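(* Let $\emptyset \neq \omega \subseteq G \Subset \Omega \subset \mathbb{R}^n$ be bounded domains, and let $\alpha\in(0,1]$ be an exponent for which the propagation of smallness estimate holds, i.e., there is a constant $C_0$ such that $$\|w\|_{L_2(G)} \le C_0 \|w\|_{L_2(\omega)}^{\alpha}\,\|w\|_{L_2(\Omega)}^{1-\alpha}\quad\text{for all harmonic } w\in L_2(\Omega).$$ Define $A=(B,C)\in\mathcal{L}\big(L_2(\Omega),H^{-2}(\Omega)\times L_2(\omega)\big)$ by $$(Bz)(v):=-\int_\Omega z\,\Delta v\,dx\quad (v\in H^2_0(\Omega)),\qquad Cz:=z|_\omega .$$ Then there exists a constant $K$ such that for all $z\in L_2(\Omega)$, $$\|z\|_{L_2(G)} \le K\, \|Az\|_{H^{-2}(\Omega)\times L_2(\omega)}^{\alpha}\,\big(\|z\|_{L_2(\Omega)}+\|Az\|_{H^{-2}(\Omega)\times L_2(\omega)}\big)^{1-\alpha}.$$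
   Context: A domain is a non-empty open connected set; $D\Subset E$ means that $\overline{D}$ is a compact subset of $E$. $H^{-2}(\Omega)$ is the dual of $H^2_0(\Omega)$, where $H^2_0(\Omega)$ is the closure of the smooth compactly supported functions in $H^2(\Omega)$. The norm on $H^{-2}(\Omega)\times L_2(\omega)$ is the product norm $(\|\cdot\|_{H^{-2}(\Omega)}^2+\|\cdot\|_{L_2(\omega)}^2)^{1/2}$. It is a known result that, when $\omega\Subset G\Subset\Omega$, an exponent $\alpha\in(0,1)$ as in the claim exists; for $G=\omega$ one may take $\alpha=1$. All spaces are real. When $\alpha=1$, factors with exponent $1-\alpha=0$ are read as $1$. *)

theory Defs
  imports "HOL-Analysis.Analysis"
begin

definition domain :: "(real ^ 'n) set \<Rightarrow> bool" where
  "domain S \<longleftrightarrow> S \<noteq> {} \<and> open S \<and> connected S"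

definition compactly_in :: "(real ^ 'n) set \<Rightarrow> (real ^ 'n) set \<Rightarrow> bool" where
  "compactly_in D E \<longleftrightarrow> compact (closure D) \<and> closure D \<subseteq> E"

text \<open>The convention \<open>x\<^sup>0 = 1\<close> has to be added for \<open>x = 0\<close>, because \<open>0 powr 0 = 0\<close>.\<close>

definition rpow :: "real \<Rightarrow> real \<Rightarrow> real" where
  "rpow x a = (if a = 0 then 1 else x powr a)"


section \<open>Classical derivatives\<close>

definition pd :: "'n \<Rightarrow> (real ^ 'n \<Rightarrow> real) \<Rightarrow> real ^ 'n \<Rightarrow> real" where
  "pd i f = (\<lambda>x. frechet_derivative f (at x) (axis i 1))"

definition pds :: "'n list \<Rightarrow> (real ^ 'n \<Rightarrow> real) \<Rightarrow> real ^ 'n \<Rightarrow> real" where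
  "pds is f = foldr pd is f"

text \<open>\<open>Ck_on k S f\<close> is only meant for open \<open>S\<close>; it does not depend on \<open>f\<close> outside \<open>S\<close>.\<close>

fun Ck_on :: "nat \<Rightarrow> (real ^ 'n) set \<Rightarrow> (real ^ 'n \<Rightarrow> real) \<Rightarrow> bool" where
  "Ck_on 0 S f \<longleftrightarrow> continuous_on S f"
| "Ck_on (Suc k) S f \<longleftrightarrow> (\<forall>x\<in>S. f differentiable (at x)) \<and> (\<forall>i. Ck_on k S (pd i f))"

definition harmonic_on :: "(real ^ 'n) set \<Rightarrow> (real ^ 'n \<Rightarrow> real) \<Rightarrow> bool" where
  "harmonic_on S w \<longleftrightarrow> Ck_on 2 S w \<and> (\<forall>x\<in>S. (\<Sum>i\<in>UNIV. pds [i, i] w x) = 0)"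

definition test_funs :: "(real ^ 'n) set \<Rightarrow> (real ^ 'n \<Rightarrow> real) set" where
  "test_funs S = {\<phi>. (\<forall>k. Ck_on k UNIV \<phi>) \<and> compactly_in {x. \<phi> x \<noteq> 0} S}"


section \<open>Lebesgue and Sobolev spaces\<close>

text \<open>
  The elements of all spaces are functions on the whole of \<open>real ^ 'n\<close> rather than classes
  of functions on \<open>S\<close>; only their values on \<open>S\<close>, up to null sets, matter.
\<close>

definition L2 :: "(real ^ 'n) set \<Rightarrow> (real ^ 'n \<Rightarrow> real) set" where
  "L2 S = {f. f \<in> borel_measurable (lebesgue_on S) \<and> integrable (lebesgue_on S) (\<lambda>x. (f x)\<^sup>2)}"

definition L2_norm :: "(real ^ 'n) set \<Rightarrow> (real ^ 'n \<Rightarrow> real) \<Rightarrow> real" where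
  "L2_norm S f = sqrt (\<integral>x. (f x)\<^sup>2 \<partial>lebesgue_on S)"

definition is_weak_pds ::
  "(real ^ 'n) set \<Rightarrow> 'n list \<Rightarrow> (real ^ 'n \<Rightarrow> real) \<Rightarrow> (real ^ 'n \<Rightarrow> real) \<Rightarrow> bool" where
  "is_weak_pds S is u g \<longleftrightarrow>
     (\<forall>\<phi>\<in>test_funs S. (\<integral>x. u x * pds is \<phi> x \<partial>lebesgue_on S)
        = (- 1) ^ length is * (\<integral>x. g x * \<phi> x \<partial>lebesgue_on S))"

text \<open>Weak derivatives in \<open>L2 S\<close> are unique up to null sets, so the choice is immaterial.\<close>

definition weak_pds ::
  "(real ^ 'n) set \<Rightarrow> 'n list \<Rightarrow> (real ^ 'n \<Rightarrow> real) \<Rightarrow> real ^ 'n \<Rightarrow> real" where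
  "weak_pds S is u = (SOME g. g \<in> L2 S \<and> is_weak_pds S is u g)"

definition H2 :: "(real ^ 'n) set \<Rightarrow> (real ^ 'n \<Rightarrow> real) set" where
  "H2 S = {u \<in> L2 S. \<forall>is. length is \<le> 2 \<longrightarrow> (\<exists>g\<in>L2 S. is_weak_pds S is u g)}"

text \<open>
  The sum runs over all index lists of length at most 2, i.e. over \<open>u\<close>, all entries of its
  gradient and all entries of its Hessian matrix.
\<close>

definition H2_norm :: "(real ^ 'n) set \<Rightarrow> (real ^ 'n \<Rightarrow> real) \<Rightarrow> real" where
  "H2_norm S u = sqrt (\<Sum>is | length is \<le> 2. (L2_norm S (weak_pds S is u))\<^sup>2)"

definition H20 :: "(real ^ 'n) set \<Rightarrow> (real ^ 'n \<Rightarrow> real) set" where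
  "H20 S = {u \<in> H2 S. \<forall>e>0. \<exists>\<phi>\<in>test_funs S. H2_norm S (\<lambda>x. u x - \<phi> x) < e}"

definition Hm2_norm :: "(real ^ 'n) set \<Rightarrow> ((real ^ 'n \<Rightarrow> real) \<Rightarrow> real) \<Rightarrow> real" where
  "Hm2_norm S F = (SUP v\<in>{v \<in> H20 S. H2_norm S v \<le> 1}. \<bar>F v\<bar>)"


section \<open>The operators\<close>

definition weak_laplacian :: "(real ^ 'n) set \<Rightarrow> (real ^ 'n \<Rightarrow> real) \<Rightarrow> real ^ 'n \<Rightarrow> real" where
  "weak_laplacian S v = (\<lambda>x. \<Sum>i\<in>UNIV. weak_pds S [i, i] v x)"

definition opB :: "(real ^ 'n) set \<Rightarrow> (real ^ 'n \<Rightarrow> real) \<Rightarrow> (real ^ 'n \<Rightarrow> real) \<Rightarrow> real" where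
  "opB \<Omega> z = (\<lambda>v\<in>H20 \<Omega>. - (\<integral>x. z x * weak_laplacian \<Omega> v x \<partial>lebesgue_on \<Omega>))"

definition opC :: "(real ^ 'n) set \<Rightarrow> (real ^ 'n \<Rightarrow> real) \<Rightarrow> real ^ 'n \<Rightarrow> real" where
  "opC \<omega> z = restrict z \<omega>"

definition opA :: "(real ^ 'n) set \<Rightarrow> (real ^ 'n) set \<Rightarrow> (real ^ 'n \<Rightarrow> real)
    \<Rightarrow> ((real ^ 'n \<Rightarrow> real) \<Rightarrow> real) \<times> (real ^ 'n \<Rightarrow> real)" where
  "opA \<Omega> \<omega> z = (opB \<Omega> z, opC \<omega> z)"

definition data_norm :: "(real ^ 'n) set \<Rightarrow> (real ^ 'n) set
    \<Rightarrow> ((real ^ 'n \<Rightarrow> real) \<Rightarrow> real) \<times> (real ^ 'n \<Rightarrow> real) \<Rightarrow> real" where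
  "data_norm \<Omega> \<omega> y = sqrt ((Hm2_norm \<Omega> (fst y))\<^sup>2 + (L2_norm \<omega> (snd y))\<^sup>2)"

text \<open>The supremum defining the dual norm of \<open>opB \<Omega> z\<close> is that of a bounded set.\<close>

lemma weak_pds_L2:
  assumes "v \<in> H2 S" "length is \<le> 2"
  shows "weak_pds S is v \<in> L2 S" and "is_weak_pds S is v (weak_pds S is v)"
proof -
  have "\<exists>g. g \<in> L2 S \<and> is_weak_pds S is v g"
    using assms unfolding H2_def by blast
  then have "weak_pds S is v \<in> L2 S \<and> is_weak_pds S is v (weak_pds S is v)"
    unfolding weak_pds_def by (rule someI_ex)
  then show "weak_pds S is v \<in> L2 S" "is_weak_pds S is v (weak_pds S is v)"
    by auto
qed

lemma L2_norm_weak_pds_le: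
  fixes S :: "(real ^ 'n) set"
  assumes "length is \<le> 2"
  shows "(L2_norm S (weak_pds S is v))\<^sup>2 \<le> (H2_norm S v)\<^sup>2"
proof -
  have fin: "finite {is :: 'n list. length is \<le> 2}"
    using finite_lists_length_le[of "UNIV :: 'n set" 2] by simp
  have "(L2_norm S (weak_pds S is v))\<^sup>2
      \<le> (\<Sum>is | length is \<le> 2. (L2_norm S (weak_pds S is v))\<^sup>2)"
    by (rule member_le_sum[where f = "\<lambda>is. (L2_norm S (weak_pds S is v))\<^sup>2"]) (use assms fin in auto)
  also have "\<dots> = (H2_norm S v)\<^sup>2"
    unfolding H2_norm_def by (simp add: sum_nonneg)
  finally show ?thesis .
qed

lemma L2_mult_integrable:
  assumes f: "f \<in> L2 S" and g: "g \<in> L2 S"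
  shows "integrable (lebesgue_on S) (\<lambda>x. f x * g x)"
    and "\<bar>\<integral>x. f x * g x \<partial>lebesgue_on S\<bar> \<le> (L2_norm S f)\<^sup>2 + (L2_norm S g)\<^sup>2"
proof -
  have le: "\<bar>a * b\<bar> \<le> a\<^sup>2 + b\<^sup>2" for a b :: real
  proof -
    have "0 \<le> (\<bar>a\<bar> - \<bar>b\<bar>)\<^sup>2" "0 \<le> \<bar>a\<bar> * \<bar>b\<bar>" by auto
    then have "2 * (\<bar>a\<bar> * \<bar>b\<bar>) \<le> a\<^sup>2 + b\<^sup>2" by (simp add: power2_diff)
    with \<open>0 \<le> \<bar>a\<bar> * \<bar>b\<bar>\<close> show ?thesis unfolding abs_mult by linarith
  qed
  have int: "integrable (lebesgue_on S) (\<lambda>x. (f x)\<^sup>2 + (g x)\<^sup>2)"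
    using f g by (auto simp: L2_def)
  show int': "integrable (lebesgue_on S) (\<lambda>x. f x * g x)"
    by (rule Bochner_Integration.integrable_bound[OF int])
       (use f g le in \<open>auto simp: L2_def\<close>)
  have "\<bar>\<integral>x. f x * g x \<partial>lebesgue_on S\<bar> \<le> (\<integral>x. \<bar>f x * g x\<bar> \<partial>lebesgue_on S)"
    by (rule integral_abs_bound)
  also have "\<dots> \<le> (\<integral>x. (f x)\<^sup>2 + (g x)\<^sup>2 \<partial>lebesgue_on S)"
    by (rule integral_mono) (use int int' le in auto)
  also have "\<dots> = (L2_norm S f)\<^sup>2 + (L2_norm S g)\<^sup>2"
    using f g by (simp add: L2_def L2_norm_def)
  finally show "\<bar>\<integral>x. f x * g x \<partial>lebesgue_on S\<bar> \<le> (L2_norm S f)\<^sup>2 + (L2_norm S g)\<^sup>2" .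
qed

lemma bdd_above_opB:
  fixes \<Omega> :: "(real ^ 'n) set"
  assumes z: "z \<in> L2 \<Omega>"
  shows "bdd_above ((\<lambda>v. \<bar>opB \<Omega> z v\<bar>) ` {v \<in> H20 \<Omega>. H2_norm \<Omega> v \<le> 1})"
proof (rule bdd_aboveI2)
  fix v assume v: "v \<in> {v \<in> H20 \<Omega>. H2_norm \<Omega> v \<le> 1}"
  have v2: "v \<in> H2 \<Omega>" using v by (simp add: H20_def)
  let ?w = "\<lambda>i. weak_pds \<Omega> [i, i] v"
  have w: "?w i \<in> L2 \<Omega>" for i using weak_pds_L2[OF v2, of "[i, i]"] by simp
  have H: "0 \<le> H2_norm \<Omega> v" unfolding H2_norm_def by (intro real_sqrt_ge_zero sum_nonneg) auto
  have n: "(L2_norm \<Omega> (?w i))\<^sup>2 \<le> 1" for i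
  proof -
    have "(L2_norm \<Omega> (?w i))\<^sup>2 \<le> (H2_norm \<Omega> v)\<^sup>2" by (rule L2_norm_weak_pds_le) simp
    also have "\<dots> \<le> 1" using v H by (simp add: power_le_one)
    finally show ?thesis .
  qed
  have "\<bar>opB \<Omega> z v\<bar> = \<bar>\<Sum>i\<in>UNIV. \<integral>x. z x * ?w i x \<partial>lebesgue_on \<Omega>\<bar>"
    using v L2_mult_integrable(1)[OF z w]
    by (simp add: opB_def weak_laplacian_def sum_distrib_left)
  also have "\<dots> \<le> (\<Sum>i\<in>UNIV. \<bar>\<integral>x. z x * ?w i x \<partial>lebesgue_on \<Omega>\<bar>)"
    by (rule sum_abs)
  also have "\<dots> \<le> (\<Sum>i\<in>(UNIV :: 'n set). (L2_norm \<Omega> z)\<^sup>2 + 1)"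
    by (rule sum_mono) (use L2_mult_integrable(2)[OF z w] n in \<open>smt (verit)\<close>)
  finally show "\<bar>opB \<Omega> z v\<bar> \<le> (\<Sum>i\<in>(UNIV :: 'n set). (L2_norm \<Omega> z)\<^sup>2 + 1)" .
qed

end

theory Submission
  imports Defs
begin

text \<open>
  Split \<open>z = w + v\<close> orthogonally in \<open>L2 \<Omega>\<close>, where \<open>v\<close> lies in the closure of the Laplacians of test
  functions. Integrating by parts and using the Poincare inequality, \<open>H2_norm \<Omega> \<phi> \<le> C * L2_norm \<Omega> (\<Delta> \<phi>)\<close>
  for test functions \<open>\<phi>\<close>; testing \<open>B z\<close> with them gives that the norm of \<open>v\<close> is at most \<open>C\<close> times that of
  \<open>B z\<close>. The function \<open>w\<close> is orthogonal to all Laplacians of test functions, hence harmonic by Weyl's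
  lemma, so the propagation of smallness estimate applies to it; \<open>v\<close> only contributes multiples of the
  data norm to each of the norms involved.

  For Weyl's lemma, radial mollifiers \<open>moll c\<close> are used for which \<open>d/dc moll c\<close> is the Laplacian of a test
  function. Mollifying a weakly harmonic function therefore gives the same result on all small scales,
  and this common smooth function is the harmonic representative.
\<close>

section \<open>Smooth functions\<close>

text \<open>The bound on \<open>v\<close> is a duality argument. If \<open>lap \<phi>\<close> is
  close to \<open>v\<close>, the square of the norm of \<open>v\<close> is nearly the pairing of
  \<open>v\<close> with \<open>lap \<phi>\<close>, which equals that of \<open>z\<close> with
  \<open>lap \<phi>\<close>, that is - (B z)(\<phi>); it is at most the dual norm of
  \<open>B z\<close> times \<open>C\<close> times the norm of \<open>lap \<phi>\<close>. Only test
  functions are ever paired with \<open>B z\<close>, so no equation is solved in \<open>H20\<close>.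

  The mollifiers have the form c^n m(c u). The derivative in c of such a mass-preserving scaling is
  the divergence of a radial field, hence the Laplacian of a radial function. Taking a derivative as
  profile makes that function explicit and compactly supported, so weak harmonicity can be applied
  to it.

  Two gaps separate the definitions from the analysis: weak derivatives are chosen representatives,
  and elements of \<open>L2 S\<close> are Lebesgue measurable functions with arbitrary values off
  \<open>S\<close>. The fundamental lemma closes the first gap, Borel representatives extended by
  zero the second.\<close>

definition smooth :: "(real ^ 'n \<Rightarrow> real) \<Rightarrow> bool" where
  "smooth f \<longleftrightarrow> (\<forall>k. Ck_on k UNIV f)"

lemma sum_axis_mult [simp]: "(\<Sum>j\<in>UNIV. axis i 1 $ j * a j) = (a i :: real)"
proof -
  have "(\<Sum>j\<in>UNIV. axis i 1 $ j * a j) = (\<Sum>j\<in>UNIV. if j = i then a j else 0)"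
    by (intro sum.cong) (auto simp: axis_def)
  then show ?thesis by simp
qed

lemma pd_eqI: "(f has_derivative f') (at x) \<Longrightarrow> pd i f x = f' (axis i 1)"
  unfolding pd_def by (simp add: frechet_derivative_at[symmetric])

text \<open>Linearity and expansion of the increment in the standard basis. Derivatives are kept in
  this coordinate form, so that \<open>pd_eqI\<close> reads off a partial derivative by inserting
  \<open>axis i 1\<close>.\<close>

lemma differentiable_has_derivative_pd:
  assumes "f differentiable (at x)"
  shows "(f has_derivative (\<lambda>h. \<Sum>i\<in>UNIV. h $ i * pd i f x)) (at x)"
proof -
  have d: "(f has_derivative frechet_derivative f (at x)) (at x)"
    using assms frechet_derivative_works by blast
  then interpret bounded_linear "frechet_derivative f (at x)" by (rule has_derivative_bounded_linear)
  have "frechet_derivative f (at x) h = (\<Sum>i\<in>UNIV. h $ i * pd i f x)" for h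
  proof -
    have "frechet_derivative f (at x) h = frechet_derivative f (at x) (\<Sum>i\<in>UNIV. h $ i *s axis i 1)"
      by (simp only: basis_expansion)
    also have "\<dots> = (\<Sum>i\<in>UNIV. h $ i * pd i f x)"
      by (simp add: sum scaleR pd_def scalar_mult_eq_scaleR)
    finally show ?thesis .
  qed
  then have "frechet_derivative f (at x) = (\<lambda>h. \<Sum>i\<in>UNIV. h $ i * pd i f x)" by blast
  with d show ?thesis by simp
qed

lemma Ck_on_Suc_imp: "Ck_on (Suc k) S f \<Longrightarrow> Ck_on k S f"
proof (induction k arbitrary: f)
  case 0
  then show ?case
    by (auto intro!: differentiable_imp_continuous_on differentiable_at_imp_differentiable_on)
next
  case (Suc k)
  then show ?case by (metis Ck_on.simps(2))
qed

lemma smooth_differentiable: "smooth f \<Longrightarrow> f differentiable (at x)"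
  unfolding smooth_def by (drule spec[of _ 1]) simp

lemma smooth_pd: "smooth f \<Longrightarrow> smooth (pd i f)"
  unfolding smooth_def using Ck_on.simps(2) by blast

lemma smooth_continuous_on: "smooth f \<Longrightarrow> continuous_on S f"
  unfolding smooth_def by (metis Ck_on.simps(1) continuous_on_subset subset_UNIV)

lemmas smooth_has_derivative = differentiable_has_derivative_pd[OF smooth_differentiable]

text \<open>Continuity at each order follows from differentiability there, so only differentiability
  and closure under \<open>pd\<close> remain to be checked. This suits families indexed by a kernel,
  such as reflections and convolutions.\<close>

lemma smooth_coinduct:
  assumes "P f" and "\<And>f x. P f \<Longrightarrow> f differentiable (at x)" and "\<And>f i. P f \<Longrightarrow> P (pd i f)"
  shows "smooth f"
proof -
  have "P f \<Longrightarrow> Ck_on k UNIV f" for k f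
  proof (induction k arbitrary: f)
    case 0
    then show ?case
      using assms(2) by (auto intro!: continuous_at_imp_continuous_on differentiable_imp_continuous_within)
  qed (use assms in auto)
  with assms(1) show ?thesis unfolding smooth_def by blast
qed

lemma pd_add:
  "f differentiable (at x) \<Longrightarrow> g differentiable (at x) \<Longrightarrow> pd i (\<lambda>x. f x + g x) x = pd i f x + pd i g x"
  by (rule pd_eqI[OF has_derivative_add[OF differentiable_has_derivative_pd differentiable_has_derivative_pd], THEN trans])
     (auto simp: sum_negf)

lemma pd_mult:
  "f differentiable (at x) \<Longrightarrow> g differentiable (at x) \<Longrightarrow>
   pd i (\<lambda>x. f x * g x) x = pd i f x * g x + f x * pd i g x"
  by (rule pd_eqI[OF has_derivative_mult[OF differentiable_has_derivative_pd differentiable_has_derivative_pd], THEN trans])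
     (auto simp: sum_negf)

lemma pd_const [simp]: "pd i (\<lambda>x. c) = (\<lambda>x. 0)"
  by (rule ext, rule pd_eqI[THEN trans]) (auto intro!: derivative_eq_intros)

lemma pd_coord: "pd i (\<lambda>x. x $ j) = (\<lambda>x. if i = j then 1 else 0)"
  by (rule ext, rule pd_eqI[OF bounded_linear_imp_has_derivative[OF bounded_linear_vec_nth], THEN trans])
     (auto simp: axis_def)

lemma smooth_const [simp]: "smooth (\<lambda>x. c)"
  by (rule smooth_coinduct[where P = "\<lambda>f. \<exists>c. f = (\<lambda>x. c)"]) auto

lemma smooth_coord [simp]: "smooth (\<lambda>x :: real ^ 'n. x $ j)"
proof (rule smooth_coinduct[where P = "\<lambda>f. smooth f \<or> f = (\<lambda>x. x $ j)"])
  show "f differentiable (at x)" if "smooth f \<or> f = (\<lambda>x. x $ j)" for f :: "real ^ 'n \<Rightarrow> real" and x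
    using that bounded_linear_imp_differentiable[OF bounded_linear_vec_nth] smooth_differentiable by blast
  show "smooth (pd i f) \<or> pd i f = (\<lambda>x. x $ j)" if "smooth f \<or> f = (\<lambda>x. x $ j)" for f :: "real ^ 'n \<Rightarrow> real" and i
    using that by (auto simp: smooth_pd pd_coord)
qed auto

lemma Ck_add: "Ck_on k UNIV f \<Longrightarrow> Ck_on k UNIV g \<Longrightarrow> Ck_on k UNIV (\<lambda>x. f x + g x)"
proof (induction k arbitrary: f g)
  case 0
  then show ?case by (auto intro: continuous_intros)
next
  case (Suc k)
  then have "pd i (\<lambda>x. f x + g x) = (\<lambda>x. pd i f x + pd i g x)" for i
    by (auto simp: pd_add)
  with Suc show ?case by auto
qed

text \<open>The product rule turns a product into a sum of products, so the induction runs over the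
  order, with \<open>Ck_add\<close> for the sum and \<open>Ck_on_Suc_imp\<close> for the factor left
  undifferentiated.\<close>

lemma Ck_mult: "Ck_on k UNIV f \<Longrightarrow> Ck_on k UNIV g \<Longrightarrow> Ck_on k UNIV (\<lambda>x. f x * g x)"
proof (induction k arbitrary: f g)
  case 0
  then show ?case by (auto intro: continuous_intros)
next
  case (Suc k)
  then have "pd i (\<lambda>x. f x * g x) = (\<lambda>x. pd i f x * g x + f x * pd i g x)" for i
    by (auto simp: pd_mult)
  with Suc show ?case
    using Ck_on_Suc_imp[OF Suc.prems(1)] Ck_on_Suc_imp[OF Suc.prems(2)] by (auto intro!: Ck_add Suc.IH)
qed

lemma smooth_add: "smooth f \<Longrightarrow> smooth g \<Longrightarrow> smooth (\<lambda>x. f x + g x)"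
  by (simp add: smooth_def Ck_add)

lemma smooth_mult: "smooth f \<Longrightarrow> smooth g \<Longrightarrow> smooth (\<lambda>x. f x * g x)"
  by (simp add: smooth_def Ck_mult)

lemma smooth_minus: "smooth f \<Longrightarrow> smooth (\<lambda>x. - f x)"
  using smooth_mult[of "\<lambda>x. -1" f] by simp

lemma smooth_diff: "smooth f \<Longrightarrow> smooth g \<Longrightarrow> smooth (\<lambda>x. f x - g x)"
  using smooth_add[OF _ smooth_minus, of f g] by simp

lemma smooth_sum: "(\<And>i. i \<in> A \<Longrightarrow> smooth (f i)) \<Longrightarrow> smooth (\<lambda>x. \<Sum>i\<in>A. f i x)"
  by (induction A rule: infinite_finite_induct) (auto intro: smooth_add)

lemma smooth_prod: "(\<And>i. i \<in> A \<Longrightarrow> smooth (f i)) \<Longrightarrow> smooth (\<lambda>x. \<Prod>i\<in>A. f i x)"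
  by (induction A rule: infinite_finite_induct) (auto intro: smooth_mult)

lemma smooth_norm_sq: "smooth (\<lambda>x. (norm (x - a))\<^sup>2)"
proof -
  have "(\<lambda>x. (norm (x - a))\<^sup>2) = (\<lambda>x. \<Sum>i\<in>UNIV. (x $ i - a $ i) * (x $ i - a $ i))"
    by (simp add: power2_norm_eq_inner inner_vec_def)
  then show ?thesis by (auto intro!: smooth_sum smooth_mult smooth_diff)
qed

lemma pd_cmult: "f differentiable (at x) \<Longrightarrow> pd i (\<lambda>x. c * f x) x = c * pd i f x"
  by (simp add: pd_mult)

lemma pd_compose:
  assumes "(e has_real_derivative e') (at (f x))" "f differentiable (at x)"
  shows "pd i (\<lambda>x. e (f x)) x = e' * pd i f x"
proof -
  have "((\<lambda>x. e (f x)) has_derivative (\<lambda>h. e' * (\<Sum>i\<in>UNIV. h $ i * pd i f x))) (at x)"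
    using has_derivative_compose[OF differentiable_has_derivative_pd[OF assms(2)]
      assms(1)[unfolded has_field_derivative_def]] by simp
  from pd_eqI[OF this] show ?thesis by (simp add: sum_negf)
qed

text \<open>\<open>e m\<close> plays the role of the \<open>m\<close>-th derivative of
  \<open>e 0\<close>. With all derivatives given as one family, the chain rule only moves from
  \<open>e m\<close> to \<open>e (Suc m)\<close>, and the induction is uniform in
  \<open>m\<close>.\<close>

lemma smooth_compose:
  fixes e :: "nat \<Rightarrow> real \<Rightarrow> real"
  assumes e: "\<And>m t. (e m has_real_derivative e (Suc m) t) (at t)" and f: "smooth f"
  shows "smooth (\<lambda>x. e m (f x))"
proof -
  have d: "(\<lambda>x. e m (f x)) differentiable (at x)" for m x
    using has_derivative_compose[OF smooth_has_derivative[OF f] e[unfolded has_field_derivative_def]]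
    by (auto simp: differentiable_def)
  have "Ck_on k UNIV (\<lambda>x. e m (f x))" for k m
  proof (induction k arbitrary: m)
    case 0
    show ?case using d
      by (auto intro!: continuous_at_imp_continuous_on differentiable_imp_continuous_within)
  next
    case (Suc k)
    have "pd i (\<lambda>x. e m (f x)) = (\<lambda>x. e (Suc m) (f x) * pd i f x)" for i
      by (rule ext) (rule pd_compose[OF e smooth_differentiable[OF f]])
    then show ?case using d Suc smooth_pd[OF f] by (auto intro!: Ck_mult simp: smooth_def)
  qed
  then show ?thesis by (simp add: smooth_def)
qed

lemma pd_cong_open:
  assumes "open U" "x \<in> U" "\<And>y. y \<in> U \<Longrightarrow> f y = g y"
  shows "pd i f x = pd i g x"
proof -
  have "(f has_derivative D) (at x) \<longleftrightarrow> (g has_derivative D) (at x)" for D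
    using assms has_derivative_transform_within_open by metis
  then show ?thesis by (simp add: pd_def frechet_derivative_def)
qed

lemma pds_cong_open:
  assumes "open U" "x \<in> U" "\<And>y. y \<in> U \<Longrightarrow> f y = g y"
  shows "pds is f x = pds is g x"
  using assms(2)
proof (induction "is" arbitrary: x)
  case Nil
  then show ?case using assms(3) by (simp add: pds_def)
next
  case (Cons i "is")
  then show ?case using pd_cong_open[OF assms(1), of x "pds is f" "pds is g"] by (simp add: pds_def)
qed

text \<open>The harmonic representative in Weyl's lemma is no single convolution: the admissible
  scale shrinks towards the boundary. Regularity is therefore checked against a smooth function that
  may depend on the point.\<close>

lemma Ck_on_cong_local:
  assumes "open S" and "\<And>x. x \<in> S \<Longrightarrow> \<exists>g U. smooth g \<and> open U \<and> x \<in> U \<and> (\<forall>y\<in>U. f y = g y)"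
  shows "Ck_on k S f"
  using assms(2)
proof (induction k arbitrary: f)
  case 0
  have "isCont f x" if x: "x \<in> S" for x
  proof -
    obtain g U where g: "smooth g" "open U" "x \<in> U" "\<forall>y\<in>U. f y = g y" using 0[OF x] by blast
    have "continuous_on U f"
      using g(4) smooth_continuous_on[OF g(1), of U] by (simp cong: continuous_on_cong)
    then show ?thesis using g(2,3) by (simp add: continuous_on_eq_continuous_at)
  qed
  then show ?case by (simp add: continuous_at_imp_continuous_on)
next
  case (Suc k)
  have "f differentiable (at x)" if x: "x \<in> S" for x
  proof -
    obtain g U where g: "smooth g" "open U" "x \<in> U" "\<forall>y\<in>U. f y = g y" using Suc.prems[OF x] by blast
    from smooth_has_derivative[OF g(1), of x]
    have "(f has_derivative (\<lambda>h. \<Sum>i\<in>UNIV. h $ i * pd i g x)) (at x)"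
      by (rule has_derivative_transform_within_open[OF _ g(2,3)]) (use g in auto)
    then show ?thesis by (auto simp: differentiable_def)
  qed
  moreover have "Ck_on k S (pd i f)" for i
  proof (rule Suc.IH)
    fix x assume "x \<in> S"
    then obtain g U where g: "smooth g" "open U" "x \<in> U" "\<forall>y\<in>U. f y = g y" using Suc.prems by blast
    then show "\<exists>g U. smooth g \<and> open U \<and> x \<in> U \<and> (\<forall>y\<in>U. pd i f y = g y)"
      by (intro exI[of _ "pd i g"] exI[of _ U]) (auto simp: smooth_pd intro!: pd_cong_open[of U])
  qed
  ultimately show ?case by simp
qed

lemma pd_reflect:
  assumes "smooth k"
  shows "pd i (\<lambda>y. c * k (x - y)) y = - c * pd i k (x - y)"
proof -
  have "((\<lambda>y. x - y) has_derivative (\<lambda>h. - h)) (at y)" by (auto intro!: derivative_eq_intros)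
  from has_derivative_compose[OF this smooth_has_derivative[OF assms]]
  have "((\<lambda>y. c * k (x - y)) has_derivative (\<lambda>h. c * (\<Sum>i\<in>UNIV. (- h) $ i * pd i k (x - y)))) (at y)"
    by (auto intro!: derivative_eq_intros)
  from pd_eqI[OF this] show ?thesis by (simp add: sum_negf)
qed

text \<open>The factor \<open>c\<close> absorbs the sign that each differentiation of
  \<open>k (x - y)\<close> in \<open>y\<close> produces, which makes the class closed under
  \<open>pd\<close>.\<close>

lemma smooth_reflect:
  assumes "smooth k"
  shows "smooth (\<lambda>y. c * k (x - y))"
proof (rule smooth_coinduct[where P = "\<lambda>f. \<exists>k c. smooth k \<and> f = (\<lambda>y. c * k (x - y))"])
  show "f differentiable (at y)" if f: "\<exists>k c. smooth k \<and> f = (\<lambda>y. c * k (x - y))" for f y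
  proof -
    obtain k c where k: "smooth k" "f = (\<lambda>y. c * k (x - y))" using f by auto
    have "((\<lambda>y. x - y) has_derivative (\<lambda>h. - h)) (at y)" by (auto intro!: derivative_eq_intros)
    from has_derivative_compose[OF this smooth_has_derivative[OF k(1)]]
    show ?thesis unfolding k by (intro differentiable_mult) (auto simp: differentiable_def)
  qed
  show "\<exists>k' c. smooth k' \<and> pd i f = (\<lambda>y. c * k' (x - y))" if f: "\<exists>k c. smooth k \<and> f = (\<lambda>y. c * k (x - y))" for f i
  proof -
    obtain k c where k: "smooth k" "f = (\<lambda>y. c * k (x - y))" using f by auto
    then show ?thesis
      by (intro exI[of _ "pd i k"] exI[of _ "- c"]) (auto simp: smooth_pd pd_reflect)
  qed
qed (use assms in auto)

lemma pds_reflect_pair: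
  assumes "smooth k"
  shows "pds [i, j] (\<lambda>y. k (x - y)) y = pds [i, j] k (x - y)"
proof -
  have "pd j (\<lambda>y. k (x - y)) = (\<lambda>y. (-1) * pd j k (x - y))"
    using pd_reflect[OF assms, of j 1] by auto
  then show ?thesis using pd_reflect[OF smooth_pd[OF assms], of i "-1"] by (simp add: pds_def)
qed

section \<open>Smooth cut-off functions on the line\<close>

definition bump :: "real poly \<Rightarrow> real \<Rightarrow> real" where
  "bump p t = (if t \<le> 0 then 0 else poly p (1 / t) * exp (- (1 / t)))"

text \<open>With s = 1/t one has d/dt = - s^2 d/ds, which sends p(s) exp(-s) to s^2 (p - p')(s)
  exp(-s). The polynomial factor thus yields a family that contains exp(-1/t) and is closed under
  differentiation.\<close>

definition bump_step :: "real poly \<Rightarrow> real poly" where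
  "bump_step p = [:0, 0, 1:] * (p - pderiv p)"

lemma poly_exp_tendsto_0: "((\<lambda>t. poly p t * exp (- t)) \<longlongrightarrow> (0::real)) at_top"
proof -
  have "((\<lambda>t. \<Sum>i\<le>degree p. coeff p i * (t ^ i / exp t)) \<longlongrightarrow> (\<Sum>i\<le>degree p. coeff p i * 0)) at_top"
    by (intro tendsto_intros tendsto_power_div_exp_0)
  moreover have "(\<lambda>t. \<Sum>i\<le>degree p. coeff p i * (t ^ i / exp t)) = (\<lambda>t. poly p t * exp (- t))"
    by (simp add: poly_altdef exp_minus field_simps sum_distrib_right sum_distrib_left divide_simps)
  ultimately show ?thesis by simp
qed

lemma bump_tendsto_0: "(bump p \<longlongrightarrow> 0) (at 0)"
proof -
  have "((\<lambda>t. poly p (inverse t) * exp (- (inverse t))) \<longlongrightarrow> 0) (at_right 0)"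
    by (rule filterlim_compose[OF poly_exp_tendsto_0 filterlim_inverse_at_top_right])
  then have "(bump p \<longlongrightarrow> 0) (at_right 0)"
    by (rule Lim_transform_eventually) (auto simp: eventually_at_filter bump_def field_simps)
  moreover have "(bump p \<longlongrightarrow> 0) (at_left 0)"
    by (rule Lim_transform_eventually[OF tendsto_const]) (auto simp: eventually_at_filter bump_def)
  ultimately show ?thesis by (simp add: filterlim_at_split)
qed

lemma bump_DERIV: "(bump p has_real_derivative bump (bump_step p) t) (at t)"
proof (cases t "0::real" rule: linorder_cases)
  case less
  have "((\<lambda>_. 0) has_real_derivative bump (bump_step p) t) (at t)"
    using less by (simp add: bump_def)
  then show ?thesis
    by (rule has_field_derivative_transform_within_open[of _ _ _ "{..<0}"]) (use less in \<open>auto simp: bump_def\<close>)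
next
  case equal
  \<comment> \<open>Dividing by \<open>h\<close> multiplies the polynomial in 1/h by its variable,
    so for h \<noteq> 0 the difference quotient at 0 is again a member of the family and tends to
    0.\<close>
  have "((\<lambda>h. (bump p (0 + h) - bump p 0) / h) \<longlongrightarrow> 0) (at 0)"
    by (rule Lim_transform_eventually[OF bump_tendsto_0[of "[:0, 1:] * p"]])
       (auto simp: eventually_at_filter bump_def)
  then show ?thesis using equal by (simp add: DERIV_def bump_def)
next
  case greater
  have "((\<lambda>t. poly p (1 / t) * exp (- (1 / t))) has_real_derivative bump (bump_step p) t) (at t)"
    using greater
    by (auto intro!: derivative_eq_intros simp: bump_def bump_step_def field_simps power2_eq_square)
  then show ?thesis
    by (rule has_field_derivative_transform_within_open[of _ _ _ "{0<..}"]) (use greater in \<open>auto simp: bump_def\<close>)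
qed

lemma smooth_bump:
  assumes "smooth f"
  shows "smooth (\<lambda>x. bump p (f x))"
  using smooth_compose[where e = "\<lambda>m. bump ((bump_step ^^ m) p)" and m = 0, OF _ assms] bump_DERIV by simp

text \<open>The second difference over a square of side \<open>h\<close> is symmetric in the two
  directions. Two applications of the mean value theorem, in either order, express it as h^2 times
  one or the other mixed derivative at a point of the square; continuity at \<open>x\<close> forbids
  a gap between them.\<close>

lemma pd_commute:
  fixes f :: "real ^ 'n \<Rightarrow> real"
  assumes f: "smooth f"
  shows "pd i (pd j f) = pd j (pd i f)"
proof
  fix x
  let ?e = "\<lambda>i. axis i 1 :: real ^ 'n"
  have line: "((\<lambda>s. g (y + s *\<^sub>R ?e i)) has_real_derivative pd i g (y + s *\<^sub>R ?e i)) (at s)"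
    if g: "smooth g" for g :: "real ^ 'n \<Rightarrow> real" and y s i
  proof -
    have "((\<lambda>s. y + s *\<^sub>R ?e i) has_derivative (\<lambda>h. h *\<^sub>R ?e i)) (at s)" by (auto intro!: derivative_eq_intros)
    note has_derivative_compose[OF this smooth_has_derivative[OF g]]
    moreover have "(\<lambda>h. h * c) = (*) c" for c :: real by (simp add: fun_eq_iff)
    ultimately show ?thesis by (simp add: has_field_derivative_def mult.assoc flip: sum_distrib_left)
  qed
  have rect: "\<exists>s t. 0 < s \<and> s < h \<and> 0 < t \<and> t < h \<and>
      f (x + h *\<^sub>R ?e a + h *\<^sub>R ?e b) - f (x + h *\<^sub>R ?e a) - f (x + h *\<^sub>R ?e b) + f x
       = h * h * pd b (pd a f) (x + s *\<^sub>R ?e a + t *\<^sub>R ?e b)" if h: "0 < h" for h a b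
  proof -
    let ?u = "\<lambda>s. f (x + h *\<^sub>R ?e b + s *\<^sub>R ?e a) - f (x + s *\<^sub>R ?e a)"
    have "(?u has_real_derivative pd a f (x + h *\<^sub>R ?e b + s *\<^sub>R ?e a) - pd a f (x + s *\<^sub>R ?e a)) (at s)" for s
      by (intro DERIV_diff line f)
    from MVT2[OF h, of ?u, OF this] obtain s where s: "0 < s" "s < h"
      "?u h - ?u 0 = h * (pd a f (x + h *\<^sub>R ?e b + s *\<^sub>R ?e a) - pd a f (x + s *\<^sub>R ?e a))" by auto
    let ?v = "\<lambda>t. pd a f (x + s *\<^sub>R ?e a + t *\<^sub>R ?e b)"
    from MVT2[OF h, of ?v, OF line[OF smooth_pd[OF f]]] obtain t where t: "0 < t" "t < h"
      "?v h - ?v 0 = h * pd b (pd a f) (x + s *\<^sub>R ?e a + t *\<^sub>R ?e b)" by auto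
    show ?thesis using s t by (intro exI[of _ s] exI[of _ t]) (auto simp: algebra_simps)
  qed
  have close: "\<exists>d>0. \<forall>s t. \<bar>s\<bar> < d \<longrightarrow> \<bar>t\<bar> < d \<longrightarrow> \<bar>g (x + s *\<^sub>R ?e a + t *\<^sub>R ?e b) - g x\<bar> < e"
    if g: "smooth g" and e: "0 < e" for g :: "real ^ 'n \<Rightarrow> real" and a b e
  proof -
    have "isCont g x" using smooth_continuous_on[OF g, of UNIV] by (simp add: continuous_on_eq_continuous_at)
    then obtain d where d: "d > 0" "\<And>y. dist y x < d \<Longrightarrow> dist (g y) (g x) < e"
      using e unfolding continuous_at_eps_delta by blast
    have "\<bar>g (x + s *\<^sub>R ?e a + t *\<^sub>R ?e b) - g x\<bar> < e" if "\<bar>s\<bar> < d / 2" "\<bar>t\<bar> < d / 2" for s t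
    proof -
      have "norm (s *\<^sub>R ?e a + t *\<^sub>R ?e b) \<le> \<bar>s\<bar> + \<bar>t\<bar>"
        by (rule norm_triangle_le) simp
      then have "dist (x + s *\<^sub>R ?e a + t *\<^sub>R ?e b) x < d" using that by (simp add: dist_norm add.assoc)
      then show ?thesis using d(2) by (auto simp: dist_real_def)
    qed
    with d(1) show ?thesis by (intro exI[of _ "d / 2"]) auto
  qed
  show "pd i (pd j f) x = pd j (pd i f) x"
  proof (rule ccontr)
    assume ne: "pd i (pd j f) x \<noteq> pd j (pd i f) x"
    define e where "e = \<bar>pd i (pd j f) x - pd j (pd i f) x\<bar> / 2"
    have e: "e > 0" using ne by (simp add: e_def)
    obtain d1 where d1: "d1 > 0" "\<And>s t. \<bar>s\<bar> < d1 \<Longrightarrow> \<bar>t\<bar> < d1 \<Longrightarrow> \<bar>pd i (pd j f) (x + s *\<^sub>R ?e j + t *\<^sub>R ?e i) - pd i (pd j f) x\<bar> < e"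
      using close[OF smooth_pd[OF smooth_pd[OF f]] e] by blast
    obtain d2 where d2: "d2 > 0" "\<And>s t. \<bar>s\<bar> < d2 \<Longrightarrow> \<bar>t\<bar> < d2 \<Longrightarrow> \<bar>pd j (pd i f) (x + s *\<^sub>R ?e i + t *\<^sub>R ?e j) - pd j (pd i f) x\<bar> < e"
      using close[OF smooth_pd[OF smooth_pd[OF f]] e] by blast
    define h where "h = min d1 d2"
    have h: "h > 0" "h \<le> d1" "h \<le> d2" using d1 d2 by (auto simp: h_def)
    obtain s t where st: "0 < s" "s < h" "0 < t" "t < h"
      "f (x + h *\<^sub>R ?e j + h *\<^sub>R ?e i) - f (x + h *\<^sub>R ?e j) - f (x + h *\<^sub>R ?e i) + f x
       = h * h * pd i (pd j f) (x + s *\<^sub>R ?e j + t *\<^sub>R ?e i)" using rect[OF h(1)] by blast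
    obtain s' t' where st': "0 < s'" "s' < h" "0 < t'" "t' < h"
      "f (x + h *\<^sub>R ?e i + h *\<^sub>R ?e j) - f (x + h *\<^sub>R ?e i) - f (x + h *\<^sub>R ?e j) + f x
       = h * h * pd j (pd i f) (x + s' *\<^sub>R ?e i + t' *\<^sub>R ?e j)" using rect[OF h(1)] by blast
    have "f (x + h *\<^sub>R ?e i + h *\<^sub>R ?e j) = f (x + h *\<^sub>R ?e j + h *\<^sub>R ?e i)" by (simp add: add_ac)
    with st(5) st'(5) have "h * h * pd i (pd j f) (x + s *\<^sub>R ?e j + t *\<^sub>R ?e i) = h * h * pd j (pd i f) (x + s' *\<^sub>R ?e i + t' *\<^sub>R ?e j)"
      by linarith
    then have "pd i (pd j f) (x + s *\<^sub>R ?e j + t *\<^sub>R ?e i) = pd j (pd i f) (x + s' *\<^sub>R ?e i + t' *\<^sub>R ?e j)"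
      using h(1) by simp
    moreover have "\<bar>pd i (pd j f) (x + s *\<^sub>R ?e j + t *\<^sub>R ?e i) - pd i (pd j f) x\<bar> < e"
      using st h by (intro d1) auto
    moreover have "\<bar>pd j (pd i f) (x + s' *\<^sub>R ?e i + t' *\<^sub>R ?e j) - pd j (pd i f) x\<bar> < e"
      using st' h by (intro d2) auto
    ultimately show False unfolding e_def by (smt (verit, best) field_sum_of_halves)
  qed
qed

section \<open>Integration by parts and the Hessian\<close>

definition cinf :: "(real ^ 'n \<Rightarrow> real) \<Rightarrow> bool" where
  "cinf f \<longleftrightarrow> smooth f \<and> bounded {x. f x \<noteq> 0}"

lemma cinf_smooth: "cinf f \<Longrightarrow> smooth f"
  by (simp add: cinf_def)

lemma test_funs_iff: "\<phi> \<in> test_funs S \<longleftrightarrow> cinf \<phi> \<and> closure {x. \<phi> x \<noteq> 0} \<subseteq> S"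
  by (auto simp: test_funs_def cinf_def smooth_def compactly_in_def)

lemma pd_support: "{x. pd i f x \<noteq> 0} \<subseteq> closure {x. f x \<noteq> 0}"
proof -
  have "pd i f x = pd i (\<lambda>_. 0) x" if "x \<notin> closure {x. f x \<noteq> 0}" for x
    using that closure_subset[of "{x. f x \<noteq> 0}"]
    by (intro pd_cong_open[of "- closure {x. f x \<noteq> 0}"]) auto
  then show ?thesis by auto
qed

lemma cinf_pd:
  assumes "cinf f"
  shows "cinf (pd i f)"
  using assms bounded_subset[OF bounded_closure pd_support[of i f]]
  by (auto simp: cinf_def smooth_pd)

lemma cinf_pds: "cinf f \<Longrightarrow> cinf (pds is f)"
  by (induction "is") (auto simp: pds_def cinf_pd)

lemma pds_support: "{x. pds is f x \<noteq> 0} \<subseteq> closure {x. f x \<noteq> 0}"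
proof (induction "is")
  case Nil
  then show ?case using closure_subset by (simp add: pds_def)
next
  case (Cons i "is")
  have "{x. pds (i # is) f x \<noteq> 0} \<subseteq> closure {x. pds is f x \<noteq> 0}"
    using pd_support[of i "pds is f"] by (simp add: pds_def)
  with Cons closure_minimal[OF Cons] show ?case by auto
qed

lemma cinf_mult: "smooth f \<Longrightarrow> cinf g \<Longrightarrow> cinf (\<lambda>x. f x * g x)"
  unfolding cinf_def by (auto intro: smooth_mult elim!: bounded_subset)

lemma cinf_add: "cinf f \<Longrightarrow> cinf g \<Longrightarrow> cinf (\<lambda>x. f x + g x)"
proof -
  assume "cinf f" "cinf g"
  moreover have "{x. f x + g x \<noteq> 0} \<subseteq> {x. f x \<noteq> 0} \<union> {x. g x \<noteq> 0}" by auto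
  ultimately show "cinf (\<lambda>x. f x + g x)"
    unfolding cinf_def
    using bounded_subset[of "{x. f x \<noteq> 0} \<union> {x. g x \<noteq> 0}" "{x. f x + g x \<noteq> 0}"] by (simp add: smooth_add)
qed

lemma cinf_0: "cinf (\<lambda>x. 0)"
  by (simp add: cinf_def)

lemma cinf_sum: "(\<And>i. i \<in> A \<Longrightarrow> cinf (f i)) \<Longrightarrow> cinf (\<lambda>x. \<Sum>i\<in>A. f i x)"
  by (induction A rule: infinite_finite_induct) (auto intro: cinf_add cinf_0)

lemma cinf_cball:
  assumes "cinf f"
  obtains R where "R > 0" "\<And>x. x \<notin> cball 0 R \<Longrightarrow> f x = 0"
proof -
  obtain R where "R > 0" "\<And>x. x \<in> {x. f x \<noteq> 0} \<Longrightarrow> norm x \<le> R"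
    using assms unfolding cinf_def bounded_pos by blast
  then show ?thesis by (intro that[of R]) auto
qed

lemma cinf_bounded:
  assumes "cinf f"
  obtains M where "M \<ge> 0" "\<And>x. \<bar>f x\<bar> \<le> M"
proof -
  obtain R where R: "\<And>x. x \<notin> cball 0 R \<Longrightarrow> f x = 0" using cinf_cball[OF assms] by blast
  have "bounded (f ` cball 0 R)"
    by (intro compact_imp_bounded compact_continuous_image smooth_continuous_on cinf_smooth assms compact_cball)
  then obtain M where M: "M > 0" "\<And>x. x \<in> cball 0 R \<Longrightarrow> \<bar>f x\<bar> \<le> M"
    by (auto simp: bounded_pos)
  show ?thesis
    by (rule that[of M]) (use M R in \<open>force+\<close>)
qed

lemma smooth_borel [measurable]: "smooth f \<Longrightarrow> f \<in> borel_measurable borel"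
  by (rule borel_measurable_continuous_onI) (rule smooth_continuous_on)

lemma cinf_integrable:
  assumes "cinf f"
  shows "integrable lborel f"
proof -
  obtain R where R: "\<And>x. x \<notin> cball 0 R \<Longrightarrow> f x = 0" using cinf_cball[OF assms] by blast
  have "integrable lborel (\<lambda>x. indicator (cball 0 R) x *\<^sub>R f x)"
    by (intro borel_integrable_compact smooth_continuous_on cinf_smooth assms compact_cball)
  moreover have "(\<lambda>x. indicator (cball 0 R) x *\<^sub>R f x) = f"
  proof
    show "indicator (cball 0 R) x *\<^sub>R f x = f x" for x
      by (cases "x \<in> cball 0 R") (simp_all add: R del: mem_cball)
  qed
  ultimately show ?thesis by simp
qed

lemma sum_mult_le_norm:
  assumes "\<And>i. \<bar>a i\<bar> \<le> b i"
  shows "\<bar>\<Sum>i\<in>UNIV. (h :: real ^ 'n) $ i * a i\<bar> \<le> (\<Sum>i\<in>UNIV. b i) * norm h"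
proof -
  have "\<bar>\<Sum>i\<in>UNIV. h $ i * a i\<bar> \<le> (\<Sum>i\<in>UNIV. \<bar>h $ i * a i\<bar>)" by (rule sum_abs)
  also have "\<dots> \<le> (\<Sum>i\<in>UNIV. norm h * b i)"
    unfolding abs_mult by (intro sum_mono mult_mono assms) (auto intro: component_le_norm_cart)
  finally show ?thesis by (simp add: sum_distrib_left mult.commute)
qed

lemma cinf_lipschitz:
  assumes f: "cinf (f :: real ^ 'n \<Rightarrow> real)"
  obtains L where "L \<ge> 0" "\<And>x y. \<bar>f x - f y\<bar> \<le> L * norm (x - y)"
proof -
  have "\<exists>M. M \<ge> 0 \<and> (\<forall>x. \<bar>pd i f x\<bar> \<le> M)" for i using cinf_bounded[OF cinf_pd[OF f]] by metis
  then obtain M where M: "\<And>i. M i \<ge> 0" "\<And>i x. \<bar>pd i f x\<bar> \<le> M i" by metis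
  have "norm (f x - f y) \<le> (\<Sum>i\<in>UNIV. M i) * norm (x - y)" for x y
  proof (rule differentiable_bound[of UNIV])
    show "(f has_derivative (\<lambda>h. \<Sum>i\<in>UNIV. h $ i * pd i f x)) (at x within UNIV)" for x
      by (rule smooth_has_derivative[OF cinf_smooth[OF f]])
    show "onorm (\<lambda>h. \<Sum>i\<in>UNIV. h $ i * pd i f x) \<le> (\<Sum>i\<in>UNIV. M i)" for x
      by (rule onorm_le) (simp add: sum_mult_le_norm M)
  qed auto
  then show ?thesis by (intro that[of "\<Sum>i\<in>UNIV. M i"]) (auto simp: M sum_nonneg)
qed

text \<open>The first derivatives are globally Lipschitz, so the mean value inequality gives a
  quadratic remainder with one constant for all base points. This uniformity is what allows the
  expansion to be integrated, both over space and against an integrable function.\<close>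

lemma cinf_quadratic:
  assumes f: "cinf (f :: real ^ 'n \<Rightarrow> real)"
  obtains M where "M \<ge> 0"
    "\<And>x h. \<bar>f (x + h) - f x - (\<Sum>i\<in>UNIV. h $ i * pd i f x)\<bar> \<le> M * (norm h)\<^sup>2"
proof -
  have "\<exists>L. L \<ge> 0 \<and> (\<forall>x y. \<bar>pd i f x - pd i f y\<bar> \<le> L * norm (x - y))" for i
    using cinf_lipschitz[OF cinf_pd[OF f]] by metis
  then obtain L where L: "\<And>i. L i \<ge> 0" "\<And>i x y. \<bar>pd i f x - pd i f y\<bar> \<le> L i * norm (x - y)" by metis
  have "\<bar>f (x + h) - f x - (\<Sum>i\<in>UNIV. h $ i * pd i f x)\<bar> \<le> (\<Sum>i\<in>UNIV. L i) * (norm h)\<^sup>2" for x h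
  proof -
    \<comment> \<open>The linear part is frozen at \<open>x\<close>, so the derivative of
      \<open>?g\<close> on the ball of radius |h| is a difference of gradients, of size at most a
      constant times |h|.\<close>
    let ?g = "\<lambda>y. f y - (\<Sum>i\<in>UNIV. y $ i * pd i f x)"
    have "norm (?g (x + h) - ?g x) \<le> ((\<Sum>i\<in>UNIV. L i) * norm h) * norm (x + h - x)"
    proof (rule differentiable_bound[of "cball x (norm h)"])
      show "(?g has_derivative (\<lambda>k. \<Sum>i\<in>UNIV. k $ i * (pd i f y - pd i f x))) (at y within cball x (norm h))" for y
      proof -
        have "((\<lambda>y. \<Sum>i\<in>UNIV. y $ i * pd i f x) has_derivative (\<lambda>k. \<Sum>i\<in>UNIV. k $ i * pd i f x)) (at y)"
          by (intro has_derivative_sum has_derivative_mult_left bounded_linear_imp_has_derivative bounded_linear_vec_nth)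
        from has_derivative_diff[OF smooth_has_derivative[OF cinf_smooth[OF f]] this]
        have "(?g has_derivative (\<lambda>k. \<Sum>i\<in>UNIV. k $ i * (pd i f y - pd i f x))) (at y)"
          by (simp add: right_diff_distrib sum_subtractf)
        then show ?thesis by (rule has_derivative_at_withinI)
      qed
      show "onorm (\<lambda>k. \<Sum>i\<in>UNIV. k $ i * (pd i f y - pd i f x)) \<le> (\<Sum>i\<in>UNIV. L i) * norm h"
        if y: "y \<in> cball x (norm h)" for y
      proof (rule onorm_le)
        fix k :: "real ^ 'n"
        have "norm (y - x) \<le> norm h" using y by (simp add: dist_norm norm_minus_commute)
        then have "\<bar>pd i f y - pd i f x\<bar> \<le> L i * norm h" for i
          using L(2)[of i y x] mult_left_mono[OF _ L(1)[of i]] order_trans by blast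
        from sum_mult_le_norm[OF this, of k]
        show "norm (\<Sum>i\<in>UNIV. k $ i * (pd i f y - pd i f x)) \<le> (\<Sum>i\<in>UNIV. L i) * norm h * norm k"
          by (simp add: sum_distrib_right)
      qed
    qed (auto simp: dist_norm)
    then show ?thesis
      by (simp add: power2_eq_square distrib_right sum.distrib mult.assoc)
  qed
  then show ?thesis by (intro that[of "\<Sum>i\<in>UNIV. L i"]) (auto simp: L sum_nonneg)
qed

section \<open>Translation invariance and integration by parts\<close>

lemma integral_shift:
  fixes f :: "'a::euclidean_space \<Rightarrow> real"
  assumes [measurable]: "f \<in> borel_measurable borel"
  shows "(\<integral>x. f (c + x) \<partial>lborel) = (\<integral>x. f x \<partial>lborel)"
proof -
  have "(\<integral>x. f x \<partial>lborel) = (\<integral>x. f x \<partial>distr lborel borel ((+) c))" by (simp add: lborel_distr_plus)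
  also have "\<dots> = (\<integral>x. f (c + x) \<partial>lborel)" by (rule integral_distr) auto
  finally show ?thesis by simp
qed

lemma integrable_shift:
  fixes f :: "'a::euclidean_space \<Rightarrow> real"
  assumes "integrable lborel f"
  shows "integrable lborel (\<lambda>x. f (c + x))"
proof -
  have "integrable (distr lborel borel ((+) c)) f" using assms by (simp add: lborel_distr_plus)
  moreover have "f \<in> borel_measurable borel" using assms by simp
  ultimately show ?thesis by (simp add: integrable_distr_eq)
qed

text \<open>Translation invariance makes the integral of every difference quotient vanish.\<close>

lemma integral_pd:
  assumes f: "cinf (f :: real ^ 'n \<Rightarrow> real)"
  shows "(\<integral>x. pd i f x \<partial>lborel) = 0"
proof -
  obtain M where M: "M \<ge> 0" "\<And>x h. \<bar>f (x + h) - f x - (\<Sum>i\<in>UNIV. h $ i * pd i f x)\<bar> \<le> M * (norm h)\<^sup>2"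
    using cinf_quadratic[OF f] by blast
  obtain R0 where R0: "R0 > 0" "\<And>x. x \<notin> cball 0 R0 \<Longrightarrow> f x = 0" using cinf_cball[OF f] by blast
  obtain R1 where R1: "R1 > 0" "\<And>x. x \<notin> cball 0 R1 \<Longrightarrow> pd i f x = 0" using cinf_cball[OF cinf_pd[OF f]] by blast
  \<comment> \<open>The extra 1 leaves room for translations by less than 1: off this ball the
    function, its translate and its derivative all vanish.\<close>
  define R where "R = R0 + R1 + 1"
  define V :: real where "V = (\<integral>x. indicator (cball 0 R) x \<partial>(lborel :: (real ^ 'n) measure))"
  have iV: "integrable lborel (indicator (cball 0 R) :: real ^ 'n \<Rightarrow> real)"
    using borel_integrable_compact[of "cball 0 R" "\<lambda>_. 1 :: real"] by simp
  \<comment> \<open>The Taylor remainder is at most \<open>M\<close> h^2 and lives on one ball of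
    volume \<open>V\<close>; after division by \<open>h\<close> it is still of order
    \<open>h\<close>.\<close>
  have bound: "\<bar>\<integral>x. pd i f x \<partial>lborel\<bar> \<le> M * V * h" if h: "0 < h" "h < 1" for h
  proof -
    let ?e = "h *\<^sub>R axis i 1 :: real ^ 'n"
    let ?d = "\<lambda>x. f (?e + x) - f x - h * pd i f x"
    have i1: "integrable lborel f" "integrable lborel (pd i f)" "integrable lborel (\<lambda>x. f (?e + x))"
      by (intro cinf_integrable integrable_shift f cinf_pd)+
    have "(\<Sum>j\<in>UNIV. ?e $ j * pd j f x) = h * pd i f x" for x
      by (simp add: mult.assoc flip: sum_distrib_left)
    then have d: "\<bar>?d x\<bar> \<le> M * h\<^sup>2" for x
      using M(2)[of x ?e] by (simp add: add.commute)
    have d': "\<bar>?d x\<bar> \<le> M * h\<^sup>2 * indicator (cball 0 R) x" for x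
    proof (cases "x \<in> cball 0 R")
      case True
      then show ?thesis using d by simp
    next
      case False
      then have n: "norm x > R0 + R1 + 1" by (simp add: R_def)
      have "norm x \<le> norm (?e + x) + norm ?e" by (metis add.commute add_diff_cancel_right' norm_triangle_ineq4)
      then have "norm (?e + x) > R0" using n h R1 by simp
      then have "f (?e + x) = 0" "f x = 0" "pd i f x = 0" using R0 R1 n by auto
      then show ?thesis using False by simp
    qed
    have "h * (\<integral>x. pd i f x \<partial>lborel) = - (\<integral>x. ?d x \<partial>lborel)"
      using i1 integral_shift[of f ?e] f by (simp add: cinf_def smooth_borel)
    then have "\<bar>h * (\<integral>x. pd i f x \<partial>lborel)\<bar> = \<bar>\<integral>x. ?d x \<partial>lborel\<bar>"
      by simp
    then have "h * \<bar>\<integral>x. pd i f x \<partial>lborel\<bar> = \<bar>\<integral>x. ?d x \<partial>lborel\<bar>"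
      using h by (simp add: abs_mult)
    also have "\<dots> \<le> (\<integral>x. \<bar>?d x\<bar> \<partial>lborel)"
      by (rule integral_abs_bound)
    also have "\<dots> \<le> (\<integral>x. M * h\<^sup>2 * indicator (cball 0 R) x \<partial>(lborel :: (real ^ 'n) measure))"
      by (rule integral_mono) (use i1 iV d' in auto)
    also have "\<dots> = h * (M * V * h)" using iV by (simp add: V_def power2_eq_square)
    finally show ?thesis using h by simp
  qed
  have "((\<lambda>h. M * V * h) \<longlongrightarrow> M * V * 0) (at_right 0)" by (intro tendsto_intros)
  then have "\<bar>\<integral>x. pd i f x \<partial>lborel\<bar> \<le> M * V * 0"
    by (rule tendsto_lowerbound) (use bound in \<open>auto intro!: eventually_at_rightI[of 0 1]\<close>)
  then show ?thesis by simp
qed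

lemma integral_by_parts:
  assumes f: "smooth f" and g: "cinf g"
  shows "(\<integral>x. f x * pd i g x \<partial>lborel) = - (\<integral>x. pd i f x * g x \<partial>lborel)"
proof -
  have "pd i (\<lambda>x. f x * g x) = (\<lambda>x. pd i f x * g x + f x * pd i g x)"
    using smooth_differentiable[OF f] smooth_differentiable[OF cinf_smooth[OF g]] by (auto simp: pd_mult)
  moreover have "integrable lborel (\<lambda>x. pd i f x * g x)" "integrable lborel (\<lambda>x. f x * pd i g x)"
    by (intro cinf_integrable cinf_mult f g smooth_pd cinf_pd)+
  ultimately show ?thesis
    using integral_pd[OF cinf_mult[OF f g], of i] by simp
qed

section \<open>Derivatives up to order two bounded by the Laplacian\<close>

lemma cinf_mult_integrable:
  assumes "cinf f" "cinf g"
  shows "integrable lborel (\<lambda>x. f x * g x)"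
  by (intro cinf_integrable cinf_mult assms cinf_smooth)

lemma cinf_square_integrable: "cinf f \<Longrightarrow> integrable lborel (\<lambda>x. (f x)\<^sup>2)"
  unfolding power2_eq_square by (rule cinf_mult_integrable)

text \<open>Since the i-th coordinate has i-th derivative 1, integration by parts turns the integral
  of f^2 into -2 times that of f x_i (pd i f). Young's inequality with |x_i| \<le> \<open>R\<close>
  bounds this by half of the left-hand side, which is absorbed, plus 2 R^2 times the integral of the
  squared derivative.\<close>

lemma poincare:
  assumes f: "cinf f" and R: "\<And>x. f x \<noteq> 0 \<Longrightarrow> norm x \<le> R"
  shows "(\<integral>x. (f x)\<^sup>2 \<partial>lborel) \<le> 4 * R\<^sup>2 * (\<integral>x. (pd i f x)\<^sup>2 \<partial>lborel)"
proof -
  note [intro] = smooth_differentiable cinf_smooth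
  let ?p = "\<lambda>x. x $ i * f x"
  have c: "cinf ?p" by (intro cinf_mult smooth_coord f)
  have "pd i ?p = (\<lambda>x. f x + x $ i * pd i f x)"
  proof
    fix x
    show "pd i ?p x = f x + x $ i * pd i f x"
      using f by (subst pd_mult) (auto simp: pd_coord)
  qed
  then have "(\<integral>x. f x * (x $ i * pd i f x) \<partial>lborel) = - (\<integral>x. (f x)\<^sup>2 + f x * (x $ i * pd i f x) \<partial>lborel)"
    using integral_by_parts[OF cinf_smooth[OF c] f, of i]
    by (simp add: algebra_simps power2_eq_square)
  moreover have i1: "integrable lborel (\<lambda>x. f x * (x $ i * pd i f x))"
    by (intro cinf_mult_integrable f cinf_mult smooth_coord cinf_pd)
  moreover have i2: "integrable lborel (\<lambda>x. (f x)\<^sup>2)" "integrable lborel (\<lambda>x. (pd i f x)\<^sup>2)"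
    by (intro cinf_square_integrable f cinf_pd)+
  ultimately have *: "(\<integral>x. (f x)\<^sup>2 \<partial>lborel) = (\<integral>x. - 2 * (f x * (x $ i * pd i f x)) \<partial>lborel)" by simp
  have "(\<integral>x. - 2 * (f x * (x $ i * pd i f x)) \<partial>lborel) \<le> (\<integral>x. (f x)\<^sup>2 / 2 + 2 * R\<^sup>2 * (pd i f x)\<^sup>2 \<partial>lborel)"
  proof (rule integral_mono)
    fix x
    show "- 2 * (f x * (x $ i * pd i f x)) \<le> (f x)\<^sup>2 / 2 + 2 * R\<^sup>2 * (pd i f x)\<^sup>2"
    proof (cases "f x = 0")
      case False
      have "0 \<le> (f x + 2 * (x $ i * pd i f x))\<^sup>2" by simp
      then have "- 2 * (f x * (x $ i * pd i f x)) \<le> (f x)\<^sup>2 / 2 + 2 * (x $ i)\<^sup>2 * (pd i f x)\<^sup>2"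
        by (simp add: power2_eq_square algebra_simps)
      moreover have "\<bar>x $ i\<bar> \<le> R" using component_le_norm_cart[of x i] R[OF False] by linarith
      then have "(x $ i)\<^sup>2 \<le> R\<^sup>2" by (metis abs_ge_zero power2_abs power_mono)
      then have "2 * (x $ i)\<^sup>2 * (pd i f x)\<^sup>2 \<le> 2 * R\<^sup>2 * (pd i f x)\<^sup>2" by (simp add: mult_right_mono)
      ultimately show ?thesis by linarith
    qed simp
  qed (use i1 i2 in auto)
  also have "\<dots> = (\<integral>x. (f x)\<^sup>2 \<partial>lborel) / 2 + 2 * R\<^sup>2 * (\<integral>x. (pd i f x)\<^sup>2 \<partial>lborel)" using i2 by simp
  finally show ?thesis using * by simp
qed

definition lap :: "(real ^ 'n \<Rightarrow> real) \<Rightarrow> real ^ 'n \<Rightarrow> real" where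
  "lap f x = (\<Sum>i\<in>UNIV. pds [i, i] f x)"

lemma cinf_lap: "cinf f \<Longrightarrow> cinf (lap f)"
  unfolding lap_def[abs_def] by (intro cinf_sum cinf_pds)

text \<open>Two integrations by parts and the symmetry of derivatives move one derivative in
  direction i and one in direction j across, turning the square of each mixed derivative into the
  product of two pure ones; these products sum to the square of the Laplacian.\<close>

lemma hessian_eq_laplacian:
  assumes f: "cinf (f :: real ^ 'n \<Rightarrow> real)"
  shows "(\<Sum>i\<in>UNIV. \<Sum>j\<in>UNIV. \<integral>x. (pds [i, j] f x)\<^sup>2 \<partial>lborel) = (\<integral>x. (lap f x)\<^sup>2 \<partial>lborel)"
proof -
  note c = cinf_smooth cinf_pd f
  have *: "(\<integral>x. (pds [i, j] f x)\<^sup>2 \<partial>lborel) = (\<integral>x. pds [j, j] f x * pds [i, i] f x \<partial>lborel)" for i j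
  proof -
    have "(\<integral>x. (pds [i, j] f x)\<^sup>2 \<partial>lborel) = - (\<integral>x. pd i (pd i (pd j f)) x * pd j f x \<partial>lborel)"
      using integral_by_parts[of "pd i (pd j f)" "pd j f" i]
      by (simp add: pds_def power2_eq_square c)
    also have "pd i (pd i (pd j f)) = pd j (pd i (pd i f))"
      by (simp add: pd_commute[of _ i j] c)
    also have "- (\<integral>x. pd j (pd i (pd i f)) x * pd j f x \<partial>lborel) = (\<integral>x. pd i (pd i f) x * pd j (pd j f) x \<partial>lborel)"
      using integral_by_parts[of "pd i (pd i f)" "pd j f" j] by (simp add: c)
    finally show ?thesis by (simp add: pds_def mult.commute)
  qed
  have "(\<integral>x. (lap f x)\<^sup>2 \<partial>lborel) = (\<integral>x. (\<Sum>i\<in>UNIV. \<Sum>j\<in>UNIV. pds [j, j] f x * pds [i, i] f x) \<partial>lborel)"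
    by (simp add: lap_def power2_eq_square sum_product mult.commute)
  also have "\<dots> = (\<Sum>i\<in>UNIV. \<Sum>j\<in>UNIV. \<integral>x. pds [j, j] f x * pds [i, i] f x \<partial>lborel)"
    using cinf_mult_integrable[OF cinf_pds[OF f] cinf_pds[OF f]]
    by (simp add: integral_sum)
  finally show ?thesis by (simp add: *)
qed

text \<open>Entries of the Hessian are controlled directly. Each step down in order costs one
  Poincare inequality, that is a factor 4 R^2, and derivatives keep their support in the same
  ball.\<close>

lemma pds_le_laplacian:
  assumes f: "cinf (f :: real ^ 'n \<Rightarrow> real)" and R: "\<And>x. f x \<noteq> 0 \<Longrightarrow> norm x \<le> R" and l: "length is \<le> 2"
  shows "(\<integral>x. (pds is f x)\<^sup>2 \<partial>lborel) \<le> (1 + 4 * R\<^sup>2)\<^sup>2 * (\<integral>x. (lap f x)\<^sup>2 \<partial>lborel)"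
proof -
  let ?D = "\<integral>x. (lap f x)\<^sup>2 \<partial>lborel" and ?c = "4 * R\<^sup>2"
  have D: "?D \<ge> 0" by simp
  have "closure {x. f x \<noteq> 0} \<subseteq> cball 0 R" using R by (intro closure_minimal) auto
  then have R': "pd i f x \<noteq> 0 \<Longrightarrow> norm x \<le> R" for i x using pd_support[of i f] by auto
  have b2: "(\<integral>x. (pds [i, j] f x)\<^sup>2 \<partial>lborel) \<le> ?D" for i j
  proof -
    have "(\<integral>x. (pds [i, j] f x)\<^sup>2 \<partial>lborel) \<le> (\<Sum>j\<in>UNIV. \<integral>x. (pds [i, j] f x)\<^sup>2 \<partial>lborel)"
      by (rule member_le_sum[where f = "\<lambda>j. \<integral>x. (pds [i, j] f x)\<^sup>2 \<partial>lborel"]) auto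
    also have "\<dots> \<le> (\<Sum>i\<in>UNIV. \<Sum>j\<in>UNIV. \<integral>x. (pds [i, j] f x)\<^sup>2 \<partial>lborel)"
      by (rule member_le_sum[where f = "\<lambda>i. \<Sum>j\<in>UNIV. \<integral>x. (pds [i, j] f x)\<^sup>2 \<partial>lborel"]) (auto intro: sum_nonneg)
    finally show ?thesis using hessian_eq_laplacian[OF f] by simp
  qed
  have b1: "(\<integral>x. (pd i f x)\<^sup>2 \<partial>lborel) \<le> ?c * ?D" for i
    using poincare[OF cinf_pd[OF f, of i] R', where i = i] b2[of i i]
      mult_left_mono[of "\<integral>x. (pd i (pd i f) x)\<^sup>2 \<partial>lborel" ?D ?c] by (force simp: pds_def)
  \<comment> \<open>The Poincare inequality holds in every coordinate direction;
    \<open>undefined\<close> merely names one.\<close>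
  have b0: "(\<integral>x. (f x)\<^sup>2 \<partial>lborel) \<le> ?c * (?c * ?D)"
    using poincare[OF f R, where i = undefined] b1[of undefined]
      mult_left_mono[of "\<integral>x. (pd undefined f x)\<^sup>2 \<partial>lborel" "?c * ?D" ?c] by force
  \<comment> \<open>The square expands to 1 + 2 c + c^2 with c = 4 R^2, which dominates the three
    factors 1, c and c^2 at once.\<close>
  have e: "(1 + ?c)\<^sup>2 * ?D = ?D + 2 * (?c * ?D) + ?c * (?c * ?D)"
    by (simp add: power2_eq_square algebra_simps)
  have p: "0 \<le> ?c * ?D" "0 \<le> ?c * (?c * ?D)" using D by auto
  consider "is = []" | i where "is = [i]" | i j where "is = [i, j]"
    using l by (auto simp: le_Suc_eq numeral_2_eq_2 length_Suc_conv)
  then show ?thesis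
  proof cases
    case 1
    then have "(\<integral>x. (pds is f x)\<^sup>2 \<partial>lborel) = (\<integral>x. (f x)\<^sup>2 \<partial>lborel)" by (simp add: pds_def)
    then show ?thesis using b0 p D unfolding e by linarith
  next
    case 2
    then have "(\<integral>x. (pds is f x)\<^sup>2 \<partial>lborel) = (\<integral>x. (pd i f x)\<^sup>2 \<partial>lborel)" by (simp add: pds_def)
    then show ?thesis using b1[of i] p D unfolding e by linarith
  next
    case 3
    then have "(\<integral>x. (pds is f x)\<^sup>2 \<partial>lborel) = (\<integral>x. (pds [i, j] f x)\<^sup>2 \<partial>lborel)" by simp
    then show ?thesis using b2[of i j] p D unfolding e by linarith
  qed
qed

section \<open>The fundamental lemma of the calculus of variations\<close>

text \<open>The support is the same open box for every k > 0. Increasing \<open>k\<close> only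
  steepens the slopes, so the functions converge pointwise to the indicator of the box and stay
  below it.\<close>

definition box_bump :: "real \<Rightarrow> real ^ 'n \<Rightarrow> real ^ 'n \<Rightarrow> real ^ 'n \<Rightarrow> real" where
  "box_bump k a b x = (\<Prod>i\<in>UNIV. bump 1 (k * (x $ i - a $ i)) * bump 1 (k * (b $ i - x $ i)))"

lemma bump_1: "bump 1 t = (if t \<le> 0 then 0 else exp (- (1 / t)))"
  by (simp add: bump_def)

lemma smooth_box_bump: "smooth (box_bump k a b)"
  unfolding box_bump_def[abs_def] by (intro smooth_prod smooth_mult smooth_bump smooth_diff smooth_const smooth_coord)

lemma box_bump_support: "k > 0 \<Longrightarrow> box_bump k a b x \<noteq> 0 \<longleftrightarrow> x \<in> box a b"
  by (simp add: box_bump_def bump_1 mem_box_cart zero_less_mult_iff not_le) (auto simp: mult_le_0_iff not_le)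

lemma box_bump_bounds: "0 \<le> box_bump k a b x" "box_bump k a b x \<le> 1"
  unfolding box_bump_def by (auto intro!: prod_nonneg prod_le_1 mult_le_one simp: bump_1)

lemma box_bump_tendsto:
  fixes x :: "real ^ 'n"
  shows "(\<lambda>n. box_bump (real (Suc n)) a b x) \<longlonglongrightarrow> indicator (box a b) x"
proof (cases "x \<in> box a b")
  case True
  have lim: "(\<lambda>n. bump 1 (real (Suc n) * t)) \<longlonglongrightarrow> 1" if "t > 0" for t
  proof -
    have "(\<lambda>n. exp (- (inverse t * inverse (real (Suc n))))) \<longlonglongrightarrow> exp (- (inverse t * 0))"
      by (intro tendsto_intros LIMSEQ_inverse_real_of_nat)
    moreover have "bump 1 (real (Suc n) * t) = exp (- (inverse t * inverse (real (Suc n))))" for n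
    proof -
      have "real (Suc n) * t > 0" using that by simp
      then show ?thesis by (simp add: bump_1 not_le divide_simps)
    qed
    ultimately show ?thesis by simp
  qed
  have "(\<lambda>n. box_bump (real (Suc n)) a b x) \<longlonglongrightarrow> (\<Prod>i\<in>(UNIV :: 'n set). 1 * 1)"
    unfolding box_bump_def using True by (intro tendsto_prod tendsto_mult) (auto intro!: lim simp: mem_box_cart simp del: of_nat_Suc)
  then show ?thesis using True by simp
next
  case False
  then have "box_bump (real (Suc n)) a b x = 0" for n
    using box_bump_support[of "real (Suc n)"] by force
  then show ?thesis using False by simp
qed

lemma box_bump_test_fun:
  assumes "k > 0" "cbox a b \<subseteq> S"
  shows "box_bump k a b \<in> test_funs S"
proof -
  have "{x. box_bump k a b x \<noteq> 0} = box a b" using box_bump_support[OF assms(1)] by blast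
  moreover have "closure (box a b) \<subseteq> cbox a b" by (intro closure_minimal box_subset_cbox closed_cbox)
  ultimately show ?thesis
    using assms(2) by (auto simp: test_funs_iff cinf_def smooth_box_bump)
qed

text \<open>Testing with \<open>box_bump\<close> and dominated convergence makes the integral of
  \<open>g\<close> over small boxes vanish. Boxes generate the Borel sets, so within one such box
  all integrals of \<open>g\<close> vanish and \<open>g\<close> is zero almost everywhere; a
  Lindelof argument covers \<open>S\<close> by countably many of them. Only local integrability is
  assumed because the function built in Weyl's lemma is first known only to be continuous on
  \<open>S\<close>.\<close>

lemma fundamental_lemma:
  fixes g :: "real ^ 'n \<Rightarrow> real"
  assumes S: "open S" and g [measurable]: "g \<in> borel_measurable borel"
    and loc: "\<And>K. compact K \<Longrightarrow> K \<subseteq> S \<Longrightarrow> integrable lborel (\<lambda>x. indicator K x * g x)"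
    and z: "\<And>\<phi>. \<phi> \<in> test_funs S \<Longrightarrow> (\<integral>x. g x * \<phi> x \<partial>lborel) = 0"
  shows "AE x in lborel. x \<in> S \<longrightarrow> g x = 0"
proof -
  have int: "integrable lborel (\<lambda>x. indicator (box a b) x * g x)" if "cbox a b \<subseteq> S" for a b
  proof (rule Bochner_Integration.integrable_bound[OF loc[OF compact_cbox that]])
    show "AE x in lborel. norm (indicator (box a b) x * g x) \<le> norm (indicator (cbox a b) x * g x)"
      using box_subset_cbox[of a b] by (auto split: split_indicator)
  qed simp
  have zero: "(\<integral>x. indicator (box a b) x * g x \<partial>lborel) = 0" if ab: "cbox a b \<subseteq> S" for a b
  proof -
    have "(\<lambda>n. \<integral>x. g x * box_bump (real (Suc n)) a b x \<partial>lborel) \<longlonglongrightarrow> (\<integral>x. indicator (box a b) x * g x \<partial>lborel)"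
    proof (rule integral_dominated_convergence)
      show "integrable lborel (\<lambda>x. \<bar>indicator (box a b) x * g x\<bar>)" using int[OF ab] by simp
      show "(\<lambda>x. g x * box_bump (real (Suc n)) a b x) \<in> borel_measurable lborel" for n
        using borel_measurable_times[OF g smooth_borel[OF smooth_box_bump]] by simp
      show "AE x in lborel. (\<lambda>n. g x * box_bump (real (Suc n)) a b x) \<longlonglongrightarrow> indicator (box a b) x * g x"
        by (intro AE_I2) (subst mult.commute, intro tendsto_intros box_bump_tendsto)
      show "AE x in lborel. norm (g x * box_bump (real (Suc n)) a b x) \<le> \<bar>indicator (box a b) x * g x\<bar>" for n
      proof (rule AE_I2)
        fix x
        show "norm (g x * box_bump (real (Suc n)) a b x) \<le> \<bar>indicator (box a b) x * g x\<bar>"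
        proof (cases "x \<in> box a b")
          case True
          then show ?thesis using box_bump_bounds[of "real (Suc n)" a b x]
            by (simp add: abs_mult mult_left_le)
        next
          case False
          then have "box_bump (real (Suc n)) a b x = 0" using box_bump_support[of "real (Suc n)"] by force
          then show ?thesis by simp
        qed
      qed
    qed simp
    moreover have "(\<integral>x. g x * box_bump (real (Suc n)) a b x \<partial>lborel) = 0" for n
      by (intro z box_bump_test_fun ab) simp
    ultimately show ?thesis by (simp add: LIMSEQ_const_iff)
  qed
  have box: "AE x in lborel. x \<in> box a b \<longrightarrow> g x = 0" if ab: "cbox a b \<subseteq> S" for a b
  proof -
    define h where "h x = indicator (box a b) x * g x" for x
    have h: "integrable lborel h" using int[OF ab] by (simp add: h_def[abs_def])
    have hb: "h \<in> borel_measurable borel" using h by simp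
    have "(LINT x:A|lborel. h x) = 0" if "A \<in> sets borel" for A
    proof -
      let ?G = "range (\<lambda>(c, d). box c d :: (real ^ 'n) set)"
      have A: "A \<in> sigma_sets UNIV ?G" using that by (simp add: borel_eq_box)
      have "Int_stable ?G"
        by (auto simp: Int_stable_def box_Int_box)
      moreover have "?G \<subseteq> Pow UNIV" by simp
      ultimately show ?thesis
        using A
      proof (induction A rule: sigma_sets_induct_disjoint)
        case (basic A)
        then obtain c d where A: "A = box c d" by auto
        \<comment> \<open>Open and closed boxes intersect in boxes with the same corners. Hence the
          closed box belonging to the intersection still lies in \<open>cbox a b\<close> and so in
          \<open>S\<close>, and \<open>zero\<close> applies to it.\<close>
        have "box c d \<inter> box a b = box (\<Sum>i\<in>Basis. max (c \<bullet> i) (a \<bullet> i) *\<^sub>R i) (\<Sum>i\<in>Basis. min (d \<bullet> i) (b \<bullet> i) *\<^sub>R i)"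
          by (rule box_Int_box)
        moreover have "cbox c d \<inter> cbox a b = cbox (\<Sum>i\<in>Basis. max (c \<bullet> i) (a \<bullet> i) *\<^sub>R i) (\<Sum>i\<in>Basis. min (d \<bullet> i) (b \<bullet> i) *\<^sub>R i)"
          by (rule Int_interval)
        ultimately obtain u v where uv: "box c d \<inter> box a b = box u v" "cbox u v \<subseteq> S" using ab by blast
        have "(LINT x:A|lborel. h x) = (\<integral>x. indicator (box u v) x * g x \<partial>lborel)"
          unfolding set_lebesgue_integral_def h_def A uv(1)[symmetric]
          by (intro Bochner_Integration.integral_cong) (auto split: split_indicator)
        then show ?case using zero[OF uv(2)] by simp
      next
        case empty
        show ?case by (simp add: set_lebesgue_integral_def)
      next
        case (compl A)
        then have [measurable]: "A \<in> sets borel" by (simp add: borel_eq_box)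
        have iA: "integrable lborel (\<lambda>x. indicator A x *\<^sub>R h x)"
          using integrable_mult_indicator[OF _ h, of A] by simp
        have "(LINT x:UNIV - A|lborel. h x) = (\<integral>x. h x - indicator A x *\<^sub>R h x \<partial>lborel)"
          unfolding set_lebesgue_integral_def
          by (intro Bochner_Integration.integral_cong) (auto split: split_indicator)
        also have "\<dots> = (\<integral>x. h x \<partial>lborel) - (LINT x:A|lborel. h x)"
          using h iA by (simp add: set_lebesgue_integral_def)
        also have "\<dots> = 0" using compl zero[OF ab] by (simp add: h_def[abs_def])
        finally show ?case .
      next
        case (union A)
        then have A: "A i \<in> sets lborel" for i by (auto simp: borel_eq_box)
        have "(LINT x:(\<Union>i. A i)|lborel. h x) = (\<Sum>i. LINT x:A i|lborel. h x)"
        proof (rule lebesgue_integral_countable_add[OF A])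
          show "A i \<inter> A j = {}" if "i \<noteq> j" for i j using union(1) that by (auto simp: disjoint_family_on_def)
          show "set_integrable lborel (\<Union>i. A i) h"
            unfolding set_integrable_def by (rule integrable_mult_indicator[OF _ h]) (use A in auto)
        qed
        then show ?case using union by simp
      qed
    qed
    then have "AE x in lborel. h x = 0"
      using h by (intro density_unique_real) (auto simp: set_lebesgue_integral_def)
    then show ?thesis by (rule AE_mp) (auto simp: h_def)
  qed
  define F where "F = {(a, b). cbox a b \<subseteq> S}"
  have "\<And>U. U \<in> (\<lambda>(a, b). box a b) ` F \<Longrightarrow> open U" by auto
  then obtain F' where F': "F' \<subseteq> (\<lambda>(a, b). box a b) ` F" "countable F'" "\<Union>F' = \<Union>((\<lambda>(a, b). box a b) ` F)"
    by (rule Lindelof)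
  have ae: "AE x in lborel. \<forall>U\<in>F'. x \<in> U \<longrightarrow> g x = 0"
    using F'(1) box by (subst AE_ball_countable[OF F'(2)]) (auto simp: F_def)
  have sub: "S \<subseteq> \<Union>F'"
  proof
    fix x assume "x \<in> S"
    then obtain a b where "cbox a b \<subseteq> S" "x \<in> box a b" using open_contains_cbox[OF S] by metis
    then show "x \<in> \<Union>F'" unfolding F'(3) by (auto simp: F_def)
  qed
  from ae show ?thesis by eventually_elim (use sub in blast)
qed

section \<open>Passing between \<open>L2 S\<close> and Borel functions on the whole space\<close>

lemma L2_integrable:
  assumes "S \<in> lmeasurable" and "f \<in> L2 S"
  shows "integrable (lebesgue_on S) f"
proof -
  have "integrable (lebesgue_on S) (\<lambda>x. 1 * f x)"
    using assms by (intro L2_mult_integrable(1)[of _ S])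
       (auto simp: L2_def fmeasurable_def emeasure_restrict_space intro!: integrable_const finite_measure.integrable_const finite_measureI)
  then show ?thesis by simp
qed

text \<open>Convolution and Fubini's theorem are carried out for Borel functions with respect to
  \<open>lborel\<close>. The last clause is what transfers orthogonality relations on
  \<open>S\<close> to the representative.\<close>

lemma borel_version:
  fixes f :: "real ^ 'n \<Rightarrow> real"
  assumes S: "open S" "bounded S" and f: "f \<in> L2 S"
  obtains f' where "integrable lborel f'" "\<And>x. x \<notin> S \<Longrightarrow> f' x = 0" "AE x in lebesgue_on S. f x = f' x"
    "\<And>g. g \<in> borel_measurable borel \<Longrightarrow> (\<integral>x. f x * g x \<partial>lebesgue_on S) = (\<integral>x. f' x * g x \<partial>lborel)"
proof -
  have Sb [measurable]: "S \<in> sets borel" and Sl: "S \<in> sets lebesgue" using S(1) by auto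
  have "integrable (lebesgue_on S) f"
    by (intro L2_integrable f lmeasurable_open S)
  then have i: "integrable lebesgue (\<lambda>x. indicator S x * f x)"
    using Sl by (simp add: integrable_restrict_space)
  then obtain f0 where f0: "f0 \<in> borel_measurable lborel" "AE x in lborel. indicator S x * f x = f0 x"
    using completion_ex_borel_measurable_real[of "\<lambda>x. indicator S x * f x" lborel] by (auto intro: borel_measurable_integrable)
  have [measurable]: "f0 \<in> borel_measurable borel" using f0(1) by simp
  define f' where "f' x = indicator S x * f0 x" for x
  have m [measurable]: "f' \<in> borel_measurable borel" unfolding f'_def[abs_def] by measurable
  have ae: "AE x in lebesgue. indicator S x * f x = f' x"
    using AE_completion[OF f0(2)] by (rule AE_mp) (auto simp: f'_def split: split_indicator)
  have "integrable lebesgue f'"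
    by (rule integrable_cong_AE_imp[OF i]) (use ae m in \<open>auto simp: measurable_completion\<close>)
  then have i': "integrable lborel f'" by (simp add: integrable_completion)
  show ?thesis
  proof (rule that[of f'])
    show "AE x in lebesgue_on S. f x = f' x"
      using ae Sl by (simp add: AE_restrict_space_iff) (auto elim!: AE_mp)
    fix g :: "real ^ 'n \<Rightarrow> real" assume g [measurable]: "g \<in> borel_measurable borel"
    have "(\<integral>x. f x * g x \<partial>lebesgue_on S) = (\<integral>x. (indicator S x * f x) * g x \<partial>lebesgue)"
      using Sl by (subst integral_restrict_space) (auto simp: mult.assoc)
    also have "\<dots> = (\<integral>x. f' x * g x \<partial>lebesgue)"
    proof (rule integral_cong_AE)
      have gl: "g \<in> borel_measurable lebesgue" using g by (simp add: measurable_completion)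
      show "(\<lambda>x. indicator S x * f x * g x) \<in> borel_measurable lebesgue"
        by (rule borel_measurable_times[OF borel_measurable_integrable[OF i] gl])
      show "(\<lambda>x. f' x * g x) \<in> borel_measurable lebesgue"
        using m by (intro borel_measurable_times gl) (simp add: measurable_completion)
      show "AE x in lebesgue. indicator S x * f x * g x = f' x * g x"
        using ae by eventually_elim simp
    qed
    also have "\<dots> = (\<integral>x. f' x * g x \<partial>lborel)" by (rule integral_completion) simp
    finally show "(\<integral>x. f x * g x \<partial>lebesgue_on S) = (\<integral>x. f' x * g x \<partial>lborel)" .
  qed (use i' in \<open>auto simp: f'_def\<close>)
qed

lemma L2_zeroI:
  assumes S: "open S" "bounded S" and g: "g \<in> L2 S"
    and z: "\<And>\<phi>. \<phi> \<in> test_funs S \<Longrightarrow> (\<integral>x. g x * \<phi> x \<partial>lebesgue_on S) = 0"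
  shows "AE x in lebesgue_on S. g x = 0"
proof -
  obtain g' where g': "integrable lborel g'" "\<And>x. x \<notin> S \<Longrightarrow> g' x = 0" "AE x in lebesgue_on S. g x = g' x"
    "\<And>\<phi>. \<phi> \<in> borel_measurable borel \<Longrightarrow> (\<integral>x. g x * \<phi> x \<partial>lebesgue_on S) = (\<integral>x. g' x * \<phi> x \<partial>lborel)"
    using borel_version[OF S g] by blast
  have "AE x in lborel. x \<in> S \<longrightarrow> g' x = 0"
  proof (rule fundamental_lemma[OF S(1)])
    show "g' \<in> borel_measurable borel" using g'(1) by simp
    show "integrable lborel (\<lambda>x. indicator K x * g' x)" if "compact K" for K
      using integrable_mult_indicator[OF _ g'(1), of K] that by (simp add: compact_imp_closed borel_closed)
    show "(\<integral>x. g' x * \<phi> x \<partial>lborel) = 0" if "\<phi> \<in> test_funs S" for \<phi>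
      using z[OF that] g'(4)[of \<phi>] that by (simp add: test_funs_iff cinf_def smooth_borel)
  qed
  from AE_completion[OF this] have "AE x in lebesgue_on S. g' x = 0"
    using S(1) by (simp add: AE_restrict_space_iff)
  with g'(3) show ?thesis by eventually_elim simp
qed

lemma integral_lebesgue_on_supported:
  fixes f :: "real ^ 'n \<Rightarrow> real"
  assumes "open S" and [measurable]: "f \<in> borel_measurable borel" and "\<And>x. x \<notin> S \<Longrightarrow> f x = 0"
  shows "(\<integral>x. f x \<partial>lebesgue_on S) = (\<integral>x. f x \<partial>lborel)"
proof -
  have "(\<integral>x. f x \<partial>lebesgue_on S) = (\<integral>x. indicator S x * f x \<partial>lebesgue)"
    using assms(1) by (subst integral_restrict_space) auto
  also have "(\<lambda>x. indicator S x * f x) = f" using assms(3) by (auto split: split_indicator)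
  also have "(\<integral>x. f x \<partial>lebesgue) = (\<integral>x. f x \<partial>lborel)" by (rule integral_completion) simp
  finally show ?thesis .
qed

lemma test_funs_pds_zero:
  assumes "\<phi> \<in> test_funs S" "x \<notin> S"
  shows "pds is \<phi> x = 0"
  using assms pds_support[of "is" \<phi>] by (auto simp: test_funs_iff)

lemma L2_cinf:
  assumes "S \<in> sets lebesgue" "cinf f"
  shows "f \<in> L2 S"
proof -
  have b: "f \<in> borel_measurable borel" using assms(2) by (simp add: cinf_def smooth_borel)
  have "integrable lebesgue (\<lambda>x. (f x)\<^sup>2)"
    using cinf_square_integrable[OF assms(2)] b by (simp add: integrable_completion)
  then have "integrable (lebesgue_on S) (\<lambda>x. (f x)\<^sup>2)"
    using assms(1) integrable_mult_indicator[OF assms(1), of "\<lambda>x. (f x)\<^sup>2"] by (simp add: integrable_restrict_space)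
  moreover have "f \<in> borel_measurable (lebesgue_on S)"
    using b by (simp add: measurable_completion measurable_restrict_space1)
  ultimately show ?thesis by (simp add: L2_def)
qed

section \<open>Mollifiers changing by Laplacians\<close>

definition conv :: "(real ^ 'n \<Rightarrow> real) \<Rightarrow> (real ^ 'n \<Rightarrow> real) \<Rightarrow> real ^ 'n \<Rightarrow> real" where
  "conv w k x = (\<integral>y. w y * k (x - y) \<partial>lborel)"

lemma smooth_reflect_measurable [measurable]: "smooth k \<Longrightarrow> (\<lambda>y. k (x - y)) \<in> borel_measurable borel"
  using smooth_borel[OF smooth_reflect, of k 1 x] by simp

lemma integrable_mult_bounded:
  fixes w k :: "'a \<Rightarrow> real"
  assumes w: "integrable N w" and k: "k \<in> borel_measurable N" and B: "\<And>y. \<bar>k y\<bar> \<le> B"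
  shows "integrable N (\<lambda>y. w y * k y)"
proof (rule Bochner_Integration.integrable_bound)
  show "integrable N (\<lambda>y. B * \<bar>w y\<bar>)" using w by simp
  have "B \<ge> 0" using B[of undefined] by linarith
  show "(\<lambda>y. w y * k y) \<in> borel_measurable N" using w k by simp
  show "AE y in N. norm (w y * k y) \<le> norm (B * \<bar>w y\<bar>)"
  proof (rule AE_I2)
    fix y
    have "\<bar>k y\<bar> * \<bar>w y\<bar> \<le> B * \<bar>w y\<bar>" by (rule mult_right_mono[OF B]) simp
    then show "norm (w y * k y) \<le> norm (B * \<bar>w y\<bar>)" using \<open>B \<ge> 0\<close> by (simp add: abs_mult mult.commute)
  qed
qed

lemma abs_integral_mult_le:
  fixes w k :: "'a \<Rightarrow> real"
  assumes w: "integrable N w" and k: "k \<in> borel_measurable N" and B: "\<And>y. \<bar>k y\<bar> \<le> B"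
  shows "\<bar>\<integral>y. w y * k y \<partial>N\<bar> \<le> B * (\<integral>y. \<bar>w y\<bar> \<partial>N)"
proof -
  have "\<bar>\<integral>y. w y * k y \<partial>N\<bar> \<le> (\<integral>y. \<bar>w y * k y\<bar> \<partial>N)" by (rule integral_abs_bound)
  also have "\<dots> \<le> (\<integral>y. B * \<bar>w y\<bar> \<partial>N)"
  proof (rule integral_mono)
    show "integrable N (\<lambda>y. \<bar>w y * k y\<bar>)" using integrable_mult_bounded[OF w k B] by simp
    show "\<bar>w y * k y\<bar> \<le> B * \<bar>w y\<bar>" for y
      using mult_right_mono[OF B, of "\<bar>w y\<bar>" y] by (simp add: abs_mult mult.commute)
  qed (use w in simp)
  finally show ?thesis by simp
qed

lemma conv_integrable:
  assumes "integrable lborel w" "cinf k"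
  shows "integrable lborel (\<lambda>y. w y * k (x - y))"
proof -
  obtain B where "\<And>x. \<bar>k x\<bar> \<le> B" using cinf_bounded[OF assms(2)] by blast
  then show ?thesis
    by (intro integrable_mult_bounded assms) (auto simp: smooth_reflect_measurable cinf_smooth assms)
qed

lemma has_derivative_quadratic:
  fixes F :: "'a::real_normed_vector \<Rightarrow> real"
  assumes D: "bounded_linear D" and q: "\<And>h. \<bar>F (x + h) - F x - D h\<bar> \<le> C * (norm h)\<^sup>2"
  shows "(F has_derivative D) (at x)"
proof -
  have "((\<lambda>h. C * norm h) \<longlongrightarrow> C * norm (0::'a)) (at (0::'a))"
    by (rule tendsto_mult[OF tendsto_const tendsto_norm[OF tendsto_ident_at]])
  then have l: "((\<lambda>h. C * norm h) \<longlongrightarrow> 0) (at (0::'a))" by simp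
  have "((\<lambda>h. norm (F (x + h) - F x - D h) / norm h) \<longlongrightarrow> 0) (at 0)"
  proof (rule Lim_null_comparison[OF _ l])
    show "\<forall>\<^sub>F h in at 0. norm (norm (F (x + h) - F x - D h) / norm h) \<le> C * norm h"
      unfolding eventually_at_filter
      by (rule always_eventually) (use q in \<open>auto simp: divide_le_eq power2_eq_square mult.assoc\<close>)
  qed
  with D show ?thesis by (simp add: has_derivative_at)
qed

lemma bounded_linear_sum_coord: "bounded_linear (\<lambda>h :: real ^ 'n. \<Sum>i\<in>UNIV. h $ i * a i)"
  by (intro bounded_linear_sum bounded_linear_mult_left[THEN bounded_linear_compose] bounded_linear_vec_nth)

text \<open>The quadratic Taylor bound of the kernel is uniform in the base point, so integrating it
  against \<open>w\<close> leaves a quadratic remainder whose constant is \<open>M\<close> times the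
  integral of |w|. This is differentiation under the integral sign with an explicit error.\<close>

lemma conv_has_derivative:
  assumes w: "integrable lborel w" and k: "cinf (k :: real ^ 'n \<Rightarrow> real)"
  shows "(conv w k has_derivative (\<lambda>h. \<Sum>i\<in>UNIV. h $ i * conv w (pd i k) x)) (at x)"
proof -
  obtain M where M: "M \<ge> 0" "\<And>x h. \<bar>k (x + h) - k x - (\<Sum>i\<in>UNIV. h $ i * pd i k x)\<bar> \<le> M * (norm h)\<^sup>2"
    using cinf_quadratic[OF k] by blast
  have "\<bar>conv w k (x + h) - conv w k x - (\<Sum>i\<in>UNIV. h $ i * conv w (pd i k) x)\<bar>
      \<le> (M * (\<integral>y. \<bar>w y\<bar> \<partial>lborel)) * (norm h)\<^sup>2" for h
  proof -
    let ?r = "\<lambda>y. k (x - y + h) - k (x - y) - (\<Sum>i\<in>UNIV. h $ i * pd i k (x - y))"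
    have e: "x + h - y = x - y + h" for y by simp
    have i1: "integrable lborel (\<lambda>y. w y * k (x - y + h))"
      using conv_integrable[OF w k, of "x + h"] by (simp only: e)
    have i2: "integrable lborel (\<lambda>y. w y * (h $ i * pd i k (x - y)))" for i
      using integrable_mult_right[OF conv_integrable[OF w cinf_pd[OF k, of i], of x], of "h $ i"] by (simp add: mult_ac)
    have s: "(\<integral>y. w y * (\<Sum>i\<in>UNIV. h $ i * pd i k (x - y)) \<partial>lborel) = (\<Sum>i\<in>UNIV. h $ i * conv w (pd i k) x)"
      unfolding sum_distrib_left using i2
      by (simp add: integral_sum conv_def mult.left_commute[of _ "h $ _"])
    have i3: "integrable lborel (\<lambda>y. w y * (\<Sum>i\<in>UNIV. h $ i * pd i k (x - y)))"
      unfolding sum_distrib_left by (rule Bochner_Integration.integrable_sum) (rule i2)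
    have "conv w k (x + h) - conv w k x - (\<Sum>i\<in>UNIV. h $ i * conv w (pd i k) x) = (\<integral>y. w y * ?r y \<partial>lborel)"
      using i1 conv_integrable[OF w k, of x] i3
        using s[unfolded conv_def] by (simp add: right_diff_distrib conv_def e)
    moreover have "\<bar>\<integral>y. w y * ?r y \<partial>lborel\<bar> \<le> (M * (norm h)\<^sup>2) * (\<integral>y. \<bar>w y\<bar> \<partial>lborel)"
    proof (rule abs_integral_mult_le[OF w])
      have "(\<lambda>y. k (x - y + h)) = (\<lambda>y. k ((x + h) - y))" by (simp only: e)
      then have "(\<lambda>y. k (x - y + h)) \<in> borel_measurable borel"
        using smooth_reflect_measurable[OF cinf_smooth[OF k], of "x + h"] by simp
      then show "?r \<in> borel_measurable lborel"
        using smooth_reflect_measurable[OF cinf_smooth[OF k], of x]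
          smooth_reflect_measurable[OF cinf_smooth[OF cinf_pd[OF k]], where x = x]
        by simp
    qed (rule M)
    ultimately show ?thesis by (simp add: mult_ac)
  qed
  then show ?thesis by (intro has_derivative_quadratic bounded_linear_sum_coord)
qed

lemma pd_conv:
  assumes "integrable lborel w" and "cinf k"
  shows "pd i (conv w k) = conv w (pd i k)"
  by (rule ext, rule pd_eqI[OF conv_has_derivative[OF assms], THEN trans]) simp

lemma smooth_conv:
  assumes w: "integrable lborel w" and k: "cinf k"
  shows "smooth (conv w k)"
proof (rule smooth_coinduct[where P = "\<lambda>f. \<exists>k. cinf k \<and> f = conv w k"])
  show "f differentiable (at x)" if "\<exists>k. cinf k \<and> f = conv w k" for f x
    using that conv_has_derivative[OF w] unfolding differentiable_def by blast
  show "\<exists>k. cinf k \<and> pd i f = conv w k" if "\<exists>k. cinf k \<and> f = conv w k" for f i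
    using that pd_conv[OF w] cinf_pd by metis
qed (use k in blast)

lemma lap_conv:
  assumes w: "integrable lborel w" and k: "cinf k"
  shows "lap (conv w k) x = conv w (lap k) x"
proof -
  have "pds [i, i] (conv w k) = conv w (pds [i, i] k)" for i
    using pd_conv[OF w k, of i] pd_conv[OF w cinf_pd[OF k], of i i] by (simp add: pds_def)
  then have "lap (conv w k) x = (\<Sum>i\<in>UNIV. \<integral>y. w y * pds [i, i] k (x - y) \<partial>lborel)"
    by (simp add: lap_def conv_def)
  also have "\<dots> = conv w (lap k) x"
    using conv_integrable[OF w cinf_pds[OF k]] by (simp add: conv_def lap_def sum_distrib_left integral_sum)
  finally show ?thesis .
qed

section \<open>Radial kernels and their dependence on the scale\<close>

definition rad :: "real poly \<Rightarrow> real \<Rightarrow> real ^ 'n \<Rightarrow> real" where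
  "rad p c u = bump p (1 - c\<^sup>2 * (norm u)\<^sup>2)"

lemma rad_support:
  assumes "c > 0" "rad p c u \<noteq> 0"
  shows "norm u < 1 / c"
proof -
  have "1 - c\<^sup>2 * (norm u)\<^sup>2 > 0" using assms(2) by (auto simp: rad_def bump_def split: if_splits)
  then have "(c * norm u)\<^sup>2 < 1\<^sup>2" by (simp add: power_mult_distrib)
  then have "c * norm u < 1" by (rule power_less_imp_less_base) simp
  then show ?thesis using assms(1) by (simp add: field_simps)
qed

lemma smooth_rad: "smooth (rad p c)"
  unfolding rad_def[abs_def] using smooth_norm_sq[of 0]
  by (intro smooth_bump smooth_diff smooth_mult smooth_const) simp

lemma cinf_rad:
  assumes "c > 0"
  shows "cinf (rad p c)"
  unfolding cinf_def
proof (intro conjI smooth_rad bounded_subset[OF bounded_cball])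
  show "{x. rad p c x \<noteq> 0} \<subseteq> cball 0 (1 / c)" using rad_support[OF assms] by force
qed

lemma pd_rad: "pd i (rad p c) u = rad (bump_step p) c u * (- 2 * c\<^sup>2 * u $ i)"
proof -
  have q: "((\<lambda>u. 1 - c\<^sup>2 * (norm u)\<^sup>2) has_derivative (\<lambda>h. - (c\<^sup>2 * (2 * (u \<bullet> h))))) (at u)" for u :: "real ^ 'n"
    unfolding power2_norm_eq_inner by (auto intro!: derivative_eq_intros simp: inner_commute)
  have "pd i (\<lambda>u. 1 - c\<^sup>2 * (norm u)\<^sup>2) u = - 2 * c\<^sup>2 * u $ i"
    using pd_eqI[OF q, of i u] by (simp add: inner_axis)
  moreover have "pd i (\<lambda>x. bump p (1 - c\<^sup>2 * (norm x)\<^sup>2)) u = bump (bump_step p) (1 - c\<^sup>2 * (norm u)\<^sup>2) * pd i (\<lambda>u. 1 - c\<^sup>2 * (norm u)\<^sup>2) u"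
    using q by (intro pd_compose bump_DERIV) (auto simp: differentiable_def)
  ultimately show ?thesis by (simp add: rad_def[abs_def])
qed

text \<open>By \<open>pd_rad\<close> every differentiation passes to the next
  \<open>bump_step\<close> and brings down a multiple of \<open>u $ i\<close>; summing over
  \<open>i\<close> turns the squares of coordinates into |u|^2. What remains are the two terms that
  differentiation in \<open>c\<close> produces as well.\<close>

lemma lap_rad:
  "lap (rad p c) (u :: real ^ 'n) = 4 * c ^ 4 * (norm u)\<^sup>2 * rad (bump_step (bump_step p)) c u
      - 2 * real CARD('n) * c\<^sup>2 * rad (bump_step p) c u"
proof -
  have "pds [i, i] (rad p c) u = rad (bump_step (bump_step p)) c u * (4 * c ^ 4 * (u $ i)\<^sup>2) - 2 * c\<^sup>2 * rad (bump_step p) c u" for i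
  proof -
    have d: "(\<lambda>u. - 2 * c\<^sup>2 * u $ i) differentiable (at u)"
      by (intro smooth_differentiable smooth_mult smooth_const smooth_coord)
    have "pd i (\<lambda>u. - 2 * c\<^sup>2 * u $ i) u = - 2 * c\<^sup>2"
      using pd_cmult[OF smooth_differentiable[OF smooth_coord], of i "- 2 * c\<^sup>2" i u] by (simp add: pd_coord)
    moreover have "pd i (rad p c) = (\<lambda>u. rad (bump_step p) c u * (- 2 * c\<^sup>2 * u $ i))"
      by (rule ext) (rule pd_rad)
    ultimately show ?thesis
      using pd_mult[OF smooth_differentiable[OF smooth_rad] d, of i "bump_step p" c]
      by (simp add: pds_def pd_rad power2_eq_square power4_eq_xxxx algebra_simps)
  qed
  then have "lap (rad p c) u = rad (bump_step (bump_step p)) c u * (4 * c ^ 4 * (\<Sum>i\<in>UNIV. (u $ i)\<^sup>2)) - real CARD('n) * (2 * c\<^sup>2 * rad (bump_step p) c u)"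
    by (simp add: lap_def sum_subtractf sum_distrib_left)
  also have "(\<Sum>i\<in>UNIV. (u $ i)\<^sup>2) = (norm u)\<^sup>2"
    unfolding power2_norm_eq_inner by (simp add: inner_vec_def power2_eq_square)
  finally show ?thesis by (simp add: mult_ac)
qed

text \<open>This is c^n m(c u), where m(u) is the derivative of \<open>bump 1\<close> at 1 - |u|^2.
  Using the derivative as profile makes its change with \<open>c\<close> a multiple of the Laplacian
  of \<open>rad 1 c\<close>, which has the same support.\<close>

definition moll :: "real \<Rightarrow> real ^ 'n \<Rightarrow> real" where
  "moll c u = c ^ CARD('n) * rad (bump_step 1) c u"

text \<open>The factor is c^(n-3) / 2, written as a quotient because the dimension may be smaller
  than 3.\<close>

definition moll_dc :: "real \<Rightarrow> real ^ 'n \<Rightarrow> real" where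
  "moll_dc c u = - (c ^ CARD('n) / (2 * c ^ 3)) * lap (rad 1 c) u"

text \<open>Let b be \<open>bump 1\<close>, with derivatives taken at 1 - c^2 |u|^2. Both sides are
  n c^(n-1) b' - 2 c^(n+1) |u|^2 b''.\<close>

lemma moll_DERIV:
  assumes "c > 0"
  shows "((\<lambda>c. moll c (u :: real ^ 'n)) has_real_derivative moll_dc c u) (at c)"
proof -
  let ?n = "CARD('n)"
  have "((\<lambda>c. rad (bump_step 1) c u) has_real_derivative rad (bump_step (bump_step 1)) c u * (- (2 * c * (norm u)\<^sup>2))) (at c)"
    unfolding rad_def
    by (rule DERIV_chain2[OF bump_DERIV]) (auto intro!: derivative_eq_intros)
  then have "((\<lambda>c. moll c u) has_real_derivative real ?n * c ^ (?n - 1) * rad (bump_step 1) c u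
     + c ^ ?n * (rad (bump_step (bump_step 1)) c u * (- (2 * c * (norm u)\<^sup>2)))) (at c)"
    unfolding moll_def by (auto intro!: derivative_eq_intros simp: mult_ac)
  also have "real ?n * c ^ (?n - 1) * rad (bump_step 1) c u
     + c ^ ?n * (rad (bump_step (bump_step 1)) c u * (- (2 * c * (norm u)\<^sup>2))) = moll_dc c u"
  proof -
    have "?n > 0" by simp
    then obtain m where n: "?n = Suc m" using gr0_conv_Suc by blast
    show ?thesis using assms unfolding moll_dc_def lap_rad n
      by (simp add: field_simps power2_eq_square power3_eq_cube power4_eq_xxxx)
  qed
  finally show ?thesis .
qed

lemma cinf_moll: "c > 0 \<Longrightarrow> cinf (moll c)"
  unfolding moll_def[abs_def] by (intro cinf_mult cinf_rad smooth_const)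

lemma cinf_moll_dc: "c > 0 \<Longrightarrow> cinf (moll_dc c)"
  unfolding moll_dc_def[abs_def] by (intro cinf_mult cinf_lap cinf_rad smooth_const)

lemma moll_support: "c > 0 \<Longrightarrow> moll c u \<noteq> 0 \<Longrightarrow> norm u < 1 / c"
  using rad_support by (force simp: moll_def)

lemma moll_dc_support: "c > 0 \<Longrightarrow> moll_dc c u \<noteq> 0 \<Longrightarrow> norm u < 1 / c"
  using rad_support[of c _ u] by (force simp: moll_dc_def lap_rad)

text \<open>\<open>bump_step 1\<close> is the monomial of degree 2, so the profile is t^(-2)
  exp(-1/t) for t > 0.\<close>

lemma moll_nonneg: "c > 0 \<Longrightarrow> moll c u \<ge> 0"
  by (auto simp: moll_def rad_def bump_def bump_step_def pderiv_1)

lemma moll_even: "moll c (x - y) = moll c (y - x)"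
  by (simp add: moll_def rad_def norm_minus_commute)

lemma continuous_on_bump: "continuous_on S f \<Longrightarrow> continuous_on S (\<lambda>x. bump p (f x))"
proof -
  have "continuous_on UNIV (bump p)"
    using bump_DERIV by (meson DERIV_isCont continuous_at_imp_continuous_on)
  then show "continuous_on S f \<Longrightarrow> continuous_on S (\<lambda>x. bump p (f x))"
    by (rule continuous_on_compose2) auto
qed

text \<open>Joint continuity is uniform on the compact product of the range of scales with the ball
  of radius 1/a, and all these kernels vanish outside that ball. A modulus independent of
  \<open>u\<close> is what survives integration against a merely integrable function.\<close>

lemma moll_dc_uniform:
  assumes "0 < a" "0 < e"
  obtains d where "d > 0" "\<And>s t u. s \<in> {a..b} \<Longrightarrow> t \<in> {a..b} \<Longrightarrow> \<bar>s - t\<bar> < d \<Longrightarrow> \<bar>moll_dc s (u :: real ^ 'n) - moll_dc t u\<bar> \<le> e"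
proof -
  let ?C = "{a..b} \<times> cball (0 :: real ^ 'n) (1 / a)"
  let ?f = "\<lambda>z. moll_dc (fst z) (snd z :: real ^ 'n)"
  have "continuous_on ?C ?f"
    unfolding moll_dc_def lap_rad rad_def using assms(1)
    by (intro continuous_intros continuous_on_bump) auto
  then have "uniformly_continuous_on ?C ?f"
    by (intro compact_uniformly_continuous compact_Times compact_cball) auto
  then obtain d where d: "d > 0" "\<And>z z'. z \<in> ?C \<Longrightarrow> z' \<in> ?C \<Longrightarrow> dist z' z < d \<Longrightarrow> dist (?f z') (?f z) < e"
    using assms(2) unfolding uniformly_continuous_on_def by metis
  show ?thesis
  proof (rule that[OF d(1)])
    fix s t and u :: "real ^ 'n" assume st: "s \<in> {a..b}" "t \<in> {a..b}" "\<bar>s - t\<bar> < d"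
    show "\<bar>moll_dc s u - moll_dc t u\<bar> \<le> e"
    proof (cases "u \<in> cball 0 (1 / a)")
      case True
      have "dist (s, u) (t, u) < d" using st(3) by (simp add: dist_Pair_Pair dist_real_def)
      then show ?thesis using d(2)[of "(t, u)" "(s, u)"] st True by (simp add: dist_real_def)
    next
      case False
      have "moll_dc r u = 0" if "r \<in> {a..b}" for r
      proof (rule ccontr)
        assume "moll_dc r u \<noteq> 0"
        then have "norm u < 1 / r" using that assms by (intro moll_dc_support) auto
        also have "\<dots> \<le> 1 / a" using that assms by (simp add: frac_le)
        finally show False using False by simp
      qed
      then show ?thesis using st assms by simp
    qed
  qed
qed

lemma lap_reflect:
  assumes "smooth k"
  shows "lap (\<lambda>y. k (x - y)) y = lap k (x - y)"
  by (simp add: lap_def pds_reflect_pair[OF assms])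

lemma reflect_test_fun:
  assumes "cinf k" "\<And>u. k u \<noteq> 0 \<Longrightarrow> norm u \<le> r" "cball x r \<subseteq> S"
  shows "(\<lambda>y. k (x - y)) \<in> test_funs S"
proof -
  have s: "{y. k (x - y) \<noteq> 0} \<subseteq> cball x r" using assms(2) by (auto simp: dist_norm)
  then have "closure {y. k (x - y) \<noteq> 0} \<subseteq> cball x r" by (intro closure_minimal) auto
  then show ?thesis
    using assms(3) smooth_reflect[OF cinf_smooth[OF assms(1)], of 1 x] bounded_subset[OF bounded_cball s]
    by (auto simp: test_funs_iff cinf_def)
qed

definition weakly_harmonic :: "(real ^ 'n) set \<Rightarrow> (real ^ 'n \<Rightarrow> real) \<Rightarrow> bool" where
  "weakly_harmonic S w \<longleftrightarrow> integrable lborel w \<and> (\<forall>\<phi>\<in>test_funs S. (\<integral>x. w x * lap \<phi> x \<partial>lborel) = 0)"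

text \<open>The convolution at \<open>x\<close> is a pairing with the reflected kernel. The ball
  condition makes that kernel a test function, and reflection preserves the Laplacian because its
  two signs cancel.\<close>

lemma conv_lap_zero:
  assumes w: "weakly_harmonic S w" and k: "cinf k" "\<And>u. k u \<noteq> 0 \<Longrightarrow> norm u \<le> r" and x: "cball x r \<subseteq> S"
  shows "conv w (lap k) x = 0"
  using w reflect_test_fun[OF k x] lap_reflect[OF cinf_smooth[OF k(1)], of x]
  by (auto simp: weakly_harmonic_def conv_def)

text \<open>The derivative in the scale is the convolution with \<open>moll_dc\<close>, a multiple
  of the Laplacian of \<open>rad 1 c\<close>. For c \<ge> \<open>a\<close> this kernel fits into the
  ball of radius 1/a, so the convolution is zero.\<close>

lemma conv_moll_const:
  assumes w: "weakly_harmonic S w" and a: "0 < a" "a \<le> b" and x: "cball x (1 / a) \<subseteq> S"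
  shows "conv w (moll a) x = conv w (moll b) x"
proof -
  have iw: "integrable lborel w" using w by (simp add: weakly_harmonic_def)
  define W where "W = (\<integral>y. \<bar>w y\<bar> \<partial>lborel)"
  have W: "W \<ge> 0" by (simp add: W_def)
  have zero: "conv w (moll_dc c) x = 0" if c: "c \<in> {a..b}" for c
  proof -
    have c0: "c > 0" using c a by simp
    have "1 / c \<le> 1 / a" using c a by (simp add: frac_le)
    then have "cball x (1 / c) \<subseteq> S" using x by (meson order_trans subset_cball)
    then have "conv w (lap (rad 1 c)) x = 0"
      using conv_lap_zero[OF w cinf_rad[OF c0], of 1 "1 / c" x] rad_support[OF c0] by force
    moreover have "conv w (moll_dc c) x = - (c ^ CARD('a) / (2 * c ^ 3)) * conv w (lap (rad 1 c)) x"
      unfolding conv_def moll_dc_def by (subst integral_mult_right_zero[symmetric]) (simp only: mult_ac)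
    ultimately show ?thesis by simp
  qed
  have "((\<lambda>c. conv w (moll c) x) has_real_derivative 0) (at s within {a..b})" if s: "s \<in> {a..b}" for s
    unfolding has_field_derivative_iff Lim_within
  proof (intro allI impI)
    fix e :: real assume e: "0 < e"
    \<comment> \<open>Adding 1 to the total mass of |w| avoids division by zero and leaves room for
      a strict inequality.\<close>
    define e' where "e' = e / (W + 1)"
    have e': "e' > 0" "e' * W < e" using e W by (auto simp: e'_def field_simps)
    obtain d where d: "d > 0" "\<And>s t u. s \<in> {a..b} \<Longrightarrow> t \<in> {a..b} \<Longrightarrow> \<bar>s - t\<bar> < d \<Longrightarrow> \<bar>moll_dc s (u :: real ^ 'a) - moll_dc t u\<bar> \<le> e'"
      using moll_dc_uniform[OF a(1) e'(1), of b] by blast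
    have "\<bar>(conv w (moll t) x - conv w (moll s) x) / (t - s)\<bar> < e" if t: "t \<in> {a..b}" "t \<noteq> s" "\<bar>t - s\<bar> < d" for t
    proof -
      have s0: "s > 0" "t > 0" using s t a by auto
      let ?r = "\<lambda>y. moll t (x - y) - moll s (x - y) - (t - s) * moll_dc s (x - y)"
      \<comment> \<open>Mean value inequality for the kernel minus its linearisation at scale
        \<open>s\<close>: the derivative in the scale is a difference of two values of
        \<open>moll_dc\<close>, hence at most \<open>e'\<close> uniformly in
        \<open>u\<close>.\<close>
      have rb: "\<bar>moll t u - moll s u - (t - s) * moll_dc s u\<bar> \<le> e' * \<bar>t - s\<bar>" for u :: "real ^ 'a"
      proof -
        have "norm ((moll t u - t * moll_dc s u) - (moll s u - s * moll_dc s u)) \<le> e' * norm (t - s)"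
        proof (rule field_differentiable_bound[of "{min s t..max s t}" "\<lambda>c. moll c u - c * moll_dc s u" "\<lambda>c. moll_dc c u - moll_dc s u"])
          fix c assume c: "c \<in> {min s t..max s t}"
          then have c': "c > 0" "c \<in> {a..b}" "\<bar>c - s\<bar> < d" using s0 s t by auto
          show "((\<lambda>c. moll c u - c * moll_dc s u) has_field_derivative moll_dc c u - moll_dc s u) (at c within {min s t..max s t})"
            using DERIV_diff[OF has_field_derivative_at_within[OF moll_DERIV[OF c'(1), of u]] DERIV_cmult_right[OF DERIV_ident]]
            by simp
          show "norm (moll_dc c u - moll_dc s u) \<le> e'" using d(2)[OF c'(2) s c'(3)] by simp
        qed auto
        then show ?thesis by (simp add: algebra_simps)
      qed
      have i: "integrable lborel (\<lambda>y. w y * moll c (x - y))" "integrable lborel (\<lambda>y. w y * moll_dc c (x - y))" if "c > 0" for c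
        using that by (intro conv_integrable iw cinf_moll cinf_moll_dc; simp)+
      have i': "integrable lborel (\<lambda>y. w y * ((t - s) * moll_dc s (x - y)))"
        using integrable_mult_right[OF i(2)[OF s0(1)], of "t - s"] by (simp add: mult_ac)
      have "(\<integral>y. w y * ?r y \<partial>lborel) = conv w (moll t) x - conv w (moll s) x - (t - s) * conv w (moll_dc s) x"
        using i(1)[OF s0(1)] i(1)[OF s0(2)] i'
        by (simp add: right_diff_distrib conv_def mult.left_commute[of _ "t - s"])
      then have "conv w (moll t) x - conv w (moll s) x = (\<integral>y. w y * ?r y \<partial>lborel)"
        by (simp add: zero[OF s])
      moreover have "\<bar>\<integral>y. w y * ?r y \<partial>lborel\<bar> \<le> (e' * \<bar>t - s\<bar>) * W" unfolding W_def
      proof (intro abs_integral_mult_le iw rb)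
        have "(\<lambda>y. moll t (x - y)) \<in> borel_measurable borel" "(\<lambda>y. moll s (x - y)) \<in> borel_measurable borel"
            "(\<lambda>y. moll_dc s (x - y)) \<in> borel_measurable borel"
          using s0 by (intro smooth_reflect_measurable cinf_smooth cinf_moll cinf_moll_dc; simp)+
        then show "?r \<in> borel_measurable lborel" by simp
      qed
      ultimately have "\<bar>conv w (moll t) x - conv w (moll s) x\<bar> \<le> e' * W * \<bar>t - s\<bar>" by (simp add: mult_ac)
      also have "\<dots> < e * \<bar>t - s\<bar>" using t e' by (intro mult_strict_right_mono) auto
      finally show ?thesis using t by (simp add: abs_divide divide_less_eq)
    qed
    then show "\<exists>d>0. \<forall>t\<in>{a..b}. 0 < dist t s \<and> dist t s < d \<longrightarrow> dist ((conv w (moll t) x - conv w (moll s) x) / (t - s)) 0 < e"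
      using d(1) by (auto simp: dist_real_def)
  qed
  then have "\<exists>c. \<forall>s\<in>{a..b}. conv w (moll s) x = c"
    by (intro has_field_derivative_zero_constant) auto
  then show ?thesis using a by force
qed

section \<open>Weyl's lemma\<close>

text \<open>The kernels are not normalised; division by this constant does it in Weyl's lemma. The
  type argument carries the dimension, on which alone the value depends.\<close>

definition mass :: "'n::finite itself \<Rightarrow> real" where
  "mass _ = (\<integral>u. moll 1 (u :: real ^ 'n) \<partial>lborel)"

text \<open>Scale invariance is read off from \<open>conv_moll_const\<close>: the indicator of a
  large ball is weakly harmonic inside that ball, and its mollification at the centre is the
  integral of the kernel.\<close>

lemma integral_moll:
  assumes c: "c > 0"
  shows "(\<integral>u. moll c (u :: real ^ 'n) \<partial>lborel) = mass TYPE('n)"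
proof -
  \<comment> \<open>Both scales under comparison, \<open>c\<close> and 1, are at least
    \<open>a\<close>; each is compared with \<open>a\<close>.\<close>
  define a where "a = min c 1"
  have a: "0 < a" "a \<le> c" "a \<le> 1" using c by (auto simp: a_def)
  define S :: "(real ^ 'n) set" where "S = ball 0 (1 / a + 1)"
  define w :: "real ^ 'n \<Rightarrow> real" where "w = indicator S"
  have "integrable lborel (indicator (cball 0 (1 / a + 1)) :: real ^ 'n \<Rightarrow> real)"
    using borel_integrable_compact[of "cball (0 :: real ^ 'n) (1 / a + 1)" "\<lambda>_. 1 :: real"] by simp
  then have iw: "integrable lborel w"
    by (rule Bochner_Integration.integrable_bound)
       (auto simp: w_def S_def borel_open intro!: borel_measurable_indicator split: split_indicator)
  have ws: "(\<integral>x. w x * f x \<partial>lborel) = (\<integral>x. f x \<partial>lborel)" if "\<And>x. f x \<noteq> 0 \<Longrightarrow> x \<in> S" for f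
    by (rule Bochner_Integration.integral_cong) (use that in \<open>auto simp: w_def split: split_indicator\<close>)
  have "weakly_harmonic S w"
    unfolding weakly_harmonic_def
  proof (intro conjI ballI iw)
    fix \<phi> assume \<phi>: "\<phi> \<in> test_funs S"
    have c: "cinf \<phi>" using \<phi> by (simp add: test_funs_iff)
    have "(\<integral>x. w x * lap \<phi> x \<partial>lborel) = (\<integral>x. lap \<phi> x \<partial>lborel)"
    proof (rule ws)
      fix x assume "lap \<phi> x \<noteq> 0"
      then obtain i where "pds [i, i] \<phi> x \<noteq> 0" unfolding lap_def by (meson sum.not_neutral_contains_not_neutral)
      then show "x \<in> S" using pds_support[of "[i, i]" \<phi>] \<phi> by (auto simp: test_funs_iff)
    qed
    also have "\<dots> = (\<Sum>i\<in>UNIV. \<integral>x. pds [i, i] \<phi> x \<partial>lborel)"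
      unfolding lap_def using cinf_integrable[OF cinf_pds[OF c]] by (simp add: integral_sum)
    also have "\<dots> = 0" using integral_pd[OF cinf_pd[OF c]] by (simp add: pds_def)
    finally show "(\<integral>x. w x * lap \<phi> x \<partial>lborel) = 0" .
  qed
  moreover have "cball 0 (1 / a) \<subseteq> S" by (auto simp: S_def)
  ultimately have const: "a \<le> b \<Longrightarrow> conv w (moll a) 0 = conv w (moll b) 0" for b
    using conv_moll_const a(1) by blast
  have "conv w (moll b) 0 = (\<integral>u. moll b (u :: real ^ 'n) \<partial>lborel)" if "a \<le> b" for b
  proof -
    have "conv w (moll b) 0 = (\<integral>x. w x * moll b x \<partial>lborel)"
      unfolding conv_def by (subst moll_even) simp
    also have "\<dots> = (\<integral>x. moll b (x :: real ^ 'n) \<partial>lborel)"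
    proof (rule ws)
      fix x :: "real ^ 'n" assume "moll b x \<noteq> 0"
      then have "norm x < 1 / b" using that a by (intro moll_support) auto
      also have "\<dots> \<le> 1 / a" using that a by (simp add: frac_le)
      finally show "x \<in> S" by (simp add: S_def)
    qed
    finally show ?thesis .
  qed
  from this[OF a(2)] this[OF a(3)] const[OF a(2)] const[OF a(3)] show ?thesis by (simp add: mass_def)
qed

lemma mass_pos: "mass TYPE('n::finite) > 0"
proof -
  have i: "integrable lborel (moll 1 :: real ^ 'n \<Rightarrow> real)" by (intro cinf_integrable cinf_moll) simp
  have "mass TYPE('n) \<noteq> 0"
  proof
    assume "mass TYPE('n) = 0"
    then have "AE u in lborel. moll 1 (u :: real ^ 'n) = 0"
      using i by (subst (asm) mass_def, subst (asm) integral_nonneg_eq_0_iff_AE) (auto intro!: moll_nonneg AE_I2)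
    then have "AE u in lborel. u \<notin> ball (0 :: real ^ 'n) 1"
    proof eventually_elim
      case (elim u)
      show ?case
      proof
        assume "u \<in> ball 0 1"
        then have "(norm u)\<^sup>2 < 1" by (simp add: power_less_one_iff)
        then show False using elim by (simp add: moll_def rad_def bump_def bump_step_def pderiv_1)
      qed
    qed
    from AE_completion[OF this] have "negligible (ball (0 :: real ^ 'n) 1)"
      by (simp add: negligible_iff_null_sets AE_iff_null_sets)
    then show False using open_not_negligible[of "ball (0 :: real ^ 'n) 1"] by simp
  qed
  moreover have "mass TYPE('n) \<ge> 0" unfolding mass_def by (intro integral_nonneg_AE AE_I2 moll_nonneg) simp
  ultimately show ?thesis by simp
qed

text \<open>Fubini's theorem moves the mollifier from \<open>w\<close> to \<psi>, and evenness of
  the kernel turns the result into a convolution. Joint integrability holds because the kernel is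
  bounded while \<open>w\<close> and \<psi> are integrable.\<close>

lemma conv_moll_swap:
  assumes w: "integrable lborel w" and \<psi>: "cinf (\<psi> :: real ^ 'n \<Rightarrow> real)" and c: "c > 0"
  shows "(\<integral>x. conv w (moll c) x * \<psi> x \<partial>lborel) = (\<integral>y. w y * conv \<psi> (moll c) y \<partial>lborel)"
proof -
  obtain B where B: "\<And>u :: real ^ 'n. \<bar>moll c u\<bar> \<le> B" using cinf_bounded[OF cinf_moll[OF c]] by blast
  have B0: "B \<ge> 0" using B[of 0] by linarith
  have [measurable]: "w \<in> borel_measurable borel" using w by simp
  have [measurable]: "\<psi> \<in> borel_measurable borel" using \<psi> by (simp add: cinf_def smooth_borel)
  have [measurable]: "moll c \<in> borel_measurable (borel :: (real ^ 'n) measure)"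
    by (rule smooth_borel[OF cinf_smooth[OF cinf_moll[OF c]]])
  have m: "(\<lambda>(x, y). w y * moll c (x - y) * \<psi> x) \<in> borel_measurable (lborel \<Otimes>\<^sub>M lborel)"
    by measurable
  have i1: "integrable lborel (\<lambda>y. w y * moll c (x - y) * \<psi> x)" for x
    using conv_integrable[OF w cinf_moll[OF c], of x] by simp
  have "integrable (lborel \<Otimes>\<^sub>M lborel) (\<lambda>(x, y). w y * moll c (x - y) * \<psi> x)"
  proof (rule lborel_pair.Fubini_integrable[OF m])
    show "integrable lborel (\<lambda>x. \<integral>y. norm (case (x, y) of (x, y) \<Rightarrow> w y * moll c (x - y) * \<psi> x) \<partial>lborel)"
    proof (rule Bochner_Integration.integrable_bound)
      show "integrable lborel (\<lambda>x. (B * (\<integral>y. \<bar>w y\<bar> \<partial>lborel)) * \<psi> x)"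
        using cinf_integrable[OF \<psi>] by simp
      show "(\<lambda>x. \<integral>y. norm (case (x, y) of (x, y) \<Rightarrow> w y * moll c (x - y) * \<psi> x) \<partial>lborel) \<in> borel_measurable lborel"
        by measurable
      show "AE x in lborel. norm (\<integral>y. norm (case (x, y) of (x, y) \<Rightarrow> w y * moll c (x - y) * \<psi> x) \<partial>lborel)
          \<le> norm ((B * (\<integral>y. \<bar>w y\<bar> \<partial>lborel)) * \<psi> x)"
      proof (rule AE_I2)
        fix x
        have "(\<integral>y. \<bar>w y * moll c (x - y) * \<psi> x\<bar> \<partial>lborel) \<le> (\<integral>y. B * \<bar>w y\<bar> * \<bar>\<psi> x\<bar> \<partial>lborel)"
        proof (rule integral_mono)
          show "\<bar>w y * moll c (x - y) * \<psi> x\<bar> \<le> B * \<bar>w y\<bar> * \<bar>\<psi> x\<bar>" for y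
            unfolding abs_mult using mult_right_mono[OF B, of "\<bar>w y\<bar>" "x - y"]
            by (intro mult_right_mono) (simp_all add: mult.commute)
        qed (use i1 w in auto)
        then show "norm (\<integral>y. norm (case (x, y) of (x, y) \<Rightarrow> w y * moll c (x - y) * \<psi> x) \<partial>lborel)
          \<le> norm ((B * (\<integral>y. \<bar>w y\<bar> \<partial>lborel)) * \<psi> x)"
          using B0 by (simp add: abs_mult)
      qed
    qed
    show "AE x in lborel. integrable lborel (\<lambda>y. case (x, y) of (x, y) \<Rightarrow> w y * moll c (x - y) * \<psi> x)"
      using i1 by simp
  qed
  from lborel_pair.Fubini_integral[OF this]
  have "(\<integral>y. \<integral>x. w y * moll c (x - y) * \<psi> x \<partial>lborel \<partial>lborel) = (\<integral>x. \<integral>y. w y * moll c (x - y) * \<psi> x \<partial>lborel \<partial>lborel)"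
    by simp
  also have "(\<lambda>x. \<integral>y. w y * moll c (x - y) * \<psi> x \<partial>lborel) = (\<lambda>x. conv w (moll c) x * \<psi> x)"
    by (simp add: conv_def)
  also have "(\<lambda>y. \<integral>x. w y * moll c (x - y) * \<psi> x \<partial>lborel) = (\<lambda>y. w y * conv \<psi> (moll c) y)"
  proof
    fix y
    have "w y * moll c (x - y) * \<psi> x = w y * (\<psi> x * moll c (y - x))" for x
      by (simp add: moll_even[of c x y])
    then show "(\<integral>x. w y * moll c (x - y) * \<psi> x \<partial>lborel) = w y * conv \<psi> (moll c) y"
      by (simp only: conv_def integral_mult_right_zero)
  qed
  finally show ?thesis by (rule sym)
qed

text \<open>The kernel has fixed total mass and lives in the ball of radius 1/c, where the Lipschitz
  function \<psi> deviates from its value at the centre by at most L/c. The estimate is uniform in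
  \<open>y\<close>.\<close>

lemma conv_moll_approx:
  assumes \<psi>: "cinf (\<psi> :: real ^ 'n \<Rightarrow> real)" and L: "\<And>x y. \<bar>\<psi> x - \<psi> y\<bar> \<le> L * norm (x - y)" "L \<ge> 0" and c: "c > 0"
  shows "\<bar>conv \<psi> (moll c) y - mass TYPE('n) * \<psi> y\<bar> \<le> mass TYPE('n) * L / c"
proof -
  have k: "cinf (moll c)" by (rule cinf_moll[OF c])
  have im: "integrable lborel (\<lambda>x. moll c (x - y))"
    using integrable_shift[OF cinf_integrable[OF k], of "- y"] by simp
  have m: "(\<integral>x. moll c (x - y) \<partial>lborel) = mass TYPE('n)"
    using integral_shift[OF smooth_borel[OF cinf_smooth[OF k]], of "- y"] integral_moll[OF c, where 'n = 'n] by simp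
  have ic: "integrable lborel (\<lambda>x. \<psi> x * moll c (x - y))"
    using conv_integrable[OF cinf_integrable[OF \<psi>] k, of y] by (simp add: moll_even[of c y])
  have "conv \<psi> (moll c) y - mass TYPE('n) * \<psi> y = (\<integral>x. (\<psi> x - \<psi> y) * moll c (x - y) \<partial>lborel)"
    using ic im m by (simp add: conv_def moll_even[of c y] left_diff_distrib)
  also have "\<bar>\<dots>\<bar> \<le> (\<integral>x. \<bar>(\<psi> x - \<psi> y) * moll c (x - y)\<bar> \<partial>lborel)" by (rule integral_abs_bound)
  also have "\<dots> \<le> (\<integral>x. L / c * moll c (x - y) \<partial>lborel)"
  proof (rule integral_mono)
    show "integrable lborel (\<lambda>x. \<bar>(\<psi> x - \<psi> y) * moll c (x - y)\<bar>)"
      using ic im by (simp add: left_diff_distrib)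
    show "\<bar>(\<psi> x - \<psi> y) * moll c (x - y)\<bar> \<le> L / c * moll c (x - y)" for x
    proof (cases "moll c (x - y) = 0")
      case False
      have "norm (x - y) \<le> 1 / c" using moll_support[OF c False] by simp
      then have "\<bar>\<psi> x - \<psi> y\<bar> \<le> L / c"
        using L(1)[of x y] mult_left_mono[OF _ L(2), of "norm (x - y)" "1 / c"] by simp
      from mult_right_mono[OF this moll_nonneg[OF c, of "x - y"]]
      show ?thesis unfolding abs_mult abs_of_nonneg[OF moll_nonneg[OF c]] .
    qed simp
  qed (use im in simp)
  also have "\<dots> = mass TYPE('n) * L / c" using m by simp
  finally show ?thesis .
qed

text \<open>On the support of \<psi> the mollification of \<open>w\<close> is the same for all
  scales c \<ge> \<open>a\<close>, so c may tend to infinity on the right alone. With the mollifier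
  moved to \<psi>, the limit concerns uniform convergence of a smooth function and no convergence of
  mollifications of \<open>w\<close>.\<close>

lemma integral_conv_moll:
  assumes w: "weakly_harmonic S w" and \<psi>: "cinf (\<psi> :: real ^ 'n \<Rightarrow> real)" and a: "0 < a"
    and sup: "\<And>x. \<psi> x \<noteq> 0 \<Longrightarrow> cball x (1 / a) \<subseteq> S"
  shows "(\<integral>x. conv w (moll a) x * \<psi> x \<partial>lborel) = mass TYPE('n) * (\<integral>x. w x * \<psi> x \<partial>lborel)"
proof -
  have iw: "integrable lborel w" using w by (simp add: weakly_harmonic_def)
  obtain L where L: "L \<ge> 0" "\<And>x y. \<bar>\<psi> x - \<psi> y\<bar> \<le> L * norm (x - y)" using cinf_lipschitz[OF \<psi>] by blast
  obtain B where B: "\<And>x. \<bar>\<psi> x\<bar> \<le> B" using cinf_bounded[OF \<psi>] by blast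
  let ?M = "mass TYPE('n)" and ?W = "\<integral>y. \<bar>w y\<bar> \<partial>lborel"
  let ?l = "\<integral>x. conv w (moll a) x * \<psi> x \<partial>lborel" and ?r = "?M * (\<integral>x. w x * \<psi> x \<partial>lborel)"
  have mp: "\<psi> \<in> borel_measurable borel" using \<psi> by (simp add: cinf_def smooth_borel)
  have i1: "integrable lborel (\<lambda>y. w y * \<psi> y)"
    by (rule integrable_mult_bounded[OF iw _ B]) (use mp in simp)
  have bound: "\<bar>?l - ?r\<bar> \<le> ?M * L / c * ?W" if c: "a \<le> c" for c
  proof -
    have c0: "c > 0" using a c by simp
    have "?l = (\<integral>x. conv w (moll c) x * \<psi> x \<partial>lborel)"
    proof (rule Bochner_Integration.integral_cong)
      show "conv w (moll a) x * \<psi> x = conv w (moll c) x * \<psi> x" for x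
        using conv_moll_const[OF w a c sup] by (cases "\<psi> x = 0") auto
    qed simp
    also have "\<dots> = (\<integral>y. w y * conv \<psi> (moll c) y \<partial>lborel)" by (rule conv_moll_swap[OF iw \<psi> c0])
    finally have l: "?l = (\<integral>y. w y * conv \<psi> (moll c) y \<partial>lborel)" .
    have md: "(\<lambda>y. conv \<psi> (moll c) y - ?M * \<psi> y) \<in> borel_measurable lborel"
      using smooth_borel[OF smooth_conv[OF cinf_integrable[OF \<psi>] cinf_moll[OF c0]]] mp by simp
    note db = conv_moll_approx[OF \<psi> L(2,1) c0]
    have "integrable lborel (\<lambda>y. w y * (conv \<psi> (moll c) y - ?M * \<psi> y))"
      by (rule integrable_mult_bounded[OF iw md db])
    then have "integrable lborel (\<lambda>y. w y * (conv \<psi> (moll c) y - ?M * \<psi> y) + ?M * (w y * \<psi> y))"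
      using i1 by simp
    then have i2: "integrable lborel (\<lambda>y. w y * conv \<psi> (moll c) y)" by (simp add: algebra_simps)
    have "?l - ?r = (\<integral>y. w y * conv \<psi> (moll c) y - ?M * (w y * \<psi> y) \<partial>lborel)"
      using i1 i2 l by simp
    also have "\<dots> = (\<integral>y. w y * (conv \<psi> (moll c) y - ?M * \<psi> y) \<partial>lborel)"
      by (simp add: algebra_simps)
    finally show ?thesis using abs_integral_mult_le[OF iw md db] by simp
  qed
  have "((\<lambda>c. ?M * L / c * ?W) \<longlongrightarrow> 0 * ?W) at_top"
    by (intro tendsto_mult tendsto_const tendsto_divide_0[OF tendsto_const] filterlim_at_top_imp_at_infinity filterlim_ident)
  then have "\<bar>?l - ?r\<bar> \<le> 0 * ?W"
    by (rule tendsto_lowerbound) (use bound in \<open>auto intro!: eventually_at_top_linorderI[of a]\<close>)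
  then show ?thesis by simp
qed

text \<open>Near a given point one scale is admissible throughout a ball, so there \<open>W\<close>
  is a multiple of a single convolution: it is smooth, and its Laplacian vanishes by
  \<open>conv_lap_zero\<close>. That \<open>W\<close> represents \<open>w\<close> follows by testing
  their difference, with \<open>integral_conv_moll\<close> and
  \<open>fundamental_lemma\<close>.\<close>

lemma weyl_lemma:
  fixes w :: "real ^ 'n \<Rightarrow> real"
  assumes S: "open S" and w: "weakly_harmonic S w"
  obtains W where "harmonic_on S W" "AE x in lborel. x \<in> S \<longrightarrow> W x = w x"
proof -
  let ?M = "mass TYPE('n)"
  have M: "?M > 0" by (rule mass_pos)
  have iw: "integrable lborel w" using w by (simp add: weakly_harmonic_def)
  have wb [measurable]: "w \<in> borel_measurable borel" using iw by simp
  \<comment> \<open>The kernel of an admissible scale sees only points of \<open>S\<close>.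
    \<open>W_eq\<close> shows that the choice among admissible scales in the next definition is
    immaterial.\<close>
  define good where "good x c \<longleftrightarrow> c > 0 \<and> cball x (1 / c) \<subseteq> S" for x c
  define W where "W x = conv w (moll (SOME c. good x c)) x / ?M" for x
  have good_ex: "\<exists>d>0. \<forall>x\<in>K. good x (1 / d)" if K: "compact K" "K \<subseteq> S" for K
  proof -
    have disj: "closed (- S)" "K \<inter> (- S) = {}" using K S by auto
    obtain d where d: "d > 0" "\<forall>x\<in>K. \<forall>y\<in>- S. d \<le> dist x y"
      using separate_compact_closed[OF K(1) disj] by blast
    have "cball x (d / 2) \<subseteq> S" if "x \<in> K" for x
    proof
      fix y assume "y \<in> cball x (d / 2)"
      then have "dist x y < d" using d(1) by simp
      then show "y \<in> S" using d(2) that by force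
    qed
    then show ?thesis using d(1) by (intro exI[of _ "d / 2"]) (auto simp: good_def)
  qed
  have W_eq: "W x = conv w (moll c) x / ?M" if c: "good x c" for x c
  proof -
    have s: "good x (SOME c. good x c)" using c by (rule someI)
    have "conv w (moll s) x = conv w (moll t) x" if "good x s" "good x t" "s \<le> t" for s t
      using conv_moll_const[OF w] that by (auto simp: good_def)
    then have "conv w (moll (SOME c. good x c)) x = conv w (moll c) x"
      using s c by (metis linorder_linear)
    then show ?thesis by (simp add: W_def)
  qed
  have loc: "\<exists>g U. smooth g \<and> open U \<and> x \<in> U \<and> (\<forall>y\<in>U. W y = g y) \<and> lap g x = 0" if x: "x \<in> S" for x
  proof -
    obtain e where e: "e > 0" "cball x e \<subseteq> S" using S x open_contains_cball by blast
    obtain d where d: "d > 0" "\<And>y. y \<in> cball x e \<Longrightarrow> good y (1 / d)"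
      using good_ex[OF compact_cball e(2)] by blast
    have c: "1 / d > 0" using d(1) by simp
    let ?g = "\<lambda>y. (1 / ?M) * conv w (moll (1 / d)) y"
    have sc: "smooth (conv w (moll (1 / d)))" by (rule smooth_conv[OF iw cinf_moll[OF c]])
    have gx: "cball x (1 / (1 / d)) \<subseteq> S" using d(2)[of x] e(1) by (simp add: good_def)
    have "lap (conv w (moll (1 / d))) x = conv w (lap (moll (1 / d))) x" by (rule lap_conv[OF iw cinf_moll[OF c]])
    also have "\<dots> = 0"
      by (rule conv_lap_zero[OF w cinf_moll[OF c] less_imp_le[OF moll_support[OF c]] gx])
    finally have l: "lap (conv w (moll (1 / d))) x = 0" .
    have "pd i ?g = (\<lambda>y. (1 / ?M) * pd i (conv w (moll (1 / d))) y)" for i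
      by (rule ext) (rule pd_cmult[OF smooth_differentiable[OF sc]])
    then have "pds [i, i] ?g x = (1 / ?M) * pds [i, i] (conv w (moll (1 / d))) x" for i
      using pd_cmult[OF smooth_differentiable[OF smooth_pd[OF sc]], of i "1 / ?M" i x] by (simp add: pds_def)
    then have "lap ?g x = (1 / ?M) * lap (conv w (moll (1 / d))) x"
      by (simp add: lap_def sum_distrib_left)
    then have "lap ?g x = 0" using l by simp
    moreover have "smooth ?g" by (intro smooth_mult smooth_const sc)
    moreover have "\<forall>y\<in>ball x e. W y = ?g y" using W_eq d(2) by auto
    ultimately show ?thesis using e(1) by (intro exI[of _ ?g] exI[of _ "ball x e"]) auto
  qed
  have ck: "Ck_on k S W" for k
    by (rule Ck_on_cong_local[OF S]) (use loc in blast)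
  have "harmonic_on S W"
    unfolding harmonic_on_def
  proof (intro conjI ballI ck)
    fix x assume "x \<in> S"
    then obtain g U where g: "open U" "x \<in> U" "\<forall>y\<in>U. W y = g y" "lap g x = 0" using loc by blast
    then have "pds [i, i] W x = pds [i, i] g x" for i by (intro pds_cong_open[of U]) auto
    then show "(\<Sum>i\<in>UNIV. pds [i, i] W x) = 0" using g(4) by (simp add: lap_def)
  qed
  moreover have "AE x in lborel. x \<in> S \<longrightarrow> W x = w x"
  proof -
    have cW: "continuous_on S W" using ck[of 0] by simp
    \<comment> \<open>Off \<open>S\<close> the values of \<open>W\<close> come from an arbitrary
      choice; the indicator removes them and makes the function Borel measurable.\<close>
    define g where "g x = indicator S x * W x - w x" for x
    have [measurable]: "(\<lambda>x. indicator S x * W x) \<in> borel_measurable borel"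
      using borel_measurable_continuous_on_indicator[OF _ cW] S by simp
    have "AE x in lborel. x \<in> S \<longrightarrow> g x = 0"
    proof (rule fundamental_lemma[OF S])
      show "g \<in> borel_measurable borel" unfolding g_def[abs_def] by measurable
      show "integrable lborel (\<lambda>x. indicator K x * g x)" if K: "compact K" "K \<subseteq> S" for K
      proof -
        have "integrable lborel (\<lambda>x. indicator K x *\<^sub>R W x)"
          by (rule borel_integrable_compact[OF K(1) continuous_on_subset[OF cW K(2)]])
        moreover have "integrable lborel (\<lambda>x. indicator K x *\<^sub>R w x)"
          by (rule integrable_mult_indicator[OF _ iw]) (use K in \<open>auto simp: compact_imp_closed borel_closed\<close>)
        ultimately have "integrable lborel (\<lambda>x. indicator K x * W x - indicator K x * w x)" by simp
        also have "(\<lambda>x. indicator K x * W x - indicator K x * w x) = (\<lambda>x. indicator K x * g x)"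
          using K(2) by (auto simp: fun_eq_iff g_def indicator_def)
        finally show ?thesis .
      qed
      show "(\<integral>x. g x * \<psi> x \<partial>lborel) = 0" if \<psi>: "\<psi> \<in> test_funs S" for \<psi>
      proof -
        let ?K = "closure {x. \<psi> x \<noteq> 0}"
        have c: "cinf \<psi>" and K: "compact ?K" "?K \<subseteq> S" using \<psi> by (auto simp: test_funs_iff cinf_def)
        obtain d where d: "d > 0" "\<And>x. x \<in> ?K \<Longrightarrow> good x (1 / d)" using good_ex[OF K] by blast
        have c0: "1 / d > 0" using d(1) by simp
        let ?cv = "conv w (moll (1 / d))"
        have sup: "x \<in> ?K" if "\<psi> x \<noteq> 0" for x using that closure_subset by fastforce
        have "g x * \<psi> x = (1 / ?M) * (?cv x * \<psi> x) - w x * \<psi> x" for x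
        proof (cases "\<psi> x = 0")
          case False
          then have "x \<in> S" "W x = ?cv x / ?M" using sup K d(2) W_eq by blast+
          then show ?thesis by (simp add: g_def left_diff_distrib)
        qed simp
        moreover have "integrable lborel (\<lambda>x. ?cv x * \<psi> x)"
          by (intro cinf_integrable cinf_mult smooth_conv iw cinf_moll c c0)
        moreover have "integrable lborel (\<lambda>x. w x * \<psi> x)"
        proof -
          obtain B where "\<And>x. \<bar>\<psi> x\<bar> \<le> B" using cinf_bounded[OF c] by blast
          then show ?thesis using c by (intro integrable_mult_bounded iw) (auto simp: cinf_def smooth_borel)
        qed
        moreover have "(\<integral>x. ?cv x * \<psi> x \<partial>lborel) = ?M * (\<integral>x. w x * \<psi> x \<partial>lborel)"
          using d(2) sup by (intro integral_conv_moll[OF w c c0]) (auto simp: good_def)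
        ultimately show ?thesis using M by simp
      qed
    qed
    then show ?thesis by eventually_elim (auto simp: g_def)
  qed
  ultimately show ?thesis using that by blast
qed

section \<open>The orthogonal splitting and the estimate\<close>

lemma L2_lincomb:
  assumes "f \<in> L2 S" "g \<in> L2 S"
  shows "(\<lambda>x. a * f x + b * g x) \<in> L2 S"
proof -
  have "integrable (lebesgue_on S) (\<lambda>x. a\<^sup>2 * (f x)\<^sup>2 + 2 * a * b * (f x * g x) + b\<^sup>2 * (g x)\<^sup>2)"
    using assms
    by (intro Bochner_Integration.integrable_add integrable_mult_right L2_mult_integrable(1)[OF assms])
       (simp_all add: L2_def)
  also have "(\<lambda>x. a\<^sup>2 * (f x)\<^sup>2 + 2 * a * b * (f x * g x) + b\<^sup>2 * (g x)\<^sup>2) = (\<lambda>x. (a * f x + b * g x)\<^sup>2)"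
    by (simp add: fun_eq_iff power2_sum power_mult_distrib mult_ac)
  finally have "integrable (lebesgue_on S) (\<lambda>x. (a * f x + b * g x)\<^sup>2)" .
  moreover have "f \<in> borel_measurable (lebesgue_on S)" "g \<in> borel_measurable (lebesgue_on S)"
    using assms by (simp_all add: L2_def)
  ultimately show ?thesis unfolding L2_def by (intro CollectI conjI borel_measurable_add borel_measurable_times) simp_all
qed

lemma L2_diff: "f \<in> L2 S \<Longrightarrow> g \<in> L2 S \<Longrightarrow> (\<lambda>x. f x - g x) \<in> L2 S"
  using L2_lincomb[of f S g 1 "-1"] by simp

lemma L2_norm_nonneg [simp]: "0 \<le> L2_norm S f"
  by (simp add: L2_norm_def)

lemma L2_norm_sq: "(L2_norm S f)\<^sup>2 = (\<integral>x. (f x)\<^sup>2 \<partial>lebesgue_on S)"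
  by (simp add: L2_norm_def)

lemma L2_norm_sq_lincomb:
  assumes "f \<in> L2 S" "g \<in> L2 S"
  shows "(L2_norm S (\<lambda>x. f x + t * g x))\<^sup>2
    = (L2_norm S f)\<^sup>2 + 2 * t * (\<integral>x. f x * g x \<partial>lebesgue_on S) + t\<^sup>2 * (L2_norm S g)\<^sup>2"
proof -
  have "(\<lambda>x. (f x + t * g x)\<^sup>2) = (\<lambda>x. (f x)\<^sup>2 + 2 * t * (f x * g x) + t\<^sup>2 * (g x)\<^sup>2)"
    by (simp add: fun_eq_iff power2_sum power_mult_distrib mult_ac)
  then show ?thesis
    using assms L2_mult_integrable(1)[OF assms] by (simp add: L2_norm_sq L2_def)
qed

lemma L2_cauchy_schwarz:
  assumes "f \<in> L2 S" "g \<in> L2 S"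
  shows "\<bar>\<integral>x. f x * g x \<partial>lebesgue_on S\<bar> \<le> L2_norm S f * L2_norm S g"
proof -
  let ?I = "\<integral>x. f x * g x \<partial>lebesgue_on S" and ?F = "(L2_norm S f)\<^sup>2" and ?G = "(L2_norm S g)\<^sup>2"
  have q: "0 \<le> ?F + 2 * t * ?I + t\<^sup>2 * ?G" for t
    using L2_norm_sq_lincomb[OF assms, of t] by (metis zero_le_power2)
  have "?I\<^sup>2 \<le> ?F * ?G"
  proof (cases "?G = 0")
    case True
    have "?I = 0"
    proof (rule ccontr)
      assume "?I \<noteq> 0"
      \<comment> \<open>With a vanishing quadratic coefficient the polynomial is affine, and at this
        \<open>t\<close> its value is -1.\<close>
      then show False using q[of "- (?F + 1) / (2 * ?I)"] True by (simp add: field_simps)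
    qed
    then show ?thesis by simp
  next
    case False
    then have G: "?G > 0" by simp
    \<comment> \<open>The minimiser of the quadratic polynomial in \<open>t\<close>.\<close>
    have "0 \<le> ?F + 2 * (- ?I / ?G) * ?I + (- ?I / ?G)\<^sup>2 * ?G" by (rule q)
    also have "\<dots> = ?F - ?I\<^sup>2 / ?G" using False by (simp add: power2_eq_square field_simps)
    finally show ?thesis using G by (simp add: field_simps)
  qed
  then have "\<bar>?I\<bar>\<^sup>2 \<le> (L2_norm S f * L2_norm S g)\<^sup>2" by (simp add: power_mult_distrib)
  then show ?thesis by (rule power2_le_imp_le) simp
qed

lemma L2_triangle:
  assumes "f \<in> L2 S" "g \<in> L2 S"
  shows "L2_norm S (\<lambda>x. f x + g x) \<le> L2_norm S f + L2_norm S g"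
proof (rule power2_le_imp_le)
  show "(L2_norm S (\<lambda>x. f x + g x))\<^sup>2 \<le> (L2_norm S f + L2_norm S g)\<^sup>2"
    using L2_norm_sq_lincomb[OF assms, of 1] L2_cauchy_schwarz[OF assms]
    by (simp add: power2_sum)
qed simp

lemma L2_norm_minus: "L2_norm S (\<lambda>x. - f x) = L2_norm S f"
  by (simp add: L2_norm_def)

lemma L2_norm_diff_commute: "L2_norm S (\<lambda>x. f x - g x) = L2_norm S (\<lambda>x. g x - f x)"
  by (simp add: L2_norm_def power2_commute)

lemma L2_triangle_diff:
  assumes "f \<in> L2 S" "g \<in> L2 S"
  shows "L2_norm S (\<lambda>x. f x - g x) \<le> L2_norm S f + L2_norm S g"
  using L2_triangle[OF assms(1) L2_lincomb[OF assms(2,2), of "-1" 0]] by (simp add: L2_norm_minus)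

lemma L2_norm_cong_AE:
  assumes "AE x in lebesgue_on S. f x = g x" "f \<in> borel_measurable (lebesgue_on S)" "g \<in> borel_measurable (lebesgue_on S)"
  shows "L2_norm S f = L2_norm S g"
  unfolding L2_norm_def
  by (rule arg_cong[of _ _ sqrt], rule integral_cong_AE) (use assms in \<open>auto elim: eventually_mono\<close>)

lemma L2_mono:
  assumes "open S" "open T" "S \<subseteq> T" "f \<in> L2 T"
  shows "f \<in> L2 S" "L2_norm S f \<le> L2_norm T f"
proof -
  have m: "S \<in> sets lebesgue" "T \<in> sets lebesgue" using assms by auto
  have T: "integrable lebesgue (\<lambda>x. indicator T x *\<^sub>R (f x)\<^sup>2)"
    using assms m by (simp add: L2_def integrable_restrict_space)
  have "integrable lebesgue (\<lambda>x. indicator S x *\<^sub>R (indicator T x *\<^sub>R (f x)\<^sup>2))"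
    by (rule integrable_mult_indicator[OF m(1) T])
  also have "(\<lambda>x. indicator S x *\<^sub>R (indicator T x *\<^sub>R (f x)\<^sup>2)) = (\<lambda>x. indicator S x *\<^sub>R (f x)\<^sup>2)"
    using assms(3) by (auto simp: fun_eq_iff indicator_def)
  finally have S: "integrable lebesgue (\<lambda>x. indicator S x *\<^sub>R (f x)\<^sup>2)" .
  have "f \<in> borel_measurable (lebesgue_on S)"
    using assms(4) measurable_restrict_mono[OF _ assms(3)] by (auto simp: L2_def)
  then show "f \<in> L2 S" using S m by (simp add: L2_def integrable_restrict_space)
  have "(\<integral>x. indicator S x *\<^sub>R (f x)\<^sup>2 \<partial>lebesgue) \<le> (\<integral>x. indicator T x *\<^sub>R (f x)\<^sup>2 \<partial>lebesgue)"
    using assms(3) by (intro integral_mono S T) (auto simp: indicator_def)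
  then show "L2_norm S f \<le> L2_norm T f"
    using m by (simp add: L2_norm_def integral_restrict_space)
qed

section \<open>Completeness of \<open>L2\<close> for rapidly converging sequences\<close>

lemma finite_measure_lebesgue_on:
  assumes "open S" "bounded S"
  shows "finite_measure (lebesgue_on S)"
proof -
  have "S \<in> lmeasurable" using assms by (rule lmeasurable_open[rotated])
  then have "S \<in> sets lebesgue" "emeasure lebesgue S < \<infinity>" by (auto simp: fmeasurable_def)
  then show ?thesis by (intro finite_measureI) (simp add: emeasure_restrict_space)
qed

text \<open>A geometric rate makes the increments summable in the mean, so the sequence itself
  converges almost everywhere by telescoping, without passing to a subsequence; Fatou's lemma
  carries the rate over to the limit.\<close>

lemma L2_fast_limit:
  assumes S: "open S" "bounded S" and f: "\<And>k. f k \<in> L2 S"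
    and fast: "\<And>m n. m \<le> n \<Longrightarrow> L2_norm S (\<lambda>x. f m x - f n x) \<le> 2 / 2 ^ m"
  obtains g where "g \<in> L2 S" "\<And>n. L2_norm S (\<lambda>x. f n x - g x) \<le> 2 / 2 ^ n"
proof -
  let ?M = "lebesgue_on S"
  interpret finite_measure ?M by (rule finite_measure_lebesgue_on[OF S])
  have fm [measurable]: "f k \<in> borel_measurable ?M" for k using f by (simp add: L2_def)
  have one: "(\<lambda>x. 1) \<in> L2 S" by (simp add: L2_def)
  have df: "(\<lambda>x. f m x - f n x) \<in> L2 S" for m n by (intro L2_diff f)
  have int: "integrable ?M (\<lambda>x. \<bar>f k x - f (Suc k) x\<bar>)" for k
    using L2_integrable[OF lmeasurable_open[OF S(2,1)] df] by simp
  \<comment> \<open>Cauchy-Schwarz against the constant 1, which lies in \<open>L2 S\<close> because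
    \<open>S\<close> has finite measure, turns the rate in \<open>L2\<close> into a summable bound
    on integrals of absolute values.\<close>
  have bd: "(\<integral>x. \<bar>f k x - f (Suc k) x\<bar> \<partial>?M) \<le> 2 * L2_norm S (\<lambda>x. 1) * (1 / 2) ^ k" for k
  proof -
    have "(\<lambda>x. \<bar>f k x - f (Suc k) x\<bar>) \<in> L2 S" using df[of k "Suc k"] by (auto simp: L2_def)
    from L2_cauchy_schwarz[OF this one]
    have "(\<integral>x. \<bar>f k x - f (Suc k) x\<bar> \<partial>?M) \<le> L2_norm S (\<lambda>x. \<bar>f k x - f (Suc k) x\<bar>) * L2_norm S (\<lambda>x. 1)"
      by simp
    also have "L2_norm S (\<lambda>x. \<bar>f k x - f (Suc k) x\<bar>) = L2_norm S (\<lambda>x. f k x - f (Suc k) x)"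
      by (simp add: L2_norm_def)
    also have "\<dots> * L2_norm S (\<lambda>x. 1) \<le> 2 / 2 ^ k * L2_norm S (\<lambda>x. 1)"
      by (intro mult_right_mono fast) auto
    finally show ?thesis by (simp add: power_one_over field_simps)
  qed
  have "(\<integral>\<^sup>+x. (\<Sum>k. ennreal \<bar>f k x - f (Suc k) x\<bar>) \<partial>?M) = (\<Sum>k. \<integral>\<^sup>+x. ennreal \<bar>f k x - f (Suc k) x\<bar> \<partial>?M)"
    by (rule nn_integral_suminf) simp
  also have "\<dots> = (\<Sum>k. ennreal (\<integral>x. \<bar>f k x - f (Suc k) x\<bar> \<partial>?M))"
    by (intro arg_cong[of _ _ suminf] ext nn_integral_eq_integral int) simp
  also have "\<dots> \<le> (\<Sum>k. ennreal (2 * L2_norm S (\<lambda>x. 1) * (1 / 2) ^ k))"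
    by (intro suminf_le ennreal_leI bd) auto
  also have "\<dots> = ennreal (\<Sum>k. 2 * L2_norm S (\<lambda>x. 1) * (1 / 2) ^ k)"
    by (rule suminf_ennreal2) (auto intro!: summable_mult summable_geometric)
  finally have "(\<integral>\<^sup>+x. (\<Sum>k. ennreal \<bar>f k x - f (Suc k) x\<bar>) \<partial>?M) \<noteq> \<infinity>"
    by (metis ennreal_neq_top infinity_ennreal_def neq_top_trans)
  then have "AE x in ?M. (\<Sum>k. ennreal \<bar>f k x - f (Suc k) x\<bar>) \<noteq> \<infinity>"
    by (intro nn_integral_noteq_infinite) simp_all
  then have conv: "AE x in ?M. convergent (\<lambda>n. f n x)"
  proof eventually_elim
    case (elim x)
    have "summable (\<lambda>k. \<bar>f k x - f (Suc k) x\<bar>)"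
      by (rule summable_suminf_not_top) (use elim in auto)
    then have "summable (\<lambda>k. f k x - f (Suc k) x)" by (rule summable_rabs_cancel)
    then have "convergent (\<lambda>n. \<Sum>k<n. f k x - f (Suc k) x)" by (simp add: summable_iff_convergent)
    then have "convergent (\<lambda>n. f 0 x - f n x)" unfolding sum_lessThan_telescope'[of "\<lambda>k. f k x"] .
    then have "convergent (\<lambda>n. f 0 x - (f 0 x - f n x))" by (rule convergent_diff[OF convergent_const])
    then show ?case by simp
  qed
  define g where "g x = lim (\<lambda>n. f n x)" for x
  have [measurable]: "g \<in> borel_measurable ?M" unfolding g_def[abs_def] by (rule borel_measurable_lim_metric) simp
  \<comment> \<open>Fatou's lemma in the second index: for m \<ge> n the distances all stay below
    the same bound.\<close>
  have nn: "(\<integral>\<^sup>+x. ennreal ((f n x - g x)\<^sup>2) \<partial>?M) \<le> ennreal ((2 / 2 ^ n)\<^sup>2)" for n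
  proof -
    have "(\<integral>\<^sup>+x. ennreal ((f n x - g x)\<^sup>2) \<partial>?M) = (\<integral>\<^sup>+x. liminf (\<lambda>m. ennreal ((f n x - f m x)\<^sup>2)) \<partial>?M)"
    proof (rule nn_integral_cong_AE)
      show "AE x in ?M. ennreal ((f n x - g x)\<^sup>2) = liminf (\<lambda>m. ennreal ((f n x - f m x)\<^sup>2))"
        using conv
      proof eventually_elim
        case (elim x)
        then have "(\<lambda>m. f m x) \<longlonglongrightarrow> g x" unfolding g_def by (simp add: convergent_LIMSEQ_iff)
        then have "(\<lambda>m. ennreal ((f n x - f m x)\<^sup>2)) \<longlonglongrightarrow> ennreal ((f n x - g x)\<^sup>2)"
          by (intro tendsto_intros)
        then show ?case by (intro lim_imp_Liminf[symmetric]) auto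
      qed
    qed
    also have "\<dots> \<le> liminf (\<lambda>m. \<integral>\<^sup>+x. ennreal ((f n x - f m x)\<^sup>2) \<partial>?M)"
      by (rule nn_integral_liminf) simp
    also have "\<dots> \<le> liminf (\<lambda>m. ennreal ((2 / 2 ^ n)\<^sup>2))"
    proof (rule Liminf_mono)
      show "\<forall>\<^sub>F m in sequentially. (\<integral>\<^sup>+x. ennreal ((f n x - f m x)\<^sup>2) \<partial>?M) \<le> ennreal ((2 / 2 ^ n)\<^sup>2)"
        unfolding eventually_sequentially
      proof (intro exI[of _ n] allI impI)
        fix m assume "n \<le> m"
        have "(\<integral>\<^sup>+x. ennreal ((f n x - f m x)\<^sup>2) \<partial>?M) = ennreal ((L2_norm S (\<lambda>x. f n x - f m x))\<^sup>2)"
          unfolding L2_norm_sq using df[of n m] by (intro nn_integral_eq_integral) (auto simp: L2_def)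
        also have "\<dots> \<le> ennreal ((2 / 2 ^ n)\<^sup>2)"
          by (intro ennreal_leI power_mono fast[OF \<open>n \<le> m\<close>]) simp
        finally show "(\<integral>\<^sup>+x. ennreal ((f n x - f m x)\<^sup>2) \<partial>?M) \<le> ennreal ((2 / 2 ^ n)\<^sup>2)" .
      qed
    qed
    also have "\<dots> = ennreal ((2 / 2 ^ n)\<^sup>2)" by (rule Liminf_const) simp
    finally show ?thesis .
  qed
  have i: "integrable ?M (\<lambda>x. (f n x - g x)\<^sup>2)" for n
  proof (rule integrableI_nonneg)
    show "(\<integral>\<^sup>+x. ennreal ((f n x - g x)\<^sup>2) \<partial>?M) < \<infinity>"
      by (rule le_less_trans[OF nn]) simp
  qed auto
  have d: "(\<lambda>x. f n x - g x) \<in> L2 S" for n using i by (simp add: L2_def)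
  show ?thesis
  proof (rule that)
    show "g \<in> L2 S" using L2_diff[OF f d, of 0 0] by simp
    fix n
    have "ennreal ((L2_norm S (\<lambda>x. f n x - g x))\<^sup>2) = (\<integral>\<^sup>+x. ennreal ((f n x - g x)\<^sup>2) \<partial>?M)"
      unfolding L2_norm_sq using i by (intro nn_integral_eq_integral[symmetric]) auto
    with nn have "(L2_norm S (\<lambda>x. f n x - g x))\<^sup>2 \<le> (2 / 2 ^ n)\<^sup>2"
      by (metis ennreal_le_iff zero_le_power2)
    then show "L2_norm S (\<lambda>x. f n x - g x) \<le> 2 / 2 ^ n" by (rule power2_le_imp_le) simp
  qed
qed

section \<open>Test functions as elements of \<open>H20\<close> and the dual norm\<close>

lemma lap_zero: "lap (\<lambda>x. 0) = (\<lambda>x. 0)"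
  by (simp add: lap_def[abs_def] pds_def)

lemma lap_lincomb:
  assumes "smooth f" "smooth g"
  shows "lap (\<lambda>x. a * f x + b * g x) x = a * lap f x + b * lap g x"
proof -
  have pd: "pd i (\<lambda>x. a * f x + b * g x) = (\<lambda>x. a * pd i f x + b * pd i g x)" if "smooth f" "smooth g" for f g i
  proof
    fix x
    have "(\<lambda>x. a * f x) differentiable (at x)" "(\<lambda>x. b * g x) differentiable (at x)"
      using that by (intro smooth_differentiable smooth_mult smooth_const; simp)+
    then show "pd i (\<lambda>x. a * f x + b * g x) x = a * pd i f x + b * pd i g x"
      using that by (simp add: pd_add pd_cmult smooth_differentiable)
  qed
  show ?thesis using assms
    by (simp add: lap_def pds_def pd smooth_pd sum.distrib sum_distrib_left)
qed

lemma test_funs_lincomb: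
  assumes "f \<in> test_funs S" "g \<in> test_funs S"
  shows "(\<lambda>x. a * f x + b * g x) \<in> test_funs S"
proof -
  have "{x. a * f x + b * g x \<noteq> 0} \<subseteq> {x. f x \<noteq> 0} \<union> {x. g x \<noteq> 0}" by auto
  from closure_mono[OF this] have "closure {x. a * f x + b * g x \<noteq> 0} \<subseteq> S"
    using assms by (auto simp: test_funs_iff)
  then show ?thesis
    using assms by (auto simp: test_funs_iff intro!: cinf_add cinf_mult smooth_const)
qed

text \<open>\<open>weak_pds\<close> is a choice, so it can only be compared almost everywhere with
  the classical derivative, using uniqueness from \<open>L2_zeroI\<close>. The list is reversed
  because integration by parts peels off the outermost derivative of one factor and makes it the
  innermost one of the other.\<close>

lemma test_fun_weak_pds:
  fixes \<phi> :: "real ^ 'n \<Rightarrow> real"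
  assumes S: "open S" "bounded S" and \<phi>: "\<phi> \<in> test_funs S"
  shows "\<phi> \<in> H2 S" and "length is \<le> 2 \<Longrightarrow> AE x in lebesgue_on S. weak_pds S is \<phi> x = pds (rev is) \<phi> x"
proof -
  have c: "cinf \<phi>" using \<phi> by (simp add: test_funs_iff)
  have *: "(\<integral>x. f x * pds is \<psi> x \<partial>lborel) = (- 1) ^ length is * (\<integral>x. pds (rev is) f x * \<psi> x \<partial>lborel)"
    if "smooth f" "cinf \<psi>" for f \<psi> :: "real ^ 'n \<Rightarrow> real" and "is"
    using that(1)
  proof (induction "is" arbitrary: f)
    case Nil
    then show ?case by (simp add: pds_def)
  next
    case (Cons i "is")
    have "(\<integral>x. f x * pds (i # is) \<psi> x \<partial>lborel) = - (\<integral>x. pd i f x * pds is \<psi> x \<partial>lborel)"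
      using integral_by_parts[OF Cons.prems cinf_pds[OF that(2)], of i "is"] by (simp add: pds_def)
    then show ?case using Cons.IH[OF smooth_pd[OF Cons.prems], of i] by (simp add: pds_def)
  qed
  have L: "pds is \<phi> \<in> L2 S" for "is" using S(1) by (intro L2_cinf cinf_pds c) auto
  have wk: "is_weak_pds S is \<phi> (pds (rev is) \<phi>)" for "is"
    unfolding is_weak_pds_def
  proof
    fix \<psi> assume \<psi>: "\<psi> \<in> test_funs S"
    have c': "cinf \<psi>" using \<psi> by (simp add: test_funs_iff)
    have b: "(\<lambda>x. \<phi> x * pds is \<psi> x) \<in> borel_measurable borel" "(\<lambda>x. pds (rev is) \<phi> x * \<psi> x) \<in> borel_measurable borel"
      by (intro smooth_borel smooth_mult cinf_smooth cinf_pds c c')+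
    have z: "\<psi> x = 0" "pds is \<psi> x = 0" if "x \<notin> S" for x
      using test_funs_pds_zero[OF \<psi> that, of "[]"] test_funs_pds_zero[OF \<psi> that] by (auto simp: pds_def)
    show "(\<integral>x. \<phi> x * pds is \<psi> x \<partial>lebesgue_on S) = (- 1) ^ length is * (\<integral>x. pds (rev is) \<phi> x * \<psi> x \<partial>lebesgue_on S)"
      using *[OF cinf_smooth[OF c] c', of "is"] integral_lebesgue_on_supported[OF S(1) b(1)] integral_lebesgue_on_supported[OF S(1) b(2)] z
      by simp
  qed
  show H: "\<phi> \<in> H2 S" using L[of "[]"] L wk unfolding H2_def by (auto simp: pds_def)
  show "AE x in lebesgue_on S. weak_pds S is \<phi> x = pds (rev is) \<phi> x" if l: "length is \<le> 2"
  proof -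
    note W = weak_pds_L2[OF H l]
    have "AE x in lebesgue_on S. weak_pds S is \<phi> x - pds (rev is) \<phi> x = 0"
    proof (rule L2_zeroI[OF S L2_diff[OF W(1) L]])
      fix \<psi> assume \<psi>: "\<psi> \<in> test_funs S"
      have p: "\<psi> \<in> L2 S" using \<psi> S(1) by (intro L2_cinf) (auto simp: test_funs_iff)
      have "(- 1) ^ length is * (\<integral>x. weak_pds S is \<phi> x * \<psi> x \<partial>lebesgue_on S) = (- 1) ^ length is * (\<integral>x. pds (rev is) \<phi> x * \<psi> x \<partial>lebesgue_on S)"
        using W(2) wk[of "is"] \<psi> unfolding is_weak_pds_def by (metis (no_types, lifting))
      then have "(\<integral>x. weak_pds S is \<phi> x * \<psi> x \<partial>lebesgue_on S) = (\<integral>x. pds (rev is) \<phi> x * \<psi> x \<partial>lebesgue_on S)" by simp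
      then show "(\<integral>x. (weak_pds S is \<phi> x - pds (rev is) \<phi> x) * \<psi> x \<partial>lebesgue_on S) = 0"
        using L2_mult_integrable(1)[OF W(1) p] L2_mult_integrable(1)[OF L p] by (simp add: left_diff_distrib)
    qed
    then show ?thesis by eventually_elim simp
  qed
qed

lemma L2_norm_supported:
  assumes "open S" "cinf f" "\<And>x. x \<notin> S \<Longrightarrow> f x = 0"
  shows "(L2_norm S f)\<^sup>2 = (\<integral>x. (f x)\<^sup>2 \<partial>lborel)"
  unfolding L2_norm_sq
  using assms by (intro integral_lebesgue_on_supported) (auto simp: cinf_def smooth_borel)

lemma lap_test_zero:
  assumes "\<phi> \<in> test_funs S" "x \<notin> S"
  shows "lap \<phi> x = 0"
  unfolding lap_def using test_funs_pds_zero[OF assms] by simp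

text \<open>Almost everywhere the weak derivatives are classical ones, each bounded by
  \<open>pds_le_laplacian\<close>; the square of the constant is that bound times the number of
  index lists. Coercivity on test functions is what lets the dual norm of \<open>B z\<close> control
  the projection of \<open>z\<close>.\<close>

lemma H2_norm_le_laplacian:
  fixes S :: "(real ^ 'n) set"
  assumes S: "open S" "bounded S"
  obtains C where "C > 0" "\<And>\<phi>. \<phi> \<in> test_funs S \<Longrightarrow> H2_norm S \<phi> \<le> C * L2_norm S (lap \<phi>)"
proof -
  obtain R where R: "R > 0" "\<And>x. x \<in> S \<Longrightarrow> norm x \<le> R" using S(2) by (auto simp: bounded_pos)
  let ?A = "{is :: 'n list. length is \<le> 2}"
  have fin: "finite ?A" using finite_lists_length_le[of "UNIV :: 'n set" 2] by simp
  define C2 where "C2 = real (card ?A) * (1 + 4 * R\<^sup>2)\<^sup>2"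
  have "[] \<in> ?A" by simp
  then have "card ?A > 0" using fin card_gt_0_iff by blast
  moreover have "1 + 4 * R\<^sup>2 > 0" using R(1) by (simp add: add_pos_pos)
  ultimately have C2: "C2 > 0" unfolding C2_def by simp
  have "H2_norm S \<phi> \<le> sqrt C2 * L2_norm S (lap \<phi>)" if \<phi>: "\<phi> \<in> test_funs S" for \<phi>
  proof -
    have c: "cinf \<phi>" using \<phi> by (simp add: test_funs_iff)
    have l: "(\<integral>x. (lap \<phi> x)\<^sup>2 \<partial>lborel) = (L2_norm S (lap \<phi>))\<^sup>2"
      using L2_norm_supported[OF S(1) cinf_lap[OF c] lap_test_zero[OF \<phi>]] by simp
    have "(L2_norm S (weak_pds S is \<phi>))\<^sup>2 \<le> (1 + 4 * R\<^sup>2)\<^sup>2 * (L2_norm S (lap \<phi>))\<^sup>2" if is2: "length is \<le> 2" for "is"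
    proof -
      have "L2_norm S (weak_pds S is \<phi>) = L2_norm S (pds (rev is) \<phi>)"
        using test_fun_weak_pds(2)[OF S \<phi> is2] weak_pds_L2(1)[OF test_fun_weak_pds(1)[OF S \<phi>] is2]
          L2_cinf[OF _ cinf_pds[OF c], of S "rev is"] S(1)
        by (intro L2_norm_cong_AE) (auto simp: L2_def)
      then have "(L2_norm S (weak_pds S is \<phi>))\<^sup>2 = (\<integral>x. (pds (rev is) \<phi> x)\<^sup>2 \<partial>lborel)"
        using L2_norm_supported[OF S(1) cinf_pds[OF c] test_funs_pds_zero[OF \<phi>]] by simp
      also have "\<dots> \<le> (1 + 4 * R\<^sup>2)\<^sup>2 * (\<integral>x. (lap \<phi> x)\<^sup>2 \<partial>lborel)"
      proof (rule pds_le_laplacian[OF c])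
        show "norm x \<le> R" if "\<phi> x \<noteq> 0" for x
          using R(2) test_funs_pds_zero[OF \<phi>, of x "[]"] that by (auto simp: pds_def)
      qed (use is2 in simp)
      finally show ?thesis unfolding l .
    qed
    then have "(\<Sum>is | length is \<le> 2. (L2_norm S (weak_pds S is \<phi>))\<^sup>2) \<le> of_nat (card ?A) * ((1 + 4 * R\<^sup>2)\<^sup>2 * (L2_norm S (lap \<phi>))\<^sup>2)"
      by (intro sum_bounded_above) simp
    then have "H2_norm S \<phi> \<le> sqrt (C2 * (L2_norm S (lap \<phi>))\<^sup>2)"
      unfolding H2_norm_def C2_def by (intro real_sqrt_le_mono) (simp add: mult.assoc)
    then show ?thesis by (simp add: real_sqrt_mult)
  qed
  then show ?thesis using that[of "sqrt C2"] C2 by simp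
qed

lemma opB_test_fun:
  assumes S: "open S" "bounded S" and z: "z \<in> L2 S" and \<phi>: "\<phi> \<in> test_funs S"
  shows "\<phi> \<in> H20 S" and "opB S z \<phi> = - (\<integral>x. z x * lap \<phi> x \<partial>lebesgue_on S)"
proof -
  have c: "cinf \<phi>" using \<phi> by (simp add: test_funs_iff)
  have H: "\<phi> \<in> H2 S" by (rule test_fun_weak_pds[OF S \<phi>])
  have t0: "(\<lambda>x. 0) \<in> test_funs S" using test_funs_lincomb[OF \<phi> \<phi>, of 0 0] by simp
  obtain C where C: "C > 0" "\<And>\<phi>. \<phi> \<in> test_funs S \<Longrightarrow> H2_norm S \<phi> \<le> C * L2_norm S (lap \<phi>)"
    using H2_norm_le_laplacian[OF S] by blast
  \<comment> \<open>The weak derivatives of the zero function are chosen representatives, so the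
    value of its norm is obtained from the Laplacian bound.\<close>
  have "H2_norm S (\<lambda>x. 0) \<le> 0" using C(2)[OF t0] by (simp add: L2_norm_def lap_zero)
  then show H20: "\<phi> \<in> H20 S"
    using H \<phi> unfolding H20_def by (auto intro!: bexI[of _ \<phi>])
  have "(\<integral>x. z x * weak_laplacian S \<phi> x \<partial>lebesgue_on S) = (\<integral>x. z x * lap \<phi> x \<partial>lebesgue_on S)"
  proof (rule integral_cong_AE)
    have m: "weak_pds S [i, i] \<phi> \<in> borel_measurable (lebesgue_on S)" for i
      using weak_pds_L2(1)[OF H, of "[i, i]"] by (simp add: L2_def)
    show "(\<lambda>x. z x * weak_laplacian S \<phi> x) \<in> borel_measurable (lebesgue_on S)"
      unfolding weak_laplacian_def using z m by (intro borel_measurable_times borel_measurable_sum) (auto simp: L2_def)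
    have "lap \<phi> \<in> L2 S" using S(1) by (intro L2_cinf cinf_lap c) auto
    then show "(\<lambda>x. z x * lap \<phi> x) \<in> borel_measurable (lebesgue_on S)" using z by (auto simp: L2_def)
    have "AE x in lebesgue_on S. \<forall>i\<in>UNIV. weak_pds S [i, i] \<phi> x = pds [i, i] \<phi> x"
      using test_fun_weak_pds(2)[OF S \<phi>, of "[i, i]" for i] by (subst AE_finite_all) auto
    then show "AE x in lebesgue_on S. z x * weak_laplacian S \<phi> x = z x * lap \<phi> x"
      by eventually_elim (simp add: weak_laplacian_def lap_def)
  qed
  then show "opB S z \<phi> = - (\<integral>x. z x * lap \<phi> x \<partial>lebesgue_on S)" using H20 by (simp add: opB_def)
qed

text \<open>Dividing \<phi> by the upper bound for its norm places it in the unit ball over which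
  the dual norm is the supremum. If the Laplacian has norm zero, no such scaling exists, and
  Cauchy-Schwarz makes the left-hand side vanish.\<close>

lemma Hm2_norm_test_fun:
  fixes S :: "(real ^ 'n) set"
  assumes S: "open S" "bounded S" and z: "z \<in> L2 S" and \<phi>: "\<phi> \<in> test_funs S"
    and C: "C > 0" "\<And>\<phi>. \<phi> \<in> test_funs S \<Longrightarrow> H2_norm S \<phi> \<le> C * L2_norm S (lap \<phi>)"
  shows "\<bar>\<integral>x. z x * lap \<phi> x \<partial>lebesgue_on S\<bar> \<le> Hm2_norm S (opB S z) * (C * L2_norm S (lap \<phi>))"
proof (cases "L2_norm S (lap \<phi>) = 0")
  case True
  have "lap \<phi> \<in> L2 S" using S(1) \<phi> by (intro L2_cinf cinf_lap) (auto simp: test_funs_iff)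
  from L2_cauchy_schwarz[OF z this] show ?thesis using True by simp
next
  case False
  define N where "N = C * L2_norm S (lap \<phi>)"
  have N: "N > 0" using False C(1) L2_norm_nonneg[of S "lap \<phi>"] by (simp add: N_def less_le)
  have s: "smooth \<phi>" using \<phi> by (simp add: test_funs_iff cinf_smooth)
  \<comment> \<open>The vanishing second summand gives the multiple of \<phi> the form expected by
    the lemmas on linear combinations.\<close>
  let ?\<psi> = "\<lambda>x. (1 / N) * \<phi> x + 0 * \<phi> x"
  have \<psi>: "?\<psi> \<in> test_funs S" by (rule test_funs_lincomb[OF \<phi> \<phi>])
  have lp: "lap ?\<psi> = (\<lambda>x. (1 / N) * lap \<phi> x)" using lap_lincomb[OF s s, of "1 / N" 0] by (auto simp: fun_eq_iff)
  have "(\<lambda>x. ((1 / N) * lap \<phi> x)\<^sup>2) = (\<lambda>x. (1 / N)\<^sup>2 * (lap \<phi> x)\<^sup>2)" by (simp only: power_mult_distrib)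
  then have "L2_norm S (lap ?\<psi>) = L2_norm S (lap \<phi>) / N"
    unfolding lp L2_norm_def using N by (simp add: real_sqrt_mult real_sqrt_divide)
  then have "H2_norm S ?\<psi> \<le> 1" using C False C(2)[OF \<psi>] by (simp add: N_def)
  then have "\<bar>opB S z ?\<psi>\<bar> \<le> Hm2_norm S (opB S z)"
    unfolding Hm2_norm_def using opB_test_fun(1)[OF S z \<psi>]
    by (intro cSUP_upper2[OF _ _ order_refl] bdd_above_opB z) auto
  moreover have "opB S z ?\<psi> = - (\<integral>x. (1 / N) * (z x * lap \<phi> x) \<partial>lebesgue_on S)"
    unfolding opB_test_fun(2)[OF S z \<psi>] lp by (simp add: mult.left_commute)
  ultimately have "\<bar>\<integral>x. z x * lap \<phi> x \<partial>lebesgue_on S\<bar> / N \<le> Hm2_norm S (opB S z)"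
    using N by simp
  then show ?thesis using N by (simp add: N_def[symmetric] divide_le_eq)
qed

text \<open>\<open>v\<close> is the orthogonal projection of \<open>z\<close> onto the closure of
  the Laplacians of test functions, obtained as the limit of a minimising sequence. Orthogonality of
  \<open>z - v\<close> replaces \<open>v\<close> by \<open>z\<close> in pairings with Laplacians, so
  its norm can be estimated through \<open>B z\<close>.\<close>

lemma harmonic_splitting:
  fixes S :: "(real ^ 'n) set"
  assumes S: "open S" "bounded S" and z: "z \<in> L2 S"
    and C: "C > 0" "\<And>\<phi>. \<phi> \<in> test_funs S \<Longrightarrow> H2_norm S \<phi> \<le> C * L2_norm S (lap \<phi>)"
  obtains v where "v \<in> L2 S" "L2_norm S v \<le> C * Hm2_norm S (opB S z)"
    "\<And>\<phi>. \<phi> \<in> test_funs S \<Longrightarrow> (\<integral>x. (z x - v x) * lap \<phi> x \<partial>lebesgue_on S) = 0"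
proof -
  let ?Q = "\<lambda>\<phi>. (L2_norm S (\<lambda>x. z x - lap \<phi> x))\<^sup>2"
  define d where "d = (INF \<phi>\<in>test_funs S. ?Q \<phi>)"
  have l: "lap \<phi> \<in> L2 S" "smooth \<phi>" if "\<phi> \<in> test_funs S" for \<phi>
    using that S(1) by (auto simp: test_funs_iff cinf_smooth intro!: L2_cinf cinf_lap)
  have "(\<lambda>x. 0) \<in> test_funs S" by (simp add: test_funs_iff cinf_0)
  then have ne: "test_funs S \<noteq> {}" by blast
  have bdd: "bdd_below (?Q ` test_funs S)" by (intro bdd_belowI2[of _ 0]) simp
  have dle: "d \<le> ?Q \<phi>" if "\<phi> \<in> test_funs S" for \<phi> unfolding d_def by (rule cINF_lower[OF bdd that])
  \<comment> \<open>The excess is geometric in the squared distance so that the parallelogram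
    identity below gives exactly the rate required by \<open>L2_fast_limit\<close>.\<close>
  have "\<exists>\<phi>\<in>test_funs S. ?Q \<phi> < d + (1 / 4) ^ k" for k
    using cInf_lessD[of "?Q ` test_funs S" "d + (1 / 4) ^ k"] ne unfolding d_def by auto
  then obtain p where p: "\<And>k. p k \<in> test_funs S" "\<And>k. ?Q (p k) < d + (1 / 4) ^ k" by metis
  have fast: "L2_norm S (\<lambda>x. lap (p m) x - lap (p n) x) \<le> 2 / 2 ^ m" if mn: "m \<le> n" for m n
  proof -
    \<comment> \<open>The midpoint is admissible, so its squared distance to \<open>z\<close> is at
      least \<open>d\<close>. In the parallelogram identity the terms with \<open>d\<close> cancel
      and only the two excesses remain.\<close>
    let ?r = "\<lambda>x. (1 / 2) * p m x + (1 / 2) * p n x"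
    have r: "?r \<in> test_funs S" by (intro test_funs_lincomb p)
    have lr: "lap ?r x = (1 / 2) * lap (p m) x + (1 / 2) * lap (p n) x" for x by (rule lap_lincomb) (use l p in auto)
    have i: "integrable (lebesgue_on S) (\<lambda>x. (z x - lap \<phi> x)\<^sup>2)" if "\<phi> \<in> test_funs S" for \<phi>
      using L2_diff[OF z l(1)[OF that]] by (simp add: L2_def)
    have "(\<lambda>x. (lap (p m) x - lap (p n) x)\<^sup>2) = (\<lambda>x. 2 * (z x - lap (p m) x)\<^sup>2 + 2 * (z x - lap (p n) x)\<^sup>2 - 4 * (z x - lap ?r x)\<^sup>2)"
      unfolding lr by (auto simp: fun_eq_iff power2_eq_square field_simps)
    then have "(L2_norm S (\<lambda>x. lap (p m) x - lap (p n) x))\<^sup>2 = 2 * ?Q (p m) + 2 * ?Q (p n) - 4 * ?Q ?r"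
      unfolding L2_norm_sq using i[OF p(1)[of m]] i[OF p(1)[of n]] i[OF r] by simp
    also have "\<dots> \<le> 2 * (1 / 4) ^ m + 2 * (1 / 4) ^ n" using p(2)[of m] p(2)[of n] dle[OF r] by linarith
    also have "\<dots> \<le> 4 * (1 / 4) ^ m" using power_decreasing[OF mn, of "1 / 4 :: real"] by simp
    also have "\<dots> = (2 / 2 ^ m)\<^sup>2" by (simp add: power_divide power2_eq_square flip: power_mult_distrib)
    finally show ?thesis by (rule power2_le_imp_le) simp
  qed
  obtain v where v: "v \<in> L2 S" "\<And>n. L2_norm S (\<lambda>x. lap (p n) x - v x) \<le> 2 / 2 ^ n"
    using L2_fast_limit[OF S l(1)[OF p(1)] fast] by blast
  have half: "(\<lambda>n. c / 2 ^ n) \<longlonglongrightarrow> 0" for c :: real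
  proof -
    have "(\<lambda>n. c * (1 / 2) ^ n) \<longlonglongrightarrow> c * 0" by (intro tendsto_mult tendsto_const LIMSEQ_power_zero) simp
    then show ?thesis by (simp add: power_one_over)
  qed
  have orth: "(\<integral>x. (z x - v x) * lap \<phi> x \<partial>lebesgue_on S) = 0" if \<phi>: "\<phi> \<in> test_funs S" for \<phi>
  proof -
    let ?u = "lap \<phi>" and ?U = "L2_norm S (lap \<phi>)"
    let ?c = "\<lambda>k. \<integral>x. (z x - lap (p k) x) * ?u x \<partial>lebesgue_on S"
    have u: "?u \<in> L2 S" by (rule l[OF \<phi>])
    have zl: "(\<lambda>x. z x - lap (p k) x) \<in> L2 S" for k by (intro L2_diff z l p)
    \<comment> \<open>Perturbing the almost minimal \<open>p k\<close> by a multiple of \<phi>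
      cannot lower the squared distance below \<open>d\<close>.\<close>
    have step: "2 * t * ?c k \<le> (1 / 4) ^ k + t\<^sup>2 * ?U\<^sup>2" for t k
    proof -
      let ?r = "\<lambda>x. 1 * p k x + t * \<phi> x"
      have r: "?r \<in> test_funs S" by (intro test_funs_lincomb p \<phi>)
      have "lap ?r x = 1 * lap (p k) x + t * ?u x" for x by (rule lap_lincomb) (use l p \<phi> in auto)
      then have "?Q ?r = (L2_norm S (\<lambda>x. (z x - lap (p k) x) + (- t) * ?u x))\<^sup>2" by (simp add: algebra_simps)
      also have "\<dots> = ?Q (p k) + 2 * (- t) * ?c k + (- t)\<^sup>2 * ?U\<^sup>2" by (rule L2_norm_sq_lincomb[OF zl u])
      finally show ?thesis using dle[OF r] p(2)[of k] by simp
    qed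
    have c: "\<bar>?c k\<bar> \<le> (1 + ?U\<^sup>2) / 2 ^ k" for k
    proof -
      have e: "(1 / 4 :: real) ^ k = (1 / 2 ^ k)\<^sup>2" by (simp add: power_divide power2_eq_square flip: power_mult_distrib)
      \<comment> \<open>With t = 2^(-k) and its negative, both terms on the right are of order
        4^(-k); division by 2^(-k) leaves a bound that tends to zero.\<close>
      have "2 * (1 / 2 ^ k) * \<bar>?c k\<bar> \<le> (1 / 4) ^ k + (1 / 2 ^ k)\<^sup>2 * ?U\<^sup>2"
        using step[of "1 / 2 ^ k" k] step[of "- (1 / 2 ^ k)" k] by (simp add: abs_if)
      also have "\<dots> = (1 / 2 ^ k) * ((1 + ?U\<^sup>2) / 2 ^ k)" unfolding e by (simp add: power2_eq_square field_simps)
      finally have "(1 / 2 ^ k) * (2 * \<bar>?c k\<bar>) \<le> (1 / 2 ^ k) * ((1 + ?U\<^sup>2) / 2 ^ k)" by (simp add: mult_ac)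
      then have "2 * \<bar>?c k\<bar> \<le> (1 + ?U\<^sup>2) / 2 ^ k" by (rule mult_left_le_imp_le) simp
      then show ?thesis by linarith
    qed
    have "\<bar>\<integral>x. (z x - v x) * ?u x \<partial>lebesgue_on S\<bar> \<le> (1 + ?U\<^sup>2 + 2 * ?U) / 2 ^ k" for k
    proof -
      have d: "(\<lambda>x. lap (p k) x - v x) \<in> L2 S" by (intro L2_diff v l p)
      have "(\<integral>x. (z x - v x) * ?u x \<partial>lebesgue_on S) = (\<integral>x. (z x - lap (p k) x) * ?u x + (lap (p k) x - v x) * ?u x \<partial>lebesgue_on S)"
        by (simp add: algebra_simps)
      also have "\<dots> = ?c k + (\<integral>x. (lap (p k) x - v x) * ?u x \<partial>lebesgue_on S)"
        using L2_mult_integrable(1)[OF zl u] L2_mult_integrable(1)[OF d u] by simp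
      also have "\<bar>\<dots>\<bar> \<le> (1 + ?U\<^sup>2) / 2 ^ k + 2 / 2 ^ k * ?U"
        using c[of k] L2_cauchy_schwarz[OF d u] mult_right_mono[OF v(2)[of k], of ?U] by simp
      finally show ?thesis by (simp add: add_divide_distrib)
    qed
    then have "\<bar>\<integral>x. (z x - v x) * ?u x \<partial>lebesgue_on S\<bar> \<le> 0"
      by (intro LIMSEQ_le_const[OF half]) auto
    then show ?thesis by simp
  qed
  let ?V = "L2_norm S v" and ?b = "Hm2_norm S (opB S z)"
  have b0: "?b \<ge> 0"
  proof -
    have "(\<lambda>x. 0) \<in> {v \<in> H20 S. H2_norm S v \<le> 1}"
    proof -
      have t: "(\<lambda>x. 0) \<in> test_funs S" by (simp add: test_funs_iff cinf_0)
      have "H2_norm S (\<lambda>x. 0) \<le> 0" using C(2)[OF t] by (simp add: L2_norm_def lap_zero)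
      then show ?thesis using opB_test_fun(1)[OF S z t] by simp
    qed
    then show ?thesis unfolding Hm2_norm_def
      by (intro cSUP_upper2[OF bdd_above_opB[OF z]]) auto
  qed
  have "?V\<^sup>2 \<le> C * ?b * ?V + (2 * C * ?b + 2 * ?V) / 2 ^ k" for k
  proof -
    \<comment> \<open>The duality estimate with an error: one factor \<open>v\<close> is replaced by
      \<open>?l\<close>, to which orthogonality and \<open>Hm2_norm_test_fun\<close> apply. This
      replacement and the comparison of the norms of \<open>?l\<close> and \<open>v\<close> cost
      terms of order 2^(-k).\<close>
    let ?l = "lap (p k)"
    have lk: "?l \<in> L2 S" and d: "(\<lambda>x. v x - ?l x) \<in> L2 S" by (intro L2_diff v l p)+
    have e: "L2_norm S (\<lambda>x. v x - ?l x) \<le> 2 / 2 ^ k" using v(2)[of k] by (simp add: L2_norm_diff_commute)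
    have "(\<integral>x. (z x - v x) * ?l x \<partial>lebesgue_on S) = 0" by (rule orth[OF p(1)])
    then have zv: "(\<integral>x. v x * ?l x \<partial>lebesgue_on S) = (\<integral>x. z x * ?l x \<partial>lebesgue_on S)"
      using L2_mult_integrable(1)[OF z lk] L2_mult_integrable(1)[OF v(1) lk] by (simp add: left_diff_distrib)
    have "?V\<^sup>2 = (\<integral>x. v x * ?l x + v x * (v x - ?l x) \<partial>lebesgue_on S)"
      unfolding L2_norm_sq by (simp add: power2_eq_square algebra_simps)
    also have "\<dots> = (\<integral>x. z x * ?l x \<partial>lebesgue_on S) + (\<integral>x. v x * (v x - ?l x) \<partial>lebesgue_on S)"
      using L2_mult_integrable(1)[OF v(1) lk] L2_mult_integrable(1)[OF v(1) d] zv by simp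
    also have "\<dots> \<le> ?b * (C * L2_norm S ?l) + ?V * (2 / 2 ^ k)"
      using Hm2_norm_test_fun[OF S z p(1) C, of k] L2_cauchy_schwarz[OF v(1) d] mult_left_mono[OF e, of ?V] by simp
    also have "L2_norm S ?l \<le> ?V + 2 / 2 ^ k"
    proof -
      have "L2_norm S (\<lambda>x. v x - (v x - ?l x)) \<le> ?V + L2_norm S (\<lambda>x. v x - ?l x)" by (rule L2_triangle_diff[OF v(1) d])
      then show ?thesis using e by simp
    qed
    then have "?b * (C * L2_norm S ?l) \<le> ?b * (C * (?V + 2 / 2 ^ k))"
      using b0 C(1) by (intro mult_left_mono) auto
    finally show ?thesis by (simp add: algebra_simps add_divide_distrib)
  qed
  then have "?V\<^sup>2 \<le> C * ?b * ?V + 0"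
    by (intro LIMSEQ_le_const[OF tendsto_add[OF tendsto_const half]]) auto
  then have "?V \<le> C * ?b"
    using b0 C(1) by (cases "?V = 0") (auto simp: power2_eq_square less_le)
  then show ?thesis using that v(1) orth by blast
qed

text \<open>Weyl's lemma is applied to a Borel representative extended by zero. The harmonic
  function is continuous on \<open>S\<close>, hence measurable there, and inherits square
  integrability by equality almost everywhere.\<close>

lemma weakly_harmonic_L2:
  fixes S :: "(real ^ 'n) set"
  assumes S: "open S" "bounded S" and w: "w \<in> L2 S"
    and orth: "\<And>\<phi>. \<phi> \<in> test_funs S \<Longrightarrow> (\<integral>x. w x * lap \<phi> x \<partial>lebesgue_on S) = 0"
  obtains W where "harmonic_on S W" "AE x in lebesgue_on S. W x = w x" "W \<in> L2 S"
proof -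
  obtain w' where w': "integrable lborel w'" "\<And>x. x \<notin> S \<Longrightarrow> w' x = 0" "AE x in lebesgue_on S. w x = w' x"
    "\<And>g. g \<in> borel_measurable borel \<Longrightarrow> (\<integral>x. w x * g x \<partial>lebesgue_on S) = (\<integral>x. w' x * g x \<partial>lborel)"
    using borel_version[OF S w] by blast
  have "weakly_harmonic S w'"
    using w'(1) orth w'(4)[OF smooth_borel[OF cinf_smooth[OF cinf_lap]]]
    by (auto simp: weakly_harmonic_def test_funs_iff)
  then obtain W where W: "harmonic_on S W" "AE x in lborel. x \<in> S \<longrightarrow> W x = w' x"
    using weyl_lemma[OF S(1)] by blast
  from AE_completion[OF W(2)] have "AE x in lebesgue_on S. W x = w' x"
    using S(1) by (simp add: AE_restrict_space_iff)
  with w'(3) have ae: "AE x in lebesgue_on S. W x = w x" by eventually_elim simp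
  have "Ck_on (Suc (Suc 0)) S W" using W(1) by (simp add: harmonic_on_def numeral_2_eq_2)
  then have "continuous_on S W" using Ck_on_Suc_imp Ck_on.simps(1) by blast
  then have m: "W \<in> borel_measurable (lebesgue_on S)"
    using S(1) by (intro continuous_imp_measurable_on_sets_lebesgue) auto
  have "integrable (lebesgue_on S) (\<lambda>x. (W x)\<^sup>2)"
    by (rule integrable_cong_AE_imp[of _ "\<lambda>x. (w x)\<^sup>2"]) (use w m ae in \<open>auto simp: L2_def elim: eventually_mono\<close>)
  then show ?thesis using that W(1) ae m by (simp add: L2_def)
qed

section \<open>Powers under the convention for exponent zero\<close>

lemma rpow_mono: "0 \<le> x \<Longrightarrow> x \<le> y \<Longrightarrow> 0 \<le> a \<Longrightarrow> rpow x a \<le> rpow y a"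
  by (simp add: rpow_def powr_mono2)

lemma rpow_mult: "0 \<le> x \<Longrightarrow> 0 \<le> y \<Longrightarrow> rpow (x * y) a = rpow x a * rpow y a"
  by (simp add: rpow_def powr_mult)

lemma rpow_nonneg: "0 \<le> rpow x a"
  by (simp add: rpow_def)

lemma rpow_split: "0 \<le> x \<Longrightarrow> a \<noteq> 0 \<Longrightarrow> rpow x a * rpow x (1 - a) = x"
  by (auto simp: rpow_def simp flip: powr_add)

theorem theorem2p2:
  fixes \<omega> G \<Omega> :: "(real ^ 'n) set" and \<alpha> :: real
  assumes "domain \<omega>" and "domain G" and "domain \<Omega>"
    and "bounded \<omega>" and "bounded G" and "bounded \<Omega>"
    and "\<omega> \<subseteq> G" and "compactly_in G \<Omega>"
    and "0 < \<alpha>" and "\<alpha> \<le> 1"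
    and "\<exists>C\<^sub>0::real. \<forall>w. w \<in> L2 \<Omega> \<longrightarrow> harmonic_on \<Omega> w \<longrightarrow>
           L2_norm G w \<le> C\<^sub>0 * rpow (L2_norm \<omega> w) \<alpha> * rpow (L2_norm \<Omega> w) (1 - \<alpha>)"
  shows "\<exists>K::real. \<forall>z\<in>L2 \<Omega>.
           L2_norm G z \<le> K * rpow (data_norm \<Omega> \<omega> (opA \<Omega> \<omega> z)) \<alpha>
             * rpow (L2_norm \<Omega> z + data_norm \<Omega> \<omega> (opA \<Omega> \<omega> z)) (1 - \<alpha>)"
proof -
  have o: "open \<omega>" "open G" "open \<Omega>" using assms(1-3) by (auto simp: domain_def)
  have sub: "G \<subseteq> \<Omega>" "\<omega> \<subseteq> \<Omega>" using assms(7,8) closure_subset by (auto simp: compactly_in_def)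
  note S = o(3) assms(6)
  obtain C where C: "C > 0" "\<And>\<phi>. \<phi> \<in> test_funs \<Omega> \<Longrightarrow> H2_norm \<Omega> \<phi> \<le> C * L2_norm \<Omega> (lap \<phi>)"
    using H2_norm_le_laplacian[OF S] by blast
  obtain C0 where C0: "\<And>w. w \<in> L2 \<Omega> \<Longrightarrow> harmonic_on \<Omega> w \<Longrightarrow>
      L2_norm G w \<le> C0 * rpow (L2_norm \<omega> w) \<alpha> * rpow (L2_norm \<Omega> w) (1 - \<alpha>)"
    using assms(11) by blast
  show ?thesis
  \<comment> \<open>The term with |C0| comes from the harmonic part and the summand \<open>C\<close>
    from \<open>v\<close>. The absolute value is taken because \<open>C0\<close> carries no sign
    condition, while the estimate is monotone only for nonnegative factors.\<close>
  proof (intro exI[of _ "\<bar>C0\<bar> * (1 + C) + C"] ballI)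
    fix z assume z: "z \<in> L2 \<Omega>"
    define D where "D = data_norm \<Omega> \<omega> (opA \<Omega> \<omega> z)"
    define N where "N = L2_norm \<Omega> z + D"
    have D0: "D \<ge> 0" by (simp add: D_def data_norm_def)
    have N0: "D \<le> N" by (simp add: N_def)
    have bD: "Hm2_norm \<Omega> (opB \<Omega> z) \<le> D"
      unfolding D_def data_norm_def opA_def fst_conv by (rule real_le_rsqrt) simp
    \<comment> \<open>\<open>restrict\<close> changes \<open>z\<close> only off \<omega>, which this
      norm does not see.\<close>
    have "L2_norm \<omega> (opC \<omega> z) = L2_norm \<omega> z"
      unfolding L2_norm_def opC_def
      by (intro arg_cong[of _ _ sqrt] Bochner_Integration.integral_cong) auto
    then have cD: "L2_norm \<omega> z \<le> D"
      unfolding D_def data_norm_def opA_def snd_conv by (intro real_le_rsqrt) simp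
    obtain v where v: "v \<in> L2 \<Omega>" "L2_norm \<Omega> v \<le> C * Hm2_norm \<Omega> (opB \<Omega> z)"
      "\<And>\<phi>. \<phi> \<in> test_funs \<Omega> \<Longrightarrow> (\<integral>x. (z x - v x) * lap \<phi> x \<partial>lebesgue_on \<Omega>) = 0"
      using harmonic_splitting[OF S z C] by blast
    have vD: "L2_norm \<Omega> v \<le> C * D" using v(2) mult_left_mono[OF bD, of C] C(1) by linarith
    have zv: "(\<lambda>x. z x - v x) \<in> L2 \<Omega>" by (intro L2_diff z v)
    obtain W where W: "harmonic_on \<Omega> W" "AE x in lebesgue_on \<Omega>. W x = z x - v x" "W \<in> L2 \<Omega>"
      using weakly_harmonic_L2[OF S zv v(3)] by blast
    \<comment> \<open>Equality almost everywhere on \<Omega> passes to open subsets; it is used for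
      \<omega>, G and \<Omega> alike.\<close>
    have eq: "L2_norm T W = L2_norm T (\<lambda>x. z x - v x)" if T: "open T" "T \<subseteq> \<Omega>" for T
    proof (rule L2_norm_cong_AE)
      show "AE x in lebesgue_on T. W x = z x - v x"
        using W(2) T o(3) by (simp add: AE_restrict_space_iff) (auto elim: eventually_mono)
    qed (use L2_mono(1)[OF T(1) o(3) T(2)] W(3) zv in \<open>auto simp: L2_def\<close>)
    note m = L2_mono[OF o(1,3) sub(2)] L2_mono[OF o(2,3) sub(1)]
    have "L2_norm \<omega> W \<le> L2_norm \<omega> z + L2_norm \<omega> v"
      unfolding eq[OF o(1) sub(2)] by (rule L2_triangle_diff[OF m(1)[OF z] m(1)[OF v(1)]])
    then have 1: "L2_norm \<omega> W \<le> (1 + C) * D" using cD m(2)[OF v(1)] vD by (simp add: algebra_simps)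
    have "L2_norm \<Omega> W \<le> L2_norm \<Omega> z + L2_norm \<Omega> v"
      unfolding eq[OF o(3) subset_refl] by (rule L2_triangle_diff[OF z v(1)])
    also have "\<dots> \<le> (1 + C) * N"
    proof -
      have "0 \<le> C * L2_norm \<Omega> z" using C(1) by simp
      then show ?thesis using vD D0 by (simp add: N_def algebra_simps)
    qed
    finally have 2: "L2_norm \<Omega> W \<le> (1 + C) * N" .
    let ?P = "rpow D \<alpha> * rpow N (1 - \<alpha>)"
    have "L2_norm G W \<le> \<bar>C0\<bar> * (rpow (L2_norm \<omega> W) \<alpha> * rpow (L2_norm \<Omega> W) (1 - \<alpha>))"
      using C0[OF W(3,1)] mult_right_mono[OF abs_ge_self[of C0], of "rpow (L2_norm \<omega> W) \<alpha> * rpow (L2_norm \<Omega> W) (1 - \<alpha>)"]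
      by (simp add: rpow_nonneg mult.assoc)
    also have "\<dots> \<le> \<bar>C0\<bar> * (rpow ((1 + C) * D) \<alpha> * rpow ((1 + C) * N) (1 - \<alpha>))"
      using assms(9,10) 1 2 by (intro mult_left_mono mult_mono rpow_mono rpow_nonneg) auto
    also have "\<dots> = \<bar>C0\<bar> * (rpow (1 + C) \<alpha> * rpow (1 + C) (1 - \<alpha>)) * ?P"
      using C(1) D0 N0 by (simp add: rpow_mult mult_ac)
    \<comment> \<open>The exponents add up to 1, so the final constant does not depend on \<alpha>
      beyond \<open>C0\<close>.\<close>
    also have "rpow (1 + C) \<alpha> * rpow (1 + C) (1 - \<alpha>) = 1 + C"
      using C(1) assms(9) by (intro rpow_split) auto
    finally have GW: "L2_norm G W \<le> \<bar>C0\<bar> * (1 + C) * ?P" .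
    \<comment> \<open>The contribution of \<open>v\<close> is linear in \<open>D\<close>; splitting
      \<open>D\<close> by the exponents and using \<open>D\<close> \<le> \<open>N\<close> in one
      factor brings it into the interpolated form.\<close>
    have "D = rpow D \<alpha> * rpow D (1 - \<alpha>)" using D0 assms(9) by (simp add: rpow_split)
    also have "\<dots> \<le> ?P" using D0 N0 assms(10) by (intro mult_left_mono rpow_mono rpow_nonneg) auto
    finally have "C * D \<le> C * ?P" using C(1) by simp
    moreover have "L2_norm G z \<le> L2_norm G W + L2_norm G v"
    proof -
      have "L2_norm G (\<lambda>x. (z x - v x) + v x) \<le> L2_norm G (\<lambda>x. z x - v x) + L2_norm G v"
        by (rule L2_triangle[OF m(3)[OF zv] m(3)[OF v(1)]])
      then show ?thesis by (simp add: eq[OF o(2) sub(1)])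
    qed
    ultimately have "L2_norm G z \<le> (\<bar>C0\<bar> * (1 + C) + C) * ?P"
      using GW m(4)[OF v(1)] vD by (simp add: distrib_right)
    then show "L2_norm G z \<le> (\<bar>C0\<bar> * (1 + C) + C) * rpow (data_norm \<Omega> \<omega> (opA \<Omega> \<omega> z)) \<alpha>
             * rpow (L2_norm \<Omega> z + data_norm \<Omega> \<omega> (opA \<Omega> \<omega> z)) (1 - \<alpha>)"
      by (simp add: D_def N_def mult.assoc)
  qed
qed

end
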